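(* There exists $\hat\tau>0$ such that for all $0\le\tau\le\hat\tau$ the following hold. (i) For every $\alpha\in(0,1)$ there exists a unique $h^*_{\tau,\alpha}>0$ such that $$\Lambda(\tau,\alpha)=\mathcal F_{\tau,2h^*_{\tau,\alpha}}(E_{h^*_{\tau,\alpha},\alpha})=\inf_{h>0}\mathcal F_{\tau,2h}(E_{h,\alpha}).$$ Moreover $\lim_{\alpha\to0}h^*_{\tau,\alpha}=+\infty$ and $\lim_{\alpha\to1}h^*_{\tau,\alpha}=+\infty$. (ii) There exists $C_2>0$ such that $\sup_{\alpha\in(0,1)}|\partial_\alpha\Lambda(\tau,\alpha)|\le C_2$. (iii) The map $(0,1)\ni\alpha\mapsto\Lambda(\tau,\alpha)$ is strictly convex, with $$\partial_\alpha^2\Lambda(\tau,\alpha)\ge\tilde c\min\{\alpha^{q-1},(1-\alpha)^{q-1}\}$$ for some constant $\tilde c>0$ independent of $\alpha$.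
   Context: Fix $d\ge1$, $p\ge d+2$, $\beta=p-d-1$, $q=p-d+1$. For $\tau\ge0$ let $K_\tau(\zeta)=(\|\zeta\|_1+\tau^{1/\beta})^{-p}$ for $\zeta\in\mathbb R^d$, where $\|z\|_1=\sum_i|z_i|$. For $L>0$, $Q_L=[0,L)^d$ and a $Q_L$-periodic set $E\subset\mathbb R^d$ of locally finite perimeter with reduced boundary $\partial E$ and outer unit normal $\nu^E$, set $\mathrm{Per}_1(E,Q_L)=\int_{\partial E\cap Q_L}\|\nu^E\|_1\,d\mathcal H^{d-1}$ and $$\mathcal F_{\tau,L}(E)=\frac1{L^d}\Big(-\mathrm{Per}_1(E,Q_L)+\int_{\mathbb R^d}K_\tau(\zeta)\Big[\int_{\partial E\cap Q_L}\sum_{i=1}^d|\nu^E_i(x)||\zeta_i|\,d\mathcal H^{d-1}(x)-\int_{Q_L}|\chi_E(x)-\chi_E(x+\zeta)|\,dx\Big]d\zeta\Big).$$ For $h>0$, $\alpha\in(0,1)$ let $E_{h,\alpha}=\bigcup_{k\in\mathbb Z}[2kh,(2k+2\alpha)h)\times\mathbb R^{d-1}$ (periodic stripes of density $\alpha$ and period $2h$). Let $\mathcal C_{L,\alpha}$ be the set of $E\subset\mathbb R^d$ which, up to a permutation of coordinates, are of the form $\hat E\times\mathbb R^{d-1}$ with $\hat E\subset\mathbb R$ $L$-periodic and $|\hat E\cap[0,L)|/L=\alpha$, and $\Lambda(\tau,\alpha)=\inf_{L>0}\inf_{E\in\mathcal C_{L,\alpha}}\mathcal F_{\tau,L}(E)$.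 *)

theory Defs
  imports "HOL-Analysis.Analysis"
begin

definition ell1 :: "real^'n \<Rightarrow> real" where
  "ell1 z = (\<Sum>i\<in>UNIV. \<bar>z$i\<bar>)"

definition Kt :: "real \<Rightarrow> real \<Rightarrow> real^'n \<Rightarrow> real" where
  "Kt p \<tau> \<zeta> = (ell1 \<zeta> + \<tau> powr (1 / (p - real CARD('n) - 1))) powr (- p)"

text \<open>Reduced boundary of a one-dimensional set (points with density 1 on one side and 0 on the other).\<close>
definition bdry1 :: "real set \<Rightarrow> real set" where
  "bdry1 A = {x. \<exists>e>0.
      (measure lebesgue (A \<inter> {x-e<..<x}) = e \<and> measure lebesgue (A \<inter> {x<..<x+e}) = 0) \<or>
      (measure lebesgue (A \<inter> {x-e<..<x}) = 0 \<and> measure lebesgue (A \<inter> {x<..<x+e}) = e)}"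

text \<open>One-dimensional sets of locally finite perimeter: measurable, and near every point
  the set is a.e. empty or a.e. full on each side.\<close>
definition lfp1 :: "real set \<Rightarrow> bool" where
  "lfp1 A \<longleftrightarrow> A \<in> sets lebesgue \<and>
     (\<forall>x. \<exists>e>0. measure lebesgue (A \<inter> {x-e<..<x}) \<in> {0, e} \<and>
                 measure lebesgue (A \<inter> {x<..<x+e}) \<in> {0, e})"

definition cyl :: "'n \<Rightarrow> real set \<Rightarrow> (real^'n) set" where
  "cyl k A = {x. x$k \<in> A}"

definition QL :: "real \<Rightarrow> (real^'n) set" where
  "QL L = {x. \<forall>i. 0 \<le> x$i \<and> x$i < L}"

text \<open>The functional F_{tau,L} evaluated on the cylinder set E = {x. x$k \<in> A}.
  Its reduced boundary is bdry1 A x R^(d-1) with normal +-e_k, so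
  Per_1(E,Q_L) = L^(d-1) N and the boundary integral equals L^(d-1) N |zeta_k|,
  where N = #(bdry1 A \<inter> [0,L)).\<close>
definition Fcyl :: "real \<Rightarrow> real \<Rightarrow> real \<Rightarrow> 'n::finite \<Rightarrow> real set \<Rightarrow> real" where
  "Fcyl p \<tau> L k A =
    (let d = CARD('n); N = real (card (bdry1 A \<inter> {0..<L})); E = cyl k A in
      (1 / L ^ d) * ( - (L ^ (d - 1) * N)
        + (LINT \<zeta>|lebesgue. Kt p \<tau> \<zeta> *
             (L ^ (d - 1) * N * \<bar>\<zeta>$k\<bar>
              - (LINT x:QL L|lebesgue. \<bar>indicator E x - indicator E (x + \<zeta>)\<bar>)))))"

definition admissible :: "real \<Rightarrow> real \<Rightarrow> real set \<Rightarrow> bool" where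
  "admissible L \<alpha> A \<longleftrightarrow> lfp1 A \<and> (\<forall>x. x \<in> A \<longleftrightarrow> x + L \<in> A)
      \<and> measure lebesgue (A \<inter> {0..<L}) / L = \<alpha>"

definition Lambda :: "'n::finite itself \<Rightarrow> real \<Rightarrow> real \<Rightarrow> real \<Rightarrow> real" where
  "Lambda _ p \<tau> \<alpha> = Inf {Fcyl p \<tau> L (k::'n::finite) A | L k A. L > 0 \<and> admissible L \<alpha> A}"

definition stripe1 :: "real \<Rightarrow> real \<Rightarrow> real set" where
  "stripe1 h \<alpha> = (\<Union>j::int. {2 * of_int j * h ..< (2 * of_int j + 2 * \<alpha>) * h})"

definition strictly_convex_on :: "real set \<Rightarrow> (real \<Rightarrow> real) \<Rightarrow> bool" where
  "strictly_convex_on S f \<longleftrightarrow> (\<forall>x\<in>S. \<forall>y\<in>S. \<forall>t. x \<noteq> y \<and> 0 < t \<and> t < 1 \<longrightarrow>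
      f (t * x + (1 - t) * y) < t * f x + (1 - t) * f y)"

end

theory Submission
  imports Defs
begin

text \<open>
Writing the kernel as a Laplace integral,
\<open>c powr -p = 1 / Gamma p * \<integral>s. s powr (p - 1) * exp (- s * c)\<close> over \<open>s > 0\<close>,
reduces the functional on cylinders to a superposition of one-dimensional exponential interactions
with nonnegative weight \<open>K * s powr (p - d - 2) * exp (- e * s)\<close>, where \<open>e = \<tau> powr (1 / \<beta>)\<close>.

For a fixed \<open>s\<close> let \<open>Z t = s * \<integral>\<^sub>{w > t} exp (- s * (w - t)) * \<chi> w\<close>. Its values at consecutive interfaces satisfy
\<open>Z' - Z = tanh (s * l / 2) * (Z + Z' - 2 * f)\<close> on an interval of length \<open>l\<close> on which \<open>\<chi> = f\<close>, and the
interaction energy is a linear function of the jumps \<open>Z' - Z\<close>. Expanding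
\<open>\<Sum> tanh (s * l / 2) * (Z + Z' - c)\<^sup>2 \<ge> 0\<close> and using concavity of \<open>tanh\<close> bounds the energy from below
by that of the periodic stripes with the same density and number of interfaces,
for all \<open>s\<close> simultaneously.

The energy of stripes with half-widths \<open>x = \<alpha> * h\<close>, \<open>y = (1 - \<alpha>) * h\<close> is \<open>(\<Psi> x y - 1) / h\<close>, where \<open>\<Psi>\<close> is an
average of \<open>1 - 2 / (coth (s * x) + coth (s * y))\<close> and hence strictly convex. The
stationarity condition in \<open>h\<close> is \<open>\<Psi> - x * \<Psi>\<^sub>x - y * \<Psi>\<^sub>y = 1\<close>, whose left-hand side decreases along rays;
smallness of \<open>\<tau>\<close> makes it exceed 1 near the origin. The derivatives of the minimal energy
follow from the inverse function theorem, and its second derivative is the Hessian of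
\<open>\<Psi>\<close> in a suitable direction divided by \<open>h\<close>.
\<close>

section \<open>The kernel of periodic stripes\<close>

text \<open>The main obstacle is uniformity in \<alpha>: the optimal \<open>h\<close> diverges as
  \<alpha> tends to 0 or 1. At a stationary point, however, both half-widths are at least
  \<open>x\<^sub>0\<close> and the smaller one is at most \<open>X\<close>, with constants free of
  \<alpha>. Only the larger width \<open>y\<close> is unbounded, and \<open>h\<close> is at most
  \<open>X / min \<alpha> (1 - \<alpha>)\<close>. In the direction of \<open>y\<close> the lower
  bound for the Hessian is of order \<open>y powr - (r + 5)\<close>. The relevant direction has
  cross product \<open>h\<^sup>2\<close> with \<open>(x, y)\<close>, so squaring this and dividing
  by \<open>h\<close> leaves \<open>h powr - (r + 2)\<close>: this is the source of the exponent
  \<open>r + 2 = p - d = q - 1\<close>. A second obstacle is \<tau> = 0. The kernel is then so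
  singular at the origin that, for sets with interfaces, neither the perimeter part nor the nonlocal
  part is integrable by itself; only their nonnegative difference is. That difference is kept
  together and integrals are interchanged in the nonnegative setting.\<close>

definition stripe_kernel :: "real \<Rightarrow> real \<Rightarrow> real" where
  "stripe_kernel u v = 1 - 2 * (tanh u * tanh v / (tanh u + tanh v))"

text \<open>The partial derivative of \<open>stripe_kernel\<close> in its first argument. By
  symmetry the one in the second argument is \<open>stripe_kernel' v u\<close>, so
  \<open>stripe_kernel_diag\<close> and \<open>stripe_kernel_mixed\<close>, the derivatives of this
  function in \<open>u\<close> and \<open>v\<close>, give the whole Hessian after swapping
  arguments.\<close>

definition stripe_kernel' :: "real \<Rightarrow> real \<Rightarrow> real" where
  "stripe_kernel' u v = - 2 * (tanh v)\<^sup>2 * (1 - (tanh u)\<^sup>2) / (tanh u + tanh v)\<^sup>2"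

definition stripe_kernel_diag :: "real \<Rightarrow> real \<Rightarrow> real" where
  "stripe_kernel_diag u v =
    4 * (tanh v)\<^sup>2 * (1 - (tanh u)\<^sup>2) * (1 + tanh u * tanh v) / (tanh u + tanh v) ^ 3"

definition stripe_kernel_mixed :: "real \<Rightarrow> real \<Rightarrow> real" where
  "stripe_kernel_mixed u v =
    - 4 * tanh u * tanh v * (1 - (tanh u)\<^sup>2) * (1 - (tanh v)\<^sup>2) / (tanh u + tanh v) ^ 3"

lemma stripe_kernel_commute: "stripe_kernel u v = stripe_kernel v u"
  by (simp add: stripe_kernel_def mult.commute add.commute)

lemma stripe_kernel_mixed_commute: "stripe_kernel_mixed u v = stripe_kernel_mixed v u"
  unfolding stripe_kernel_mixed_def add.commute[of "tanh v"] by (simp only: mult_ac)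

lemma one_minus_tanh_le: "1 - tanh u \<le> 2 * exp (- 2 * u)" for u :: real
proof -
  have "1 - (1 - E) / (1 + E) = 2 * E / (1 + E)" if "E > 0" for E :: real
    using that by (simp add: divide_simps)
  then have "1 - tanh u = 2 * exp (- 2 * u) / (1 + exp (- 2 * u))"
    unfolding tanh_real_altdef using exp_gt_zero by blast
  also have "\<dots> \<le> 2 * exp (- 2 * u) / 1"
    by (intro divide_left_mono) (auto simp: add_pos_pos)
  finally show ?thesis by simp
qed

lemma one_minus_tanh_sq_nonneg: "0 \<le> 1 - (tanh u)\<^sup>2" for u :: real
  using tanh_real_bounds[of u] by (simp add: abs_square_le_1 abs_le_iff)

lemma one_minus_tanh_sq_le:
  fixes u :: real assumes "u \<ge> 0"
  shows "1 - (tanh u)\<^sup>2 \<le> 4 * exp (- 2 * u)"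
proof -
  have "1 - (tanh u)\<^sup>2 = (1 - tanh u) * (1 + tanh u)" by (simp add: power2_eq_square algebra_simps)
  also have "\<dots> \<le> (2 * exp (- 2 * u)) * 2"
    using tanh_real_bounds[of u] one_minus_tanh_le[of u] by (intro mult_mono) auto
  finally show ?thesis by simp
qed

text \<open>Follows from \<open>1 + 2 * u \<le> exp (2 * u)\<close>. The linear growth near 0
  controls the denominators \<open>tanh u + tanh v\<close> at small scales.\<close>

lemma tanh_ge:
  fixes u :: real assumes "u \<ge> 0"
  shows "u / (1 + u) \<le> tanh u"
proof -
  have *: "1 + 2 * u \<le> exp (2 * u)" by (rule exp_ge_add_one_self)
  have "(1 - inverse E) / (1 + inverse E) = (E - 1) / (E + 1)" if "E > 0" for E :: real
    using that by (simp add: divide_simps)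
  then have e: "tanh u = (exp (2 * u) - 1) / (exp (2 * u) + 1)"
    unfolding tanh_real_altdef mult_minus_left exp_minus using exp_gt_zero by blast
  have "u * (exp (2 * u) + 1) \<le> (exp (2 * u) - 1) * (1 + u)"
    using * by (simp add: algebra_simps)
  moreover have "exp (2 * u) + 1 > 0" "1 + u > 0" using assms by (simp_all add: add_pos_pos)
  ultimately show ?thesis unfolding e using assms by (simp add: divide_simps mult.commute)
qed

lemma DERIV_tanh: "(tanh has_real_derivative 1 - (tanh x)\<^sup>2) (at x)" for x :: real
  by (auto intro!: derivative_eq_intros)

text \<open>Concavity of \<open>tanh\<close> on the half-line, obtained as convexity of
  \<open>- tanh\<close>. In the form of a tangent bound, Jensen's inequality becomes a termwise
  estimate.\<close>

lemma tanh_le_tangent: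
  fixes u m :: real assumes "u \<ge> 0" "m \<ge> 0"
  shows "tanh u \<le> tanh m + (1 - (tanh m)\<^sup>2) * (u - m)"
proof -
  have "- (1 - (tanh m)\<^sup>2) * (u - m) \<le> - tanh u - - tanh m"
  proof (rule f''_imp_f'[of "{0..}"])
    fix x :: real
    show "((\<lambda>u. - tanh u) has_real_derivative - (1 - (tanh x)\<^sup>2)) (at x)"
      by (rule DERIV_minus[OF DERIV_tanh])
    show "((\<lambda>u. - (1 - (tanh u)\<^sup>2)) has_real_derivative 2 * tanh x * (1 - (tanh x)\<^sup>2)) (at x)"
      by (auto intro!: derivative_eq_intros)
    show "0 \<le> 2 * tanh x * (1 - (tanh x)\<^sup>2)" if "x \<in> {0..}"
      using that one_minus_tanh_sq_nonneg[of x] by simp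
  qed (use assms in auto)
  then show ?thesis by (simp add: algebra_simps)
qed

section \<open>Bounds and derivatives of the kernel\<close>

context
  fixes u v :: real
  assumes uv: "u > 0" "v > 0"
begin

text \<open>The kernel decreases in \<open>b = tanh v\<close>; at the limiting value
  \<open>b = 1\<close> it equals \<open>(1 - a) / (1 + a) = exp (- 2 * u)\<close>.\<close>

lemma stripe_kernel_ge: "exp (- 2 * u) \<le> stripe_kernel u v"
proof -
  define a b where "a = tanh u" and "b = tanh v"
  have ab: "0 < a" "a < 1" "0 < b" "b < 1"
    using uv by (auto simp: a_def b_def tanh_real_lt_1)
  have "a * b / (a + b) \<le> a / (1 + a)"
    using ab by (simp add: field_simps)
  moreover have "E = 1 - 2 * (((1 - E) / (1 + E)) / (1 + ((1 - E) / (1 + E))))" if "E > 0" for E :: real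
    using that by (simp add: divide_simps)
  then have "exp (- 2 * u) = 1 - 2 * (a / (1 + a))"
    unfolding a_def tanh_real_altdef using exp_gt_zero by blast
  ultimately show ?thesis by (simp add: stripe_kernel_def a_def b_def)
qed

text \<open>Bounded first by \<open>(1 - a) + (1 - b)\<close>: after clearing the denominator this
  is \<open>a\<^sup>2 + b\<^sup>2 \<le> a + b\<close> for \<open>a\<close>, \<open>b\<close> in the
  unit interval.\<close>

lemma stripe_kernel_le: "stripe_kernel u v \<le> 2 * exp (- 2 * u) + 2 * exp (- 2 * v)"
proof -
  define a b where "a = tanh u" and "b = tanh v"
  have ab: "0 < a" "a < 1" "0 < b" "b < 1"
    using uv by (auto simp: a_def b_def tanh_real_lt_1)
  have "1 - 2 * (a * b / (a + b)) \<le> (1 - a) + (1 - b)"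
  proof -
    have "(a + b) - 2 * (a * b) \<le> ((1 - a) + (1 - b)) * (a + b)"
      using ab mult_left_le[of a a] mult_left_le[of b b] by (simp add: algebra_simps add_mono)
    then show ?thesis using ab by (simp add: field_simps)
  qed
  then show ?thesis
    using one_minus_tanh_le[of u] one_minus_tanh_le[of v]
    by (simp add: stripe_kernel_def a_def b_def)
qed

lemma stripe_kernel'_nonpos: "stripe_kernel' u v \<le> 0"
  using one_minus_tanh_sq_nonneg[of u] by (simp add: stripe_kernel'_def divide_nonpos_nonneg)

lemma stripe_kernel'_ge: "- 2 * (1 - (tanh u)\<^sup>2) \<le> stripe_kernel' u v"
proof -
  have ab: "0 < tanh u" "0 < tanh v" using uv by auto
  have "(tanh v)\<^sup>2 / (tanh u + tanh v)\<^sup>2 \<le> 1"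
    using ab add_pos_pos[OF ab] by (subst divide_le_eq_1_pos) (auto intro!: power_mono)
  then have "(tanh v)\<^sup>2 / (tanh u + tanh v)\<^sup>2 * (2 * (1 - (tanh u)\<^sup>2)) \<le> 1 * (2 * (1 - (tanh u)\<^sup>2))"
    using one_minus_tanh_sq_nonneg[of u] by (intro mult_right_mono) auto
  moreover have "stripe_kernel' u v = - ((tanh v)\<^sup>2 / (tanh u + tanh v)\<^sup>2 * (2 * (1 - (tanh u)\<^sup>2)))"
    by (simp add: stripe_kernel'_def)
  ultimately show ?thesis by simp
qed

lemma abs_stripe_kernel'_le: "\<bar>stripe_kernel' u v\<bar> \<le> 8 * exp (- 2 * u)"
  using stripe_kernel'_nonpos stripe_kernel'_ge one_minus_tanh_sq_le[of u] uv by simp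

text \<open>Both second derivatives have the shape \<open>4 * q * c / (a + b) ^ 3\<close> with
  \<open>q\<close> at most \<open>2 * (a + b)\<^sup>2\<close> in absolute value, so two of the three
  factors in the denominator cancel. The remaining one is of order \<open>1 / s\<close> after
  scaling and is absorbed by the factor \<open>s\<^sup>2\<close>.\<close>

lemma abs_stripe_kernel_second_le:
  "\<bar>stripe_kernel_diag u v\<bar> \<le> 8 * (1 - (tanh u)\<^sup>2) / (tanh u + tanh v)" (is "_ \<le> ?B")
  "\<bar>stripe_kernel_mixed u v\<bar> \<le> 8 * (1 - (tanh u)\<^sup>2) / (tanh u + tanh v)"
proof -
  define a b where "a = tanh u" and "b = tanh v"
  have ab: "0 < a" "a < 1" "0 < b" "b < 1"
    using uv by (auto simp: a_def b_def tanh_real_lt_1)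
  define c d where "c = 1 - a\<^sup>2" and "d = 1 - b\<^sup>2"
  have c: "c \<ge> 0" and d: "d \<ge> 0" "d \<le> 1"
    using one_minus_tanh_sq_nonneg[of u] one_minus_tanh_sq_nonneg[of v] by (simp_all add: c_def d_def a_def b_def)
  have *: "\<bar>4 * q * c / (a + b) ^ 3\<bar> \<le> 8 * c / (a + b)" if "\<bar>q\<bar> \<le> (a + b)\<^sup>2 * 2" for q
  proof -
    have "\<bar>4 * q * c / (a + b) ^ 3\<bar> = 4 * \<bar>q\<bar> * c / (a + b) ^ 3"
      using ab c by (simp add: abs_mult abs_div_pos)
    also have "\<dots> \<le> 4 * ((a + b)\<^sup>2 * 2) * c / (a + b) ^ 3"
      using that ab c by (intro divide_right_mono mult_right_mono mult_left_mono) auto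
    finally show ?thesis using ab by (simp add: power2_eq_square power3_eq_cube)
  qed
  have "b\<^sup>2 * (1 + a * b) \<le> (a + b)\<^sup>2 * 2"
    using ab mult_le_one[of a b] by (intro mult_mono power_mono) auto
  then have "\<bar>4 * (b\<^sup>2 * (1 + a * b)) * c / (a + b) ^ 3\<bar> \<le> 8 * c / (a + b)"
    using ab by (intro *) simp
  then show "\<bar>stripe_kernel_diag u v\<bar> \<le> ?B"
    unfolding stripe_kernel_diag_def a_def[symmetric] b_def[symmetric] c_def[symmetric] by (simp only: mult_ac)
  have "a * b \<le> (a + b)\<^sup>2 * 2" using ab by (simp add: power2_eq_square algebra_simps)
  then have "a * b * d \<le> (a + b)\<^sup>2 * 2" using ab d by (meson mult_left_le mult_nonneg_nonneg less_imp_le order_trans)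
  then have "\<bar>4 * (- (a * b * d)) * c / (a + b) ^ 3\<bar> \<le> 8 * c / (a + b)"
    using ab d by (intro *) simp
  then show "\<bar>stripe_kernel_mixed u v\<bar> \<le> ?B"
    unfolding stripe_kernel_mixed_def a_def[symmetric] b_def[symmetric] c_def[symmetric] d_def[symmetric]
    by (simp add: mult_ac)
qed

lemma stripe_kernel_has_derivative:
  "((\<lambda>z. stripe_kernel (fst z) (snd z)) has_derivative
     (\<lambda>h. stripe_kernel' u v * fst h + stripe_kernel' v u * snd h)) (at (u, v))"
proof -
  define a b where "a = tanh u" and "b = tanh v"
  define c d where "c = 1 - a\<^sup>2" and "d = 1 - b\<^sup>2"
  have n: "a + b \<noteq> 0"
    using add_pos_pos[of a b] uv by (auto simp: a_def b_def)
  have A: "((\<lambda>z. tanh (fst z)) has_derivative (\<lambda>h. c * fst h)) (at (u, v))"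
    using DERIV_compose_FDERIV[OF DERIV_tanh has_derivative_fst[OF has_derivative_ident], of "(u, v)" UNIV]
    by (simp add: c_def a_def mult.commute)
  have B: "((\<lambda>z. tanh (snd z)) has_derivative (\<lambda>h. d * snd h)) (at (u, v))"
    using DERIV_compose_FDERIV[OF DERIV_tanh has_derivative_snd[OF has_derivative_ident], of "(u, v)" UNIV]
    by (simp add: d_def b_def mult.commute)
  have "((\<lambda>z. tanh (fst z) * tanh (snd z) / (tanh (fst z) + tanh (snd z))) has_derivative
      (\<lambda>h. ((a * (d * snd h) + c * fst h * b) * (a + b) - a * b * (c * fst h + d * snd h))
            / ((a + b) * (a + b)))) (at (u, v))"
    using has_derivative_divide'[OF has_derivative_mult[OF A B] has_derivative_add[OF A B]] n
    by (simp add: a_def b_def)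
  then have "((\<lambda>z. stripe_kernel (fst z) (snd z)) has_derivative
      (\<lambda>h. - 2 * (((a * (d * snd h) + c * fst h * b) * (a + b) - a * b * (c * fst h + d * snd h))
            / ((a + b) * (a + b))))) (at (u, v))"
    unfolding stripe_kernel_def
    by (rule has_derivative_eq_rhs[OF has_derivative_diff[OF has_derivative_const has_derivative_mult_right]])
       (simp only: diff_0 mult_minus_left)
  moreover have "- 2 * (((a * (d * y) + c * x * b) * (a + b) - a * b * (c * x + d * y)) / ((a + b) * (a + b)))
      = stripe_kernel' u v * x + stripe_kernel' v u * y" for x y
  proof -
    have "(a * (d * y) + c * x * b) * (a + b) - a * b * (c * x + d * y) = b * b * c * x + a * a * d * y"
      by (simp add: algebra_simps)
    then show ?thesis
      unfolding stripe_kernel'_def a_def[symmetric] b_def[symmetric] c_def[symmetric] d_def[symmetric]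
        add.commute[of b a]
      by (simp add: power2_eq_square add_divide_distrib algebra_simps)
  qed
  ultimately show ?thesis by simp
qed

lemma stripe_kernel'_has_derivative:
  "((\<lambda>z. stripe_kernel' (fst z) (snd z)) has_derivative
     (\<lambda>h. stripe_kernel_diag u v * fst h + stripe_kernel_mixed u v * snd h)) (at (u, v))"
proof -
  define a b where "a = tanh u" and "b = tanh v"
  define c d where "c = 1 - a\<^sup>2" and "d = 1 - b\<^sup>2"
  have n: "a + b \<noteq> 0"
    using add_pos_pos[of a b] uv by (auto simp: a_def b_def)
  have A: "((\<lambda>z. tanh (fst z)) has_derivative (\<lambda>h. c * fst h)) (at (u, v))"
    using DERIV_compose_FDERIV[OF DERIV_tanh has_derivative_fst[OF has_derivative_ident], of "(u, v)" UNIV]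
    by (simp add: c_def a_def mult.commute)
  have B: "((\<lambda>z. tanh (snd z)) has_derivative (\<lambda>h. d * snd h)) (at (u, v))"
    using DERIV_compose_FDERIV[OF DERIV_tanh has_derivative_snd[OF has_derivative_ident], of "(u, v)" UNIV]
    by (simp add: d_def b_def mult.commute)
  have N: "((\<lambda>z. - 2 * (tanh (snd z) * tanh (snd z)) * (1 - tanh (fst z) * tanh (fst z))) has_derivative
      (\<lambda>h. - 4 * b * c * d * snd h + 4 * b * b * a * c * fst h)) (at (u, v))"
    by (auto intro!: derivative_eq_intros A B simp: a_def[symmetric] b_def[symmetric] c_def power2_eq_square
         algebra_simps)
  have D: "((\<lambda>z. (tanh (fst z) + tanh (snd z)) * (tanh (fst z) + tanh (snd z))) has_derivative
      (\<lambda>h. 2 * (a + b) * (c * fst h + d * snd h))) (at (u, v))"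
    by (auto intro!: derivative_eq_intros A B simp: a_def[symmetric] b_def[symmetric] algebra_simps)
  have "((\<lambda>z. stripe_kernel' (fst z) (snd z)) has_derivative
      (\<lambda>h. ((- 4 * b * c * d * snd h + 4 * b * b * a * c * fst h) * ((a + b) * (a + b))
        - (- 2 * (b * b) * (1 - a * a)) * (2 * (a + b) * (c * fst h + d * snd h)))
            / (((a + b) * (a + b)) * ((a + b) * (a + b))))) (at (u, v))"
    using has_derivative_divide'[OF N D] n
    by (simp add: stripe_kernel'_def power2_eq_square a_def[symmetric] b_def[symmetric])
  moreover have "((- 4 * b * c * d * y + 4 * b * b * a * c * x) * ((a + b) * (a + b))
        - (- 2 * (b * b) * (1 - a * a)) * (2 * (a + b) * (c * x + d * y)))
            / (((a + b) * (a + b)) * ((a + b) * (a + b)))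
      = stripe_kernel_diag u v * x + stripe_kernel_mixed u v * y" for x y
  proof -
    have c: "1 - a * a = c" by (simp add: c_def power2_eq_square)
    have "(- 4 * b * c * d * y + 4 * b * b * a * c * x) * ((a + b) * (a + b))
        - (- 2 * (b * b) * c) * (2 * (a + b) * (c * x + d * y))
      = (a + b) * (4 * b * b * c * (a * a + a * b + c) * x - 4 * a * b * c * d * y)"
      by (simp add: algebra_simps)
    also have "a * a + a * b + c = 1 + a * b" by (simp add: c_def power2_eq_square)
    finally have *: "(- 4 * b * c * d * y + 4 * b * b * a * c * x) * ((a + b) * (a + b))
        - (- 2 * (b * b) * c) * (2 * (a + b) * (c * x + d * y))
      = (a + b) * (4 * b * b * c * (1 + a * b) * x - 4 * a * b * c * d * y)" .
    have **: "(a + b) * X / ((a + b) * (a + b) * ((a + b) * (a + b))) = X / (a + b) ^ 3" for X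
      using n by (simp add: power3_eq_cube)
    show ?thesis
      unfolding stripe_kernel_diag_def stripe_kernel_mixed_def a_def[symmetric] b_def[symmetric]
        c_def[symmetric] d_def[symmetric] c * **
      by (simp add: power2_eq_square diff_divide_distrib)
  qed
  ultimately show ?thesis by simp
qed

text \<open>The difference of the two sides is a multiple of the square of
  \<open>b (1 - a\<^sup>2) x - a (1 - b\<^sup>2) y\<close>, where \<open>a = tanh u\<close> and \<open>b = tanh v\<close>.\<close>

lemma stripe_kernel_hessian_ge:
  "4 / (tanh u + tanh v)\<^sup>2 * ((tanh v)\<^sup>2 * tanh u * (1 - (tanh u)\<^sup>2) * x\<^sup>2
      + (tanh u)\<^sup>2 * tanh v * (1 - (tanh v)\<^sup>2) * y\<^sup>2)
    \<le> stripe_kernel_diag u v * x\<^sup>2 + 2 * stripe_kernel_mixed u v * x * y + stripe_kernel_diag v u * y\<^sup>2"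
  (is "?L \<le> ?R")
proof -
  define a b where "a = tanh u" and "b = tanh v"
  have ab: "0 < a" "0 < b"
    using uv by (auto simp: a_def b_def)
  define c d where "c = 1 - a\<^sup>2" and "d = 1 - b\<^sup>2"
  have n: "a + b \<noteq> 0" using ab by auto
  have L: "?L = 4 * (b\<^sup>2 * a * c * x\<^sup>2 + a\<^sup>2 * b * d * y\<^sup>2) * (a + b) / (a + b) ^ 3"
    unfolding a_def[symmetric] b_def[symmetric] c_def[symmetric] d_def[symmetric]
    using n by (simp add: power2_eq_square power3_eq_cube)
  have R: "?R = (4 * b\<^sup>2 * c * (1 + a * b) * x\<^sup>2 - 8 * a * b * c * d * x * y
      + 4 * a\<^sup>2 * d * (1 + a * b) * y\<^sup>2) / (a + b) ^ 3"
    unfolding stripe_kernel_diag_def stripe_kernel_mixed_def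
      a_def[symmetric] b_def[symmetric] c_def[symmetric] d_def[symmetric] add.commute[of b a]
    by (simp add: diff_divide_distrib add_divide_distrib mult.commute[of b a])
  have "4 * b\<^sup>2 * c * (1 + a * b) * x\<^sup>2 - 8 * a * b * c * d * x * y + 4 * a\<^sup>2 * d * (1 + a * b) * y\<^sup>2
      - 4 * (b\<^sup>2 * a * c * x\<^sup>2 + a\<^sup>2 * b * d * y\<^sup>2) * (a + b)
      = 4 * b\<^sup>2 * c * (1 - a\<^sup>2) * x\<^sup>2 - 8 * a * b * c * d * x * y + 4 * a\<^sup>2 * d * (1 - b\<^sup>2) * y\<^sup>2"
    by (simp add: algebra_simps power2_eq_square)
  also have "\<dots> = 4 * (b * c * x - a * d * y)\<^sup>2"
    unfolding c_def[symmetric] d_def[symmetric] by (simp add: algebra_simps power2_eq_square)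
  finally have "?R - ?L = 4 * (b * c * x - a * d * y)\<^sup>2 / (a + b) ^ 3"
    unfolding L R diff_divide_distrib[symmetric] by simp
  also have "\<dots> \<ge> 0" using ab by simp
  finally show ?thesis by simp
qed

end

section \<open>Laplace weights\<close>

text \<open>Differentiation under the integral sign by dominated convergence of the remainder
  quotients. The mean value inequality on the convex set \<open>U\<close> bounds the increment by
  \<open>B s\<close>, the linear part costs another \<open>B s\<close>, hence the dominating
  function \<open>2 * B s\<close>.\<close>

lemma has_derivative_lebesgue_integral:
  fixes \<phi> :: "'a::{real_normed_vector, perfect_space} \<Rightarrow> 'b \<Rightarrow> real"
  assumes U: "open U" "convex U" "z\<^sub>0 \<in> U"
    and \<phi>: "\<And>z. z \<in> U \<Longrightarrow> integrable M (\<phi> z)"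
    and D: "\<And>h. (\<lambda>s. D z\<^sub>0 s h) \<in> borel_measurable M"
    and B: "integrable M B"
    and der: "AE s in M. \<forall>z\<in>U. ((\<lambda>z. \<phi> z s) has_derivative D z s) (at z)"
    and bound: "AE s in M. \<forall>z\<in>U. \<forall>h. \<bar>D z s h\<bar> \<le> B s * norm h"
  shows "((\<lambda>z. \<integral>s. \<phi> z s \<partial>M) has_derivative (\<lambda>h. \<integral>s. D z\<^sub>0 s h \<partial>M)) (at z\<^sub>0)"
proof -
  have intD: "integrable M (\<lambda>s. D z\<^sub>0 s h)" for h
  proof (rule Bochner_Integration.integrable_bound[OF integrable_mult_left[OF B, of "norm h"]])
    show "AE s in M. norm (D z\<^sub>0 s h) \<le> norm (B s * norm h)"
      using bound
    proof eventually_elim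
      case (elim s)
      then have "\<bar>D z\<^sub>0 s h\<bar> \<le> B s * norm h" using U(3) by blast
      then show ?case by simp
    qed
  qed (rule D)
  have lin: "AE s in M. bounded_linear (D z\<^sub>0 s)"
    using der by eventually_elim (use U has_derivative_bounded_linear in blast)
  have bl: "bounded_linear (\<lambda>h. \<integral>s. D z\<^sub>0 s h \<partial>M)"
  proof (rule bounded_linear_intro[where K = "\<integral>s. B s \<partial>M"])
    fix x y
    have "(\<integral>s. D z\<^sub>0 s (x + y) \<partial>M) = (\<integral>s. D z\<^sub>0 s x + D z\<^sub>0 s y \<partial>M)"
      by (rule integral_cong_AE) (use lin D in \<open>auto elim!: eventually_mono simp: linear_add bounded_linear.linear\<close>)
    then show "(\<integral>s. D z\<^sub>0 s (x + y) \<partial>M) = (\<integral>s. D z\<^sub>0 s x \<partial>M) + (\<integral>s. D z\<^sub>0 s y \<partial>M)"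
      by (simp add: intD)
  next
    fix r :: real and x
    have "(\<integral>s. D z\<^sub>0 s (r *\<^sub>R x) \<partial>M) = (\<integral>s. r * D z\<^sub>0 s x \<partial>M)"
      by (rule integral_cong_AE) (use lin D in \<open>auto elim!: eventually_mono simp: linear_cmul bounded_linear.linear\<close>)
    then show "(\<integral>s. D z\<^sub>0 s (r *\<^sub>R x) \<partial>M) = r *\<^sub>R (\<integral>s. D z\<^sub>0 s x \<partial>M)"
      by simp
  next
    fix x
    have "norm (\<integral>s. D z\<^sub>0 s x \<partial>M) \<le> (\<integral>s. B s * norm x \<partial>M)"
      by (rule order_trans[OF integral_norm_bound integral_mono_AE[OF integrable_norm[OF intD] integrable_mult_left[OF B]]])
        (use bound U in \<open>auto elim!: eventually_mono\<close>)
    then show "norm (\<integral>s. D z\<^sub>0 s x \<partial>M) \<le> norm x * (\<integral>s. B s \<partial>M)"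
      by (simp add: mult.commute)
  qed
  have "((\<lambda>z. ((\<integral>s. \<phi> z s \<partial>M) - (\<integral>s. \<phi> z\<^sub>0 s \<partial>M) - (\<integral>s. D z\<^sub>0 s (z - z\<^sub>0) \<partial>M)) / norm (z - z\<^sub>0))
      \<longlongrightarrow> 0) (at z\<^sub>0)" (is "(?q \<longlongrightarrow> 0) _")
    unfolding tendsto_at_iff_sequentially
  proof (intro allI impI)
    fix X assume X: "\<forall>i. X i \<in> UNIV - {z\<^sub>0}" "X \<longlonglongrightarrow> z\<^sub>0"
    \<comment> \<open>The domination holds on \<open>U\<close> only, so the terms of the sequence
      before it enters \<open>U\<close> are dropped.\<close>
    obtain N where N: "\<And>n. n \<ge> N \<Longrightarrow> X n \<in> U"
      using topological_tendstoD[OF X(2) U(1,3)] by (auto simp: eventually_sequentially)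
    define Y where "Y n = X (n + N)" for n
    have Y: "Y n \<in> U" "Y n \<noteq> z\<^sub>0" for n
      using N[of "n + N"] X(1) by (auto simp: Y_def)
    have Y0: "Y \<longlonglongrightarrow> z\<^sub>0" unfolding Y_def using X(2) by (rule LIMSEQ_ignore_initial_segment)
    define q where "q n s = (\<phi> (Y n) s - \<phi> z\<^sub>0 s - D z\<^sub>0 s (Y n - z\<^sub>0)) / norm (Y n - z\<^sub>0)" for n s
    have "(\<lambda>n. \<integral>s. q n s \<partial>M) \<longlonglongrightarrow> (\<integral>s. 0 \<partial>M)"
    proof (rule integral_dominated_convergence[where w = "\<lambda>s. 2 * B s"])
      show "q n \<in> borel_measurable M" for n
        unfolding q_def using \<phi>[OF Y(1)] \<phi>[OF U(3)] D[of "Y n - z\<^sub>0"] by simp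
      show "AE s in M. (\<lambda>n. q n s) \<longlonglongrightarrow> 0"
        using der
      proof eventually_elim
        case (elim s)
        then have "((\<lambda>z. (\<phi> z s - \<phi> z\<^sub>0 s - D z\<^sub>0 s (z - z\<^sub>0)) /\<^sub>R norm (z - z\<^sub>0)) \<longlongrightarrow> 0) (at z\<^sub>0)"
          using U(3) unfolding has_derivative_at_within by blast
        then show ?case
          using Y Y0 unfolding tendsto_at_iff_sequentially
          by (auto simp: q_def o_def divide_inverse mult.commute)
      qed
      show "AE s in M. norm (q n s) \<le> 2 * B s" for n
        using der bound
      proof eventually_elim
        case (elim s)
        have "norm (\<phi> (Y n) s - \<phi> z\<^sub>0 s) \<le> B s * norm (Y n - z\<^sub>0)"
        proof (rule differentiable_bound[OF U(2)])
          show "((\<lambda>z. \<phi> z s) has_derivative D z s) (at z within U)" if "z \<in> U" for z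
            using elim that has_derivative_at_withinI by blast
          show "onorm (D z s) \<le> B s" if "z \<in> U" for z
            by (rule onorm_le) (use elim that in auto)
        qed (use Y U in auto)
        moreover have "\<bar>D z\<^sub>0 s (Y n - z\<^sub>0)\<bar> \<le> B s * norm (Y n - z\<^sub>0)" using elim U by auto
        ultimately show ?case
          using Y(2)[of n] by (simp add: q_def divide_simps)
      qed
    qed (use B in auto)
    moreover have "(\<integral>s. q n s \<partial>M) = ?q (Y n)" for n
      unfolding q_def using \<phi>[OF Y(1)] \<phi>[OF U(3)] intD by simp
    ultimately have "(\<lambda>n. (?q \<circ> X) (n + N)) \<longlonglongrightarrow> 0" by (simp add: Y_def)
    then show "(?q \<circ> X) \<longlonglongrightarrow> 0" by (rule LIMSEQ_offset)
  qed
  from tendsto_norm_zero[OF this] bl show ?thesis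
    unfolding has_derivative_iff_norm by simp
qed

text \<open>For \<open>e = 0\<close>, that is \<tau> = 0, and \<open>r \<ge> 0\<close> this measure
  has infinite mass, so every integrand below must supply its own exponential decay in
  \<open>s\<close>.\<close>

definition laplace_weight :: "real \<Rightarrow> real \<Rightarrow> real \<Rightarrow> real measure" where
  "laplace_weight K r e = density lborel (\<lambda>s. ennreal (indicator {0<..} s * (K * s powr r * exp (- (e * s)))))"

lemma sets_laplace_weight [simp, measurable_cong]: "sets (laplace_weight K r e) = sets borel"
  and space_laplace_weight [simp]: "space (laplace_weight K r e) = UNIV"
  by (simp_all add: laplace_weight_def)

lemma AE_laplace_weight: "AE s in laplace_weight K r e. 0 < s"
  unfolding laplace_weight_def by (subst AE_density) (auto simp: indicator_def)

text \<open>Euler's integral for \<open>Gamma\<close> under the substitution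
  \<open>t = c * s\<close>. The nonnegative version is what Tonelli's theorem consumes
  later.\<close>

lemma nn_integral_powr_exp:
  fixes c r :: real
  assumes "c > 0" "r > -1"
  shows "(\<integral>\<^sup>+s. ennreal (indicator {0<..} s * (s powr r * exp (- (c * s)))) \<partial>lborel)
         = ennreal (Gamma (r + 1) / c powr (r + 1))"
proof -
  define g :: "real \<Rightarrow> ennreal" where "g t = ennreal (indicator {0..} t * t powr r / exp t)" for t
  have [measurable]: "g \<in> borel_measurable borel" unfolding g_def by measurable
  have "ennreal (Gamma (r + 1)) = (\<integral>\<^sup>+t. g t \<partial>lborel)"
    unfolding g_def using Gamma_conv_nn_integral_real[of "r + 1"] assms by simp
  also have "\<dots> = ennreal c * (\<integral>\<^sup>+t. g (c * t) \<partial>lborel)"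
    using nn_integral_real_affine[of g c 0] assms by simp
  also have "(\<integral>\<^sup>+t. g (c * t) \<partial>lborel)
      = (\<integral>\<^sup>+s. ennreal (c powr r) * ennreal (indicator {0<..} s * (s powr r * exp (- (c * s)))) \<partial>lborel)"
  proof (rule nn_integral_cong_AE)
    show "AE s in lborel. g (c * s)
        = ennreal (c powr r) * ennreal (indicator {0<..} s * (s powr r * exp (- (c * s))))"
      using AE_lborel_singleton[of "0::real"]
    proof eventually_elim
      case (elim s)
      then show ?case using assms
        by (cases "s > 0") (auto simp: g_def powr_mult exp_minus divide_inverse ennreal_mult'[symmetric]
          zero_le_mult_iff mult_ac)
    qed
  qed
  also have "\<dots> = ennreal (c powr r) * (\<integral>\<^sup>+s. ennreal (indicator {0<..} s * (s powr r * exp (- (c * s)))) \<partial>lborel)"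
    (is "_ = _ * ?I") by (rule nn_integral_cmult) measurable
  finally have *: "ennreal (Gamma (r + 1)) = ennreal c * (ennreal (c powr r) * ?I)" .
  define J where "J = ?I"
  have "ennreal (1 / c powr (r + 1)) * (ennreal c * (ennreal (c powr r) * J))
      = ennreal (1 / c powr (r + 1) * c * c powr r) * J"
    using assms by (simp add: mult.assoc[symmetric] ennreal_mult'[symmetric])
  also have "1 / c powr (r + 1) * c * c powr r = 1"
    using assms by (simp add: powr_add)
  finally have "J = ennreal (1 / c powr (r + 1)) * ennreal (Gamma (r + 1))"
    using * by (simp add: J_def)
  also have "\<dots> = ennreal (Gamma (r + 1) / c powr (r + 1))"
    by (simp add: ennreal_mult'[symmetric])
  finally show ?thesis by (simp add: J_def)
qed

locale laplace =
  fixes K r e :: real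
  assumes K: "K > 0" and r: "r \<ge> 0" and e: "e \<ge> 0"
begin

abbreviation M where "M \<equiv> laplace_weight K r e"

lemma has_bochner_integral_laplace_weight:
  assumes "c > 0"
  shows "has_bochner_integral M (\<lambda>s. s ^ k * exp (- (c * s)))
           (K * Gamma (r + real k + 1) / (c + e) powr (r + real k + 1))"
proof (rule has_bochner_integral_nn_integral)
  show "(\<lambda>s. s ^ k * exp (- (c * s))) \<in> borel_measurable M" by measurable
  show "AE s in M. 0 \<le> s ^ k * exp (- (c * s))"
    using AE_laplace_weight by eventually_elim auto
  show "0 \<le> K * Gamma (r + real k + 1) / (c + e) powr (r + real k + 1)"
    using K r by (auto intro!: divide_nonneg_nonneg mult_nonneg_nonneg Gamma_real_nonneg)
  have "(\<integral>\<^sup>+s. ennreal (s ^ k * exp (- (c * s))) \<partial>M)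
      = (\<integral>\<^sup>+s. ennreal K * ennreal (indicator {0<..} s * (s powr (r + real k) * exp (- ((c + e) * s)))) \<partial>lborel)"
    unfolding laplace_weight_def
  proof (subst nn_integral_density, measurable, rule nn_integral_cong)
    fix s :: real
    show "ennreal (indicator {0<..} s * (K * s powr r * exp (- (e * s)))) * ennreal (s ^ k * exp (- (c * s)))
      = ennreal K * ennreal (indicator {0<..} s * (s powr (r + real k) * exp (- ((c + e) * s))))"
    proof (cases "s > 0")
      case True
      have "exp (- ((c + e) * s)) = exp (- (e * s)) * exp (- (c * s))"
        by (simp add: exp_add[symmetric] algebra_simps)
      then show ?thesis using True K
        by (simp add: ennreal_mult'[symmetric] powr_add powr_realpow mult_ac)
    qed simp
  qed
  also have "\<dots> = ennreal K * ennreal (Gamma (r + real k + 1) / (c + e) powr (r + real k + 1))"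
    using nn_integral_powr_exp[of "c + e" "r + real k"] assms e r
    by (subst nn_integral_cmult) auto
  also have "\<dots> = ennreal (K * Gamma (r + real k + 1) / (c + e) powr (r + real k + 1))"
    using K by (simp add: ennreal_mult'[symmetric])
  finally show "(\<integral>\<^sup>+s. ennreal (s ^ k * exp (- (c * s))) \<partial>M)
      = ennreal (K * Gamma (r + real k + 1) / (c + e) powr (r + real k + 1))" .
qed

lemma integrable_laplace_weight:
  assumes "c > 0"
  shows "integrable M (\<lambda>s. s ^ k * exp (- (c * s)))"
  using has_bochner_integral_laplace_weight[OF assms] by (auto simp: has_bochner_integral_iff)

end

lemma borel_measurable_tanh [measurable]: "(tanh :: real \<Rightarrow> real) \<in> borel_measurable borel"
  by (intro borel_measurable_continuous_onI continuous_intros) (auto simp: cosh_real_pos less_imp_neq[symmetric])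

lemma borel_measurable_stripe_kernel [measurable]:
  "(\<lambda>s. stripe_kernel (s * x) (s * y)) \<in> borel_measurable borel"
  "(\<lambda>s. stripe_kernel' (s * x) (s * y)) \<in> borel_measurable borel"
  "(\<lambda>s. stripe_kernel_diag (s * x) (s * y)) \<in> borel_measurable borel"
  "(\<lambda>s. stripe_kernel_mixed (s * x) (s * y)) \<in> borel_measurable borel"
  unfolding stripe_kernel_def stripe_kernel'_def stripe_kernel_diag_def stripe_kernel_mixed_def
  by measurable

section \<open>Dominating functions for the scaled kernel\<close>

context
  fixes s m x y :: real
  assumes pos: "s > 0" "m > 0" and mx: "m \<le> x" and my: "m \<le> y"
begin

text \<open>Here and in the next lemmas the bound depends on \<open>x\<close> and \<open>y\<close>
  only through a common lower bound \<open>m\<close>, so a single dominating function serves a whole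
  neighbourhood of a point.\<close>

lemma abs_stripe_kernel_scaled_le: "\<bar>stripe_kernel (s * x) (s * y)\<bar> \<le> 4 * exp (- (2 * m * s))"
proof -
  have p: "s * x > 0" "s * y > 0" using pos mx my by auto
  have "exp (- 2 * (s * x)) \<le> exp (- (2 * m * s))" "exp (- 2 * (s * y)) \<le> exp (- (2 * m * s))"
    using pos mx my by (auto simp: mult.commute)
  then show ?thesis
    using stripe_kernel_le[OF p] stripe_kernel_ge[OF p] exp_gt_zero[of "- 2 * (s * x)"] by linarith
qed

lemma abs_stripe_kernel'_scaled_le: "\<bar>s * stripe_kernel' (s * x) (s * y)\<bar> \<le> 8 * (s * exp (- (2 * m * s)))"
proof -
  have p: "s * x > 0" "s * y > 0" using pos mx my by auto
  have "exp (- 2 * (s * x)) \<le> exp (- (2 * m * s))" using pos mx by (auto simp: mult.commute)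
  then have "\<bar>stripe_kernel' (s * x) (s * y)\<bar> \<le> 8 * exp (- (2 * m * s))"
    using abs_stripe_kernel'_le[OF p] by linarith
  then have "s * \<bar>stripe_kernel' (s * x) (s * y)\<bar> \<le> s * (8 * exp (- (2 * m * s)))"
    using pos by (intro mult_left_mono) auto
  then show ?thesis using pos by (simp add: abs_mult)
qed

text \<open>Estimating the denominator by \<open>tanh_ge\<close> costs a factor
  \<open>(1 + s * m) / (s * m)\<close>; multiplied by
  \<open>32 * s\<^sup>2 * exp (- (2 * m * s))\<close> it splits into the two terms on the
  right.\<close>

lemma scaled_second_bound:
  "s\<^sup>2 * (8 * (1 - (tanh (s * x))\<^sup>2) / (tanh (s * x) + tanh (s * y)))
    \<le> 32 * (s * exp (- (2 * m * s))) / m + 32 * (s\<^sup>2 * exp (- (2 * m * s)))"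
proof -
  have p: "s * x > 0" "s * y > 0" "s * m > 0" using pos mx my by auto
  have "exp (- 2 * (s * x)) \<le> exp (- (2 * m * s))" using pos mx by (auto simp: mult.commute)
  then have 1: "1 - (tanh (s * x))\<^sup>2 \<le> 4 * exp (- (2 * m * s))"
    using one_minus_tanh_sq_le[of "s * x"] p by linarith
  have "s * m / (1 + s * m) \<le> tanh (s * m)" using p by (intro tanh_ge) auto
  also have "\<dots> \<le> tanh (s * x)" using pos mx by simp
  also have "\<dots> \<le> tanh (s * x) + tanh (s * y)" using p by simp
  finally have 2: "s * m / (1 + s * m) \<le> tanh (s * x) + tanh (s * y)" .
  have "8 * (1 - (tanh (s * x))\<^sup>2) / (tanh (s * x) + tanh (s * y))
      \<le> 8 * (4 * exp (- (2 * m * s))) / (s * m / (1 + s * m))"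
    using 1 2 p one_minus_tanh_sq_nonneg[of "s * x"] by (intro frac_le) auto
  then have "s\<^sup>2 * (8 * (1 - (tanh (s * x))\<^sup>2) / (tanh (s * x) + tanh (s * y)))
      \<le> s\<^sup>2 * (8 * (4 * exp (- (2 * m * s))) / (s * m / (1 + s * m)))"
    by (intro mult_left_mono) auto
  also have "\<dots> = 32 * (s * exp (- (2 * m * s))) / m + 32 * (s\<^sup>2 * exp (- (2 * m * s)))"
    using pos p by (simp add: field_simps power2_eq_square)
  finally show ?thesis .
qed

lemma abs_stripe_kernel_second_scaled_le:
  "\<bar>s\<^sup>2 * stripe_kernel_diag (s * x) (s * y)\<bar>
    \<le> 32 * (s * exp (- (2 * m * s))) / m + 32 * (s\<^sup>2 * exp (- (2 * m * s)))" (is ?A)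
  "\<bar>s\<^sup>2 * stripe_kernel_mixed (s * x) (s * y)\<bar>
    \<le> 32 * (s * exp (- (2 * m * s))) / m + 32 * (s\<^sup>2 * exp (- (2 * m * s)))" (is ?B)
proof -
  have p: "s * x > 0" "s * y > 0" using pos mx my by auto
  show ?A
    using mult_left_mono[OF abs_stripe_kernel_second_le(1)[OF p], of "s\<^sup>2"] scaled_second_bound
    by (simp add: abs_mult)
  show ?B
    using mult_left_mono[OF abs_stripe_kernel_second_le(2)[OF p], of "s\<^sup>2"] scaled_second_bound
    by (simp add: abs_mult)
qed

end

section \<open>The averaged kernel and its derivatives\<close>

context laplace
begin

definition \<Psi> :: "real \<Rightarrow> real \<Rightarrow> real" where
  "\<Psi> x y = (\<integral>s. stripe_kernel (s * x) (s * y) \<partial>M)"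

definition \<Psi>' :: "real \<Rightarrow> real \<Rightarrow> real" where
  "\<Psi>' x y = (\<integral>s. s * stripe_kernel' (s * x) (s * y) \<partial>M)"

definition \<Psi>_diag :: "real \<Rightarrow> real \<Rightarrow> real" where
  "\<Psi>_diag x y = (\<integral>s. s\<^sup>2 * stripe_kernel_diag (s * x) (s * y) \<partial>M)"

definition \<Psi>_mixed :: "real \<Rightarrow> real \<Rightarrow> real" where
  "\<Psi>_mixed x y = (\<integral>s. s\<^sup>2 * stripe_kernel_mixed (s * x) (s * y) \<partial>M)"

lemma \<Psi>_commute: "\<Psi> x y = \<Psi> y x"
  by (simp add: \<Psi>_def stripe_kernel_commute)

lemma \<Psi>_mixed_commute: "\<Psi>_mixed x y = \<Psi>_mixed y x"
  by (simp add: \<Psi>_mixed_def stripe_kernel_mixed_commute)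

lemma integrable_exp_bounds:
  assumes "m > 0"
  shows "integrable M (\<lambda>s. exp (- (2 * m * s)))" "integrable M (\<lambda>s. s * exp (- (2 * m * s)))"
    "integrable M (\<lambda>s. s\<^sup>2 * exp (- (2 * m * s)))"
  using integrable_laplace_weight[of "2 * m" 0] integrable_laplace_weight[of "2 * m" 1]
    integrable_laplace_weight[of "2 * m" 2] assms by simp_all

context
  fixes x y :: real
  assumes x: "x > 0" and y: "y > 0"
begin

lemma integrable_\<Psi>: "integrable M (\<lambda>s. stripe_kernel (s * x) (s * y))"
proof (rule Bochner_Integration.integrable_bound)
  show "integrable M (\<lambda>s. 4 * exp (- (2 * min x y * s)))"
    using integrable_exp_bounds(1)[of "min x y"] x y by (intro integrable_mult_right) auto
  show "AE s in M. norm (stripe_kernel (s * x) (s * y)) \<le> norm (4 * exp (- (2 * min x y * s)))"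
    using AE_laplace_weight
    by eventually_elim (use abs_stripe_kernel_scaled_le[of _ "min x y" x y] x y in auto)
qed (use x y in auto)

lemma integrable_\<Psi>': "integrable M (\<lambda>s. s * stripe_kernel' (s * x) (s * y))"
proof (rule Bochner_Integration.integrable_bound)
  show "integrable M (\<lambda>s. 8 * (s * exp (- (2 * min x y * s))))"
    using integrable_exp_bounds(2)[of "min x y"] x y by (intro integrable_mult_right) auto
  show "AE s in M. norm (s * stripe_kernel' (s * x) (s * y)) \<le> norm (8 * (s * exp (- (2 * min x y * s))))"
    using AE_laplace_weight
  proof eventually_elim
    case (elim s)
    have "\<bar>s * stripe_kernel' (s * x) (s * y)\<bar> \<le> 8 * (s * exp (- (2 * min x y * s)))"
      using elim x y by (intro abs_stripe_kernel'_scaled_le) auto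
    then show ?case unfolding real_norm_def by linarith
  qed
qed (use x y in auto)

lemma integrable_second_bound:
  assumes "m > 0"
  shows "integrable M (\<lambda>s. 32 * (s * exp (- (2 * m * s))) / m + 32 * (s\<^sup>2 * exp (- (2 * m * s))))"
  using integrable_exp_bounds[OF assms]
  by (intro Bochner_Integration.integrable_add integrable_divide integrable_mult_right) auto

lemma integrable_\<Psi>_second:
  "integrable M (\<lambda>s. s\<^sup>2 * stripe_kernel_diag (s * x) (s * y))" (is ?A)
  "integrable M (\<lambda>s. s\<^sup>2 * stripe_kernel_mixed (s * x) (s * y))" (is ?B)
proof -
  let ?m = "min x y"
  have b: "AE s in M. \<bar>s\<^sup>2 * stripe_kernel_diag (s * x) (s * y)\<bar> \<le> \<bar>32 * (s * exp (- (2 * ?m * s))) / ?m + 32 * (s\<^sup>2 * exp (- (2 * ?m * s)))\<bar>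
    \<and> \<bar>s\<^sup>2 * stripe_kernel_mixed (s * x) (s * y)\<bar> \<le> \<bar>32 * (s * exp (- (2 * ?m * s))) / ?m + 32 * (s\<^sup>2 * exp (- (2 * ?m * s)))\<bar>"
    using AE_laplace_weight
  proof eventually_elim
    case (elim s)
    show ?case
      using abs_stripe_kernel_second_scaled_le[of s ?m x y] elim x y
      by (auto intro: order_trans[OF _ abs_ge_self])
  qed
  show ?A
    by (rule Bochner_Integration.integrable_bound[OF integrable_second_bound[of ?m]])
      (use b x y in \<open>auto elim!: eventually_mono\<close>)
  show ?B
    by (rule Bochner_Integration.integrable_bound[OF integrable_second_bound[of ?m]])
      (use b x y in \<open>auto elim!: eventually_mono\<close>)
qed

end

lemma abs_lincomb_le_norm:
  fixes h :: "real \<times> real"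
  assumes "\<bar>a\<bar> \<le> c" "\<bar>b\<bar> \<le> c"
  shows "\<bar>a * fst h + b * snd h\<bar> \<le> 2 * c * norm h"
proof -
  have "norm (fst h) \<le> norm h" "norm (snd h) \<le> norm h"
    using norm_fst_le[of "fst h" "snd h"] norm_snd_le[of "snd h" "fst h"] by simp_all
  moreover have "0 \<le> c" using assms by linarith
  ultimately have "\<bar>a * fst h\<bar> \<le> c * norm h" "\<bar>b * snd h\<bar> \<le> c * norm h"
    using assms unfolding abs_mult by (auto intro!: mult_mono)
  then show ?thesis by linarith
qed

context
  fixes x y :: real
  assumes x: "x > 0" and y: "y > 0"
begin

text \<open>Each differentiation in \<open>x\<close> or \<open>y\<close> brings down one factor
  \<open>s\<close> by the chain rule. The lemma is applied with \<open>n = 0\<close> to \<Psi> and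
  with \<open>n = 1\<close> to \<open>\<Psi>'\<close>; keeping \<open>n'\<close> as a separate
  variable lets it be instantiated by numerals.\<close>

lemma scaled_integral_has_derivative:
  fixes k k\<^sub>1 k\<^sub>2 :: "real \<Rightarrow> real \<Rightarrow> real" and b :: "real \<Rightarrow> real \<Rightarrow> real"
  assumes n': "n' = Suc n"
    and k: "\<And>u v. u > 0 \<Longrightarrow> v > 0 \<Longrightarrow>
      ((\<lambda>z. k (fst z) (snd z)) has_derivative (\<lambda>h. k\<^sub>1 u v * fst h + k\<^sub>2 u v * snd h)) (at (u, v))"
    and int: "\<And>x y. x > 0 \<Longrightarrow> y > 0 \<Longrightarrow> integrable M (\<lambda>s. s ^ n * k (s * x) (s * y))"
      "integrable M (\<lambda>s. s ^ n' * k\<^sub>1 (s * x) (s * y))" "integrable M (\<lambda>s. s ^ n' * k\<^sub>2 (s * x) (s * y))"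
    and b: "\<And>m. m > 0 \<Longrightarrow> integrable M (b m)"
      "\<And>s m x y. s > 0 \<Longrightarrow> m > 0 \<Longrightarrow> m \<le> x \<Longrightarrow> m \<le> y \<Longrightarrow>
        \<bar>s ^ n' * k\<^sub>1 (s * x) (s * y)\<bar> \<le> b m s \<and> \<bar>s ^ n' * k\<^sub>2 (s * x) (s * y)\<bar> \<le> b m s"
  shows "((\<lambda>z. \<integral>s. s ^ n * k (s * fst z) (s * snd z) \<partial>M) has_derivative
    (\<lambda>h. (\<integral>s. s ^ n' * k\<^sub>1 (s * x) (s * y) \<partial>M) * fst h + (\<integral>s. s ^ n' * k\<^sub>2 (s * x) (s * y) \<partial>M) * snd h)) (at (x, y))"
proof -
  \<comment> \<open>Half of the minimum, so that \<open>(x, y)\<close> lies inside the open quadrant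
    \<open>U\<close>.\<close>
  define m where "m = min x y / 2"
  define U where "U = {m<..} \<times> {m<..}"
  define D where "D z s h = s ^ n' * k\<^sub>1 (s * fst z) (s * snd z) * fst h
      + s ^ n' * k\<^sub>2 (s * fst z) (s * snd z) * snd h" for z h :: "real \<times> real" and s
  have m: "m > 0" using x y by (simp add: m_def)
  have "((\<lambda>z. \<integral>s. s ^ n * k (s * fst z) (s * snd z) \<partial>M) has_derivative
      (\<lambda>h. \<integral>s. D (x, y) s h \<partial>M)) (at (x, y))"
  proof (rule has_derivative_lebesgue_integral[where U = U and B = "\<lambda>s. 2 * b m s"])
    show "open U" "convex U" by (auto simp: U_def intro: open_Times convex_Times)
    show "(x, y) \<in> U" using x y by (auto simp: U_def m_def)
    show "integrable M (\<lambda>s. s ^ n * k (s * fst z) (s * snd z))" if "z \<in> U" for z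
      using that m by (intro int) (auto simp: U_def)
    show "(\<lambda>s. D (x, y) s h) \<in> borel_measurable M" for h
      using int(2,3)[THEN borel_measurable_integrable] unfolding D_def by simp
    show "integrable M (\<lambda>s. 2 * b m s)" using b(1)[OF m] by (rule integrable_mult_right)
    show "AE s in M. \<forall>z\<in>U. ((\<lambda>z. s ^ n * k (s * fst z) (s * snd z)) has_derivative D z s) (at z)"
      using AE_laplace_weight
    proof eventually_elim
      case (elim s)
      show ?case
      proof
        fix z assume "z \<in> U"
        then have pos: "s * fst z > 0" "s * snd z > 0" using elim m by (auto simp: U_def)
        have scale: "((\<lambda>z. s *\<^sub>R z) has_derivative (\<lambda>h. s *\<^sub>R h)) (at z)"
          by (intro derivative_eq_intros) auto
        have "((\<lambda>z. k (fst z) (snd z)) has_derivative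
            (\<lambda>h. k\<^sub>1 (s * fst z) (s * snd z) * fst h + k\<^sub>2 (s * fst z) (s * snd z) * snd h)) (at (s *\<^sub>R z))"
          using k[OF pos] by (simp add: scaleR_prod_def)
        from has_derivative_mult_right[OF has_derivative_compose[OF scale this], of "s ^ n"]
        show "((\<lambda>z. s ^ n * k (s * fst z) (s * snd z)) has_derivative D z s) (at z)"
          by (simp add: D_def[abs_def] n' algebra_simps)
      qed
    qed
    show "AE s in M. \<forall>z\<in>U. \<forall>h. \<bar>D z s h\<bar> \<le> 2 * b m s * norm h"
      using AE_laplace_weight
    proof eventually_elim
      case (elim s)
      show ?case unfolding D_def
        using b(2)[OF elim m] by (intro ballI allI abs_lincomb_le_norm) (auto simp: U_def)
    qed
  qed
  then show ?thesis using int(2,3) by (simp add: D_def)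
qed

lemma \<Psi>_has_derivative:
  "((\<lambda>z. \<Psi> (fst z) (snd z)) has_derivative (\<lambda>h. \<Psi>' x y * fst h + \<Psi>' y x * snd h)) (at (x, y))"
proof -
  have "((\<lambda>z. \<integral>s. s ^ 0 * stripe_kernel (s * fst z) (s * snd z) \<partial>M) has_derivative
    (\<lambda>h. (\<integral>s. s ^ 1 * stripe_kernel' (s * x) (s * y) \<partial>M) * fst h
        + (\<integral>s. s ^ 1 * stripe_kernel' (s * y) (s * x) \<partial>M) * snd h)) (at (x, y))"
    by (rule scaled_integral_has_derivative[where b = "\<lambda>m s. 8 * (s * exp (- (2 * m * s)))"])
      (use x y in \<open>auto intro!: stripe_kernel_has_derivative integrable_\<Psi> integrable_\<Psi>' integrable_mult_right
        integrable_exp_bounds abs_stripe_kernel'_scaled_le\<close>)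
  then show ?thesis by (simp add: \<Psi>_def \<Psi>'_def)
qed

lemma \<Psi>'_has_derivative:
  "((\<lambda>z. \<Psi>' (fst z) (snd z)) has_derivative (\<lambda>h. \<Psi>_diag x y * fst h + \<Psi>_mixed x y * snd h)) (at (x, y))"
proof -
  have "((\<lambda>z. \<integral>s. s ^ 1 * stripe_kernel' (s * fst z) (s * snd z) \<partial>M) has_derivative
    (\<lambda>h. (\<integral>s. s\<^sup>2 * stripe_kernel_diag (s * x) (s * y) \<partial>M) * fst h
        + (\<integral>s. s\<^sup>2 * stripe_kernel_mixed (s * x) (s * y) \<partial>M) * snd h)) (at (x, y))"
    by (rule scaled_integral_has_derivative[where
          b = "\<lambda>m s. 32 * (s * exp (- (2 * m * s))) / m + 32 * (s\<^sup>2 * exp (- (2 * m * s)))"])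
      (use x y integrable_second_bound[OF x y] in \<open>auto intro!: stripe_kernel'_has_derivative integrable_\<Psi>'
        integrable_\<Psi>_second abs_stripe_kernel_second_scaled_le \<close>)
  then show ?thesis by (simp add: \<Psi>'_def \<Psi>_diag_def \<Psi>_mixed_def power2_eq_square)
qed

end

end

section \<open>Quantitative bounds for the averaged kernel and its Hessian\<close>

context laplace
begin

text \<open>The value at \<open>t = 0\<close> of the tangent line, taken at \<open>t = 1\<close>, to
  the profile of \<Psi> at \<open>(t * x, t * y)\<close>. Convexity makes this intercept decrease
  along rays.\<close>

definition ray_defect :: "real \<Rightarrow> real \<Rightarrow> real" where
  "ray_defect x y = \<Psi> x y - x * \<Psi>' x y - y * \<Psi>' y x"

definition hess :: "real \<Rightarrow> real \<Rightarrow> real \<Rightarrow> real \<Rightarrow> real" where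
  "hess x y v w = \<Psi>_diag x y * v\<^sup>2 + 2 * \<Psi>_mixed x y * v * w + \<Psi>_diag y x * w\<^sup>2"

lemma ray_defect_commute: "ray_defect x y = ray_defect y x"
  by (simp add: ray_defect_def \<Psi>_commute[of x y])

lemma hess_commute: "hess x y v w = hess y x w v"
  by (simp add: hess_def \<Psi>_mixed_commute[of x y])

lemma integral_exp_laplace_weight:
  assumes "c > 0"
  shows "(\<integral>s. exp (- (c * s)) \<partial>M) = K * Gamma (r + 1) / (c + e) powr (r + 1)"
    and "integrable M (\<lambda>s. exp (- (c * s)))"
  using has_bochner_integral_laplace_weight[OF assms, of 0] by (auto simp: has_bochner_integral_iff)

text \<open>Uniform in \<open>y\<close>. As \<open>x\<close> tends to 0 with \<open>e > 0\<close>
  the bound tends to \<open>K * Gamma (r + 1) / e powr (r + 1)\<close>, so smallness of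
  \<open>e\<close> forces \<Psi> above 1 as soon as one width is short.\<close>

lemma \<Psi>_ge:
  assumes "x > 0" "y > 0"
  shows "K * Gamma (r + 1) / (2 * x + e) powr (r + 1) \<le> \<Psi> x y"
proof -
  have "(\<integral>s. exp (- (2 * x * s)) \<partial>M) \<le> \<Psi> x y"
    unfolding \<Psi>_def
  proof (rule integral_mono_AE)
    show "AE s in M. exp (- (2 * x * s)) \<le> stripe_kernel (s * x) (s * y)"
      using AE_laplace_weight
    proof eventually_elim
      case (elim s)
      then show ?case using stripe_kernel_ge[of "s * x" "s * y"] assms by (simp add: mult_ac)
    qed
  qed (use assms integral_exp_laplace_weight[of "2 * x"] integrable_\<Psi> in auto)
  then show ?thesis using integral_exp_laplace_weight(1)[of "2 * x"] assms by simp
qed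

lemma \<Psi>'_nonpos:
  assumes "x > 0" "y > 0"
  shows "\<Psi>' x y \<le> 0"
proof -
  have "\<Psi>' x y \<le> (\<integral>s. 0 \<partial>M)" unfolding \<Psi>'_def
  proof (rule integral_mono_AE)
    show "AE s in M. s * stripe_kernel' (s * x) (s * y) \<le> 0"
      using AE_laplace_weight
    proof eventually_elim
      case (elim s)
      then show ?case using stripe_kernel'_nonpos[of "s * x" "s * y"] assms
        by (simp add: mult_nonneg_nonpos)
    qed
  qed (use assms integrable_\<Psi>' in auto)
  then show ?thesis by simp
qed

lemma \<Psi>_le_ray_defect:
  assumes "x > 0" "y > 0"
  shows "\<Psi> x y \<le> ray_defect x y"
proof -
  have "x * \<Psi>' x y \<le> 0" "y * \<Psi>' y x \<le> 0"
    using \<Psi>'_nonpos[of x y] \<Psi>'_nonpos[of y x] assms by (simp_all add: mult_nonneg_nonpos)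
  then show ?thesis by (simp add: ray_defect_def)
qed

text \<open>The constant 10 is \<open>2 + 8\<close>, from the pointwise bounds of the kernel and of
  its first derivative. Integrating the exponentials gives powers of \<open>x + e\<close> and
  \<open>y + e\<close>, in which \<open>e\<close> may be dropped.\<close>

lemma ray_defect_le:
  assumes "x > 0" "y > 0"
  shows "ray_defect x y \<le> 10 * K * Gamma (r + 1) * (x powr - (r + 1) + y powr - (r + 1))"
proof -
  have KG: "0 \<le> K * Gamma (r + 1)" using K r by (auto intro!: mult_nonneg_nonneg Gamma_real_nonneg)
  have int: "integrable M (\<lambda>s. stripe_kernel (s * x) (s * y) - x * (s * stripe_kernel' (s * x) (s * y))
      - y * (s * stripe_kernel' (s * y) (s * x)))"
    using assms by (intro Bochner_Integration.integrable_diff integrable_mult_right integrable_\<Psi> integrable_\<Psi>')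
  have "ray_defect x y = (\<integral>s. stripe_kernel (s * x) (s * y) - x * (s * stripe_kernel' (s * x) (s * y))
      - y * (s * stripe_kernel' (s * y) (s * x)) \<partial>M)"
    unfolding ray_defect_def \<Psi>_def \<Psi>'_def
    using assms by (simp add: integrable_\<Psi> integrable_\<Psi>')
  also have "\<dots> \<le> (\<integral>s. 10 * exp (- (x * s)) + 10 * exp (- (y * s)) \<partial>M)"
  proof (rule integral_mono_AE[OF int])
    show "integrable M (\<lambda>s. 10 * exp (- (x * s)) + 10 * exp (- (y * s)))"
      using assms by (intro Bochner_Integration.integrable_add integrable_mult_right integral_exp_laplace_weight)
    show "AE s in M. stripe_kernel (s * x) (s * y) - x * (s * stripe_kernel' (s * x) (s * y))
      - y * (s * stripe_kernel' (s * y) (s * x)) \<le> 10 * exp (- (x * s)) + 10 * exp (- (y * s))"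
      using AE_laplace_weight
    proof eventually_elim
      case (elim s)
      define u v where "u = s * x" and "v = s * y"
      have uv: "u > 0" "v > 0" using elim assms by (auto simp: u_def v_def)
      \<comment> \<open>The factor \<open>t\<close> from the radial derivative is paid for with half
        of the decay rate.\<close>
      have b: "t * exp (- 2 * t) \<le> exp (- t)" "exp (- 2 * t) \<le> exp (- t)" if "t > 0" for t :: real
      proof -
        have "t * exp (- t) \<le> 1"
          using order_trans[OF _ exp_ge_add_one_self[of t], of t] by (simp add: exp_minus field_simps)
        then have "(t * exp (- t)) * exp (- t) \<le> 1 * exp (- t)" by (intro mult_right_mono) auto
        moreover have "exp (- 2 * t) = exp (- t) * exp (- t)" by (simp add: exp_add[symmetric])
        ultimately show "t * exp (- 2 * t) \<le> exp (- t)" by (simp add: mult_ac)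
        show "exp (- 2 * t) \<le> exp (- t)" using that by simp
      qed
      have "- stripe_kernel' u v * u \<le> 8 * exp (- 2 * u) * u"
        using abs_stripe_kernel'_le[OF uv] uv by (intro mult_right_mono) auto
      moreover have "- stripe_kernel' v u * v \<le> 8 * exp (- 2 * v) * v"
        using abs_stripe_kernel'_le[OF uv(2,1)] uv by (intro mult_right_mono) auto
      moreover note stripe_kernel_le[OF uv] b[OF uv(1)] b[OF uv(2)]
      ultimately have "stripe_kernel u v - u * stripe_kernel' u v - v * stripe_kernel' v u
          \<le> 10 * exp (- u) + 10 * exp (- v)"
        unfolding mult.commute[of u] mult.commute[of v] by linarith
      then show ?case by (simp add: u_def v_def mult_ac)
    qed
  qed
  also have "\<dots> = 10 * (K * Gamma (r + 1) / (x + e) powr (r + 1)) + 10 * (K * Gamma (r + 1) / (y + e) powr (r + 1))"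
    using assms by (simp add: integral_exp_laplace_weight)
  also have "\<dots> \<le> 10 * (K * Gamma (r + 1) / x powr (r + 1)) + 10 * (K * Gamma (r + 1) / y powr (r + 1))"
    using assms e r KG
    by (intro add_mono mult_left_mono divide_left_mono powr_mono2 mult_pos_pos) auto
  finally show ?thesis by (simp only: powr_minus divide_inverse distrib_left mult.assoc)
qed

lemma measure_laplace_weight_ge:
  assumes "0 < a" "a \<le> b"
  shows "K * a powr r * exp (- (e * b)) * (b - a) \<le> measure M {a..b}" (is ?A)
    and "integrable M (indicator {a..b} :: real \<Rightarrow> real)" (is ?B)
proof -
  define c where "c = K * a powr r * exp (- (e * b))"
  have c: "c \<ge> 0" using K by (simp add: c_def)
  show ?B
  proof (rule Bochner_Integration.integrable_bound)
    show "integrable M (\<lambda>s. exp b * exp (- (1 * s)))"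
      using integral_exp_laplace_weight(2)[of 1] by (intro integrable_mult_right) simp
  qed (auto simp: indicator_def exp_add[symmetric])
  then have fin: "emeasure M {a..b} < \<infinity>" by (simp add: integrable_indicator_iff)
  have "ennreal (c * (b - a)) = (\<integral>\<^sup>+s. ennreal c * indicator {a..b} s \<partial>lborel)"
    using assms c by (simp add: nn_integral_cmult_indicator ennreal_mult')
  also have "\<dots> \<le> (\<integral>\<^sup>+s. ennreal (indicator {0<..} s * (K * s powr r * exp (- (e * s)))) * indicator {a..b} s \<partial>lborel)"
  proof (rule nn_integral_mono)
    fix s :: real
    have "c \<le> K * s powr r * exp (- (e * s))" if "a \<le> s" "s \<le> b"
      unfolding c_def using that assms K e r by (intro mult_mono powr_mono2) (auto intro: mult_left_mono)
    then show "ennreal c * indicator {a..b} s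
        \<le> ennreal (indicator {0<..} s * (K * s powr r * exp (- (e * s)))) * indicator {a..b} s"
      using assms by (auto simp: indicator_def intro!: ennreal_leI)
  qed
  also have "\<dots> = emeasure M {a..b}"
    unfolding laplace_weight_def by (subst emeasure_density) auto
  finally have "ennreal (c * (b - a)) \<le> ennreal (measure M {a..b})"
    using fin by (simp add: emeasure_eq_ennreal_measure less_top)
  then show ?A by (simp add: c_def ennreal_le_iff)
qed

text \<open>Only a window of scales is retained; there the density is bounded below by its power at
  the left end and its exponential at the right end.\<close>

lemma integral_ge_on_interval:
  assumes f: "integrable M f" and nn: "\<And>s. s > 0 \<Longrightarrow> 0 \<le> f s"
    and ab: "0 < a" "a \<le> b" and c: "\<And>s. s \<in> {a..b} \<Longrightarrow> c \<le> f s" "0 \<le> c"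
  shows "c * (K * a powr r * exp (- (e * b)) * (b - a)) \<le> (\<integral>s. f s \<partial>M)"
proof -
  have "c * (K * a powr r * exp (- (e * b)) * (b - a)) \<le> c * measure M {a..b}"
    using measure_laplace_weight_ge(1)[OF ab] c(2) by (intro mult_left_mono) auto
  also have "\<dots> = (\<integral>s. c * indicator {a..b} s \<partial>M)" by simp
  also have "\<dots> \<le> (\<integral>s. f s \<partial>M)"
  proof (rule integral_mono_AE)
    show "integrable M (\<lambda>s. c * indicator {a..b} s)"
      using measure_laplace_weight_ge(2)[OF ab] by (intro integrable_mult_right)
    show "AE s in M. c * indicator {a..b} s \<le> f s"
      using AE_laplace_weight by eventually_elim (use nn c in \<open>auto simp: indicator_def\<close>)
  qed (rule f)
  finally show ?thesis .
qed

text \<open>The two coefficients come from different scales. For \<open>v\<^sup>2\<close> the window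
  \<open>{1..2}\<close> is used: there \<open>s * x\<close> stays between \<open>x\<^sub>0\<close>
  and \<open>2 * X\<close>, which gives a constant. For \<open>w\<^sup>2\<close> the window is
  \<open>{1 / (2 * y)..1 / y}\<close>, where \<open>s * y\<close> is of order 1. Its contributions
  are \<open>y powr - 2\<close> from \<open>s\<^sup>2\<close>, \<open>y powr - 2\<close> from
  \<open>(tanh (s * x))\<^sup>2\<close>, \<open>y powr - r\<close> from the weight and
  \<open>1 / y\<close> from the length, in total \<open>y powr - (r + 5)\<close>.\<close>

lemma hess_ge:
  assumes x0: "0 < x\<^sub>0" "x\<^sub>0 \<le> X"
  obtains A B where "A > 0" "B > 0"
    "\<And>x y v w. x\<^sub>0 \<le> x \<Longrightarrow> x \<le> X \<Longrightarrow> x \<le> y \<Longrightarrow> A * v\<^sup>2 + B * y powr - (r + 5) * w\<^sup>2 \<le> hess x y v w"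
proof
  define a where "a = tanh x\<^sub>0 * (1 - (tanh (2 * X))\<^sup>2)"
  define T :: real where "T = tanh (1/2) * (1 - (tanh 1)\<^sup>2)"
  \<comment> \<open>The 64 arises from \<open>(1 / (2 * y))\<^sup>2 * (x\<^sub>0 / (4 * y))\<^sup>2
    = x\<^sub>0\<^sup>2 / (64 * y ^ 4)\<close>.\<close>
  define b where "b = x\<^sub>0\<^sup>2 / 64 * T"
  have sq1: "0 < 1 - (tanh t)\<^sup>2" for t :: real
  proof -
    have "\<bar>tanh t\<bar> < 1" using tanh_real_bounds[of t] by auto
    then show ?thesis by (simp add: abs_square_less_1)
  qed
  have T: "T > 0" using sq1[of 1] by (simp add: T_def)
  have ab: "a > 0" "b > 0" using x0 sq1 T by (auto simp: a_def b_def)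
  define A where "A = a * (K * 1 powr r * exp (- (e * 2)) * (2 - 1))"
  \<comment> \<open>One factor \<open>1/2\<close> is the relative length of the second window, the
    other \<open>r\<close> of them come from its left end \<open>1 / (2 * y)\<close>; the
    exponential uses \<open>x\<^sub>0 \<le> y\<close>.\<close>
  define B where "B = b * (K * (1/2) powr (r + 1) * exp (- (e / x\<^sub>0)))"
  show "A > 0" "B > 0" using ab K by (auto simp: A_def B_def)
  fix x y v w :: real
  assume x: "x\<^sub>0 \<le> x" "x \<le> X" "x \<le> y"
  have xy: "x > 0" "y > 0" using x x0 by auto
  define C where "C s = 4 / (tanh (s * x) + tanh (s * y))\<^sup>2" for s
  define f where "f s = s\<^sup>2 * (C s * ((tanh (s * y))\<^sup>2 * tanh (s * x) * (1 - (tanh (s * x))\<^sup>2)))" for s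
  define g where "g s = s\<^sup>2 * (C s * ((tanh (s * x))\<^sup>2 * tanh (s * y) * (1 - (tanh (s * y))\<^sup>2)))" for s
  define h where "h v w s = s\<^sup>2 * stripe_kernel_diag (s * x) (s * y) * v\<^sup>2
      + 2 * (s\<^sup>2 * stripe_kernel_mixed (s * x) (s * y)) * v * w
      + s\<^sup>2 * stripe_kernel_diag (s * y) (s * x) * w\<^sup>2" for v w s
  have [measurable]: "f \<in> borel_measurable borel" "g \<in> borel_measurable borel"
    unfolding f_def g_def C_def by measurable
  have hint: "integrable M (h v w)" for v w
    unfolding h_def using xy
    by (intro Bochner_Integration.integrable_add integrable_mult_left integrable_mult_right integrable_\<Psi>_second)
  have hess: "hess x y v w = (\<integral>s. h v w s \<partial>M)" for v w
    unfolding h_def hess_def \<Psi>_diag_def \<Psi>_mixed_def using xy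
    by (simp add: integrable_\<Psi>_second)
  have fgh: "f s * v\<^sup>2 + g s * w\<^sup>2 \<le> h v w s" if "s > 0" for s v w
  proof -
    have "s * x > 0" "s * y > 0" using that xy by auto
    from mult_left_mono[OF stripe_kernel_hessian_ge[OF this, of v w], of "s\<^sup>2"]
    show ?thesis by (simp add: f_def g_def h_def C_def algebra_simps)
  qed
  have nn: "0 \<le> f s" "0 \<le> g s" if "s > 0" for s
    using that xy sq1[of "s * x"] sq1[of "s * y"] by (auto simp: f_def g_def C_def intro!: mult_nonneg_nonneg)
  have fint: "integrable M f"
  proof (rule Bochner_Integration.integrable_bound[OF hint[of 1 0]])
    show "AE s in M. norm (f s) \<le> norm (h 1 0 s)"
      using AE_laplace_weight
    proof eventually_elim
      case (elim s) then show ?case using nn[of s] fgh[of s 1 0] by simp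
    qed
  qed simp
  have gint: "integrable M g"
  proof (rule Bochner_Integration.integrable_bound[OF hint[of 0 1]])
    show "AE s in M. norm (g s) \<le> norm (h 0 1 s)"
      using AE_laplace_weight
    proof eventually_elim
      case (elim s) then show ?case using nn[of s] fgh[of s 0 1] by simp
    qed
  qed simp
  have "A \<le> (\<integral>s. f s \<partial>M)"
    unfolding A_def
  proof (rule integral_ge_on_interval[OF fint])
    fix s :: real assume s: "s \<in> {1..2}"
    define \<alpha> \<beta> where "\<alpha> = tanh (s * x)" and "\<beta> = tanh (s * y)"
    have ge: "x\<^sub>0 \<le> s * x" "s * x \<le> 2 * X" "s * x \<le> s * y"
      using s x x0 mult_mono[of 1 s x\<^sub>0 x] mult_mono[of s 2 x X] by auto
    have \<alpha>: "tanh x\<^sub>0 \<le> \<alpha>" "\<alpha> \<le> tanh (2 * X)" "\<alpha> \<le> \<beta>" "0 < \<alpha>"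
      unfolding \<alpha>_def \<beta>_def using ge x0 xy s by auto
    have "(\<alpha> + \<beta>)\<^sup>2 \<le> (2 * \<beta>)\<^sup>2" using \<alpha> by (intro power_mono) auto
    then have "1 \<le> 4 / (\<alpha> + \<beta>)\<^sup>2 * \<beta>\<^sup>2"
      using \<alpha> by (simp add: power_mult_distrib)
    moreover have "1 \<le> s\<^sup>2" using s by simp
    ultimately have 1: "1 \<le> s\<^sup>2 * (4 / (\<alpha> + \<beta>)\<^sup>2 * \<beta>\<^sup>2)"
      using mult_mono[of 1 "s\<^sup>2" 1 "4 / (\<alpha> + \<beta>)\<^sup>2 * \<beta>\<^sup>2"] by auto
    have "\<alpha>\<^sup>2 \<le> (tanh (2 * X))\<^sup>2" using \<alpha> by (intro power_mono) auto
    then have 2: "a \<le> \<alpha> * (1 - \<alpha>\<^sup>2)"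
      unfolding a_def using \<alpha> x0 sq1[of "2 * X"] by (intro mult_mono) auto
    have "1 * a \<le> s\<^sup>2 * (4 / (\<alpha> + \<beta>)\<^sup>2 * \<beta>\<^sup>2) * (\<alpha> * (1 - \<alpha>\<^sup>2))"
      using 1 2 ab by (intro mult_mono) auto
    then show "a \<le> f s" unfolding f_def C_def \<alpha>_def[symmetric] \<beta>_def[symmetric] by (simp only: mult_ac mult_1)
  qed (use nn ab in auto)
  moreover have "B * y powr - (r + 5) \<le> (\<integral>s. g s \<partial>M)"
  proof -
    have "b / y ^ 4 * (K * (1 / (2 * y)) powr r * exp (- (e * (1 / y))) * (1 / y - 1 / (2 * y))) \<le> (\<integral>s. g s \<partial>M)"
    proof (rule integral_ge_on_interval[OF gint])
      fix s :: real assume s: "s \<in> {1 / (2 * y)..1 / y}"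
      define \<alpha> \<beta> where "\<alpha> = tanh (s * x)" and "\<beta> = tanh (s * y)"
      have s0: "s > 0" using s xy by (auto intro: less_le_trans[rotated])
      have sy: "1 / 2 \<le> s * y" "s * y \<le> 1" using s xy by (auto simp: field_simps)
      have sx: "s * x \<le> 1" using x s0 sy order_trans[OF mult_left_mono[of x y s]] by auto
      have \<beta>: "tanh (1/2) \<le> \<beta>" "\<beta> \<le> tanh 1" "0 < \<beta>" "\<beta> < 1"
        unfolding \<beta>_def using sy s0 xy tanh_real_lt_1 by auto
      have "x\<^sub>0 / (4 * y) \<le> s * x / 2"
        using s xy x x0 s0 mult_mono[of "1 / (2 * y)" s x\<^sub>0 x] by auto
      also have "\<dots> \<le> s * x / (1 + s * x)"
        using sx s0 xy by (intro divide_left_mono mult_pos_pos) (auto intro: add_pos_pos)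
      also have "\<dots> \<le> \<alpha>" unfolding \<alpha>_def using s0 xy by (intro tanh_ge) auto
      finally have \<alpha>: "x\<^sub>0 / (4 * y) \<le> \<alpha>" .
      have \<alpha>1: "0 < \<alpha>" "\<alpha> < 1" unfolding \<alpha>_def using s0 xy tanh_real_lt_1 by auto
      have "(\<alpha> + \<beta>)\<^sup>2 \<le> 2\<^sup>2" using \<alpha>1 \<beta> by (intro power_mono) auto
      then have 1: "1 \<le> 4 / (\<alpha> + \<beta>)\<^sup>2" using \<alpha>1 \<beta> by simp
      have 2: "(x\<^sub>0 / (4 * y))\<^sup>2 \<le> \<alpha>\<^sup>2" using \<alpha> x0 xy by (intro power_mono) auto
      have 3: "(1 / (2 * y))\<^sup>2 \<le> s\<^sup>2" using s xy by (intro power_mono) auto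
      have "\<beta>\<^sup>2 \<le> (tanh 1)\<^sup>2" using \<beta> by (intro power_mono) auto
      then have 4: "T \<le> \<beta> * (1 - \<beta>\<^sup>2)"
        unfolding T_def using \<beta> sq1[of 1] by (intro mult_mono) auto
      have "(1 / (2 * y))\<^sup>2 * (1 * ((x\<^sub>0 / (4 * y))\<^sup>2 * T))
          \<le> s\<^sup>2 * (4 / (\<alpha> + \<beta>)\<^sup>2 * (\<alpha>\<^sup>2 * (\<beta> * (1 - \<beta>\<^sup>2))))"
        using 1 2 3 4 T by (intro mult_mono) auto
      also have "(1 / (2 * y))\<^sup>2 * (1 * ((x\<^sub>0 / (4 * y))\<^sup>2 * T)) = b / y ^ 4"
        using xy by (simp add: b_def field_simps power2_eq_square power4_eq_xxxx)
      finally show "b / y ^ 4 \<le> g s"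
        by (simp add: g_def C_def \<alpha>_def[symmetric] \<beta>_def[symmetric] mult_ac)
    qed (use nn ab xy in \<open>auto simp: field_simps\<close>)
    moreover have "B * y powr - (r + 5)
        \<le> b / y ^ 4 * (K * (1 / (2 * y)) powr r * exp (- (e * (1 / y))) * (1 / y - 1 / (2 * y)))"
    proof -
      have "y powr - (r + 5) = (1 / y) powr r * (1 / y) * (1 / y ^ 4)"
      proof -
        have "y powr (r + 5) = y powr r * y * y ^ 4"
          using xy powr_realpow[of y 5] by (simp add: powr_add power_numeral_reduce)
        then show ?thesis unfolding powr_minus using xy by (simp add: powr_divide divide_simps)
      qed
      moreover have "(1 / (2 * y)) powr r = (1 / 2) powr r * (1 / y) powr r"
        using xy powr_mult[of "1/2" "1/y" r] by simp
      moreover have "1 / y - 1 / (2 * y) = (1/2) * (1 / y)" using xy by (simp add: field_simps)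
      ultimately have *: "b / y ^ 4 * (K * (1 / (2 * y)) powr r * exp (- (e * (1 / y))) * (1 / y - 1 / (2 * y)))
        = b * (K * ((1 / 2) powr r * (1/2)) * exp (- (e / y))) * y powr - (r + 5)"
        by (simp add: mult_ac)
      have "e / y \<le> e / x\<^sub>0" using x x0 xy e by (intro divide_left_mono mult_pos_pos) auto
      then have "exp (- (e / x\<^sub>0)) \<le> exp (- (e / y))" by simp
      then have "B \<le> b * (K * ((1 / 2) powr r * (1/2)) * exp (- (e / y)))"
        unfolding B_def using ab K by (simp add: powr_add)
      then show ?thesis unfolding * by (intro mult_right_mono) auto
    qed
    ultimately show ?thesis by linarith
  qed
  ultimately have "A * v\<^sup>2 + B * y powr - (r + 5) * w\<^sup>2 \<le> (\<integral>s. f s \<partial>M) * v\<^sup>2 + (\<integral>s. g s \<partial>M) * w\<^sup>2"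
    by (intro add_mono mult_right_mono) auto
  also have "\<dots> = (\<integral>s. f s * v\<^sup>2 + g s * w\<^sup>2 \<partial>M)" using fint gint by simp
  also have "\<dots> \<le> hess x y v w"
    unfolding hess
  proof (rule integral_mono_AE)
    show "AE s in M. f s * v\<^sup>2 + g s * w\<^sup>2 \<le> h v w s"
      using AE_laplace_weight by eventually_elim (use fgh in auto)
  qed (use fint gint hint in auto)
  finally show "A * v\<^sup>2 + B * y powr - (r + 5) * w\<^sup>2 \<le> hess x y v w" .
qed

text \<open>\<open>hess_ge\<close> with both bounds equal to the smaller width, which is always
  possible after swapping the arguments.\<close>

lemma hess_pos:
  assumes "x > 0" "y > 0" "v \<noteq> 0 \<or> w \<noteq> 0"
  shows "hess x y v w > 0"
proof -
  have *: "hess x y v w > 0" if "x > 0" "x \<le> y" "v \<noteq> 0 \<or> w \<noteq> 0" for x y v w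
  proof -
    obtain A B where AB: "A > 0" "B > 0" and h: "A * v\<^sup>2 + B * y powr - (r + 5) * w\<^sup>2 \<le> hess x y v w"
      using hess_ge[OF \<open>x > 0\<close> order_refl] \<open>x \<le> y\<close> by (metis order_refl)
    have "y > 0" using that by simp
    then have "A * v\<^sup>2 + B * y powr - (r + 5) * w\<^sup>2 > 0"
      using that(3) AB by (cases "v = 0") (auto intro!: add_pos_nonneg)
    then show ?thesis using h by linarith
  qed
  show ?thesis using *[of x y v w] *[of y x w v] assms hess_commute[of x y v w] by linarith
qed

text \<open>The direction in which the Hessian is later evaluated involves the unknown derivative of
  \<open>hopt\<close>, but its cross product with \<open>(x, y)\<close> is known. Hence a bound by
  the square of \<open>v * y - w * x\<close>, which follows from \<open>hess_ge\<close> since this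
  square is at most \<open>2 * v\<^sup>2 * y\<^sup>2 + 2 * w\<^sup>2 * x\<^sup>2\<close>.\<close>

lemma hess_ge_cross:
  assumes x0: "0 < x\<^sub>0" "x\<^sub>0 \<le> X"
  obtains c where "c > 0"
    "\<And>x y v w. x\<^sub>0 \<le> x \<Longrightarrow> x \<le> X \<Longrightarrow> x \<le> y \<Longrightarrow>
        c * y powr - (r + 5) * (v * y - w * x)\<^sup>2 \<le> hess x y v w"
proof -
  obtain A B where AB: "A > 0" "B > 0"
    and h: "\<And>x y v w. x\<^sub>0 \<le> x \<Longrightarrow> x \<le> X \<Longrightarrow> x \<le> y \<Longrightarrow> A * v\<^sup>2 + B * y powr - (r + 5) * w\<^sup>2 \<le> hess x y v w"
    using hess_ge[OF x0] by metis
  \<comment> \<open>The two entries are chosen so that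
    \<open>2 * c * y powr - (r + 3) \<le> A\<close> and
    \<open>2 * c * x\<^sup>2 \<le> B\<close>.\<close>
  define c where "c = min (A * x\<^sub>0 powr (r + 3) / 2) (B / (2 * X\<^sup>2))"
  have X: "X > 0" using x0 by simp
  have c: "c > 0" using AB x0 X by (auto simp: c_def)
  show ?thesis
  proof (rule that[OF c])
    fix x y v w assume x: "x\<^sub>0 \<le> x" "x \<le> X" "x \<le> y"
    then have y: "y > 0" "x > 0" using x0 by auto
    have "(v * y - w * x)\<^sup>2 \<le> 2 * (v\<^sup>2 * y\<^sup>2) + 2 * (w\<^sup>2 * x\<^sup>2)"
      using sum_squares_ge_zero[of "v * y + w * x" 0]
      by (simp add: power2_eq_square algebra_simps)
    then have "c * y powr - (r + 5) * (v * y - w * x)\<^sup>2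
        \<le> c * y powr - (r + 5) * (2 * (v\<^sup>2 * y\<^sup>2) + 2 * (w\<^sup>2 * x\<^sup>2))"
      using c by (intro mult_left_mono) auto
    also have "\<dots> = (2 * c * y powr - (r + 3)) * v\<^sup>2 + y powr - (r + 5) * (2 * c * x\<^sup>2) * w\<^sup>2"
    proof -
      have "- (r + 3) = - (r + 5) + 2" by simp
      then have "y powr - (r + 3) = y powr (- (r + 5) + 2)" by (rule arg_cong)
      also have "\<dots> = y powr - (r + 5) * y\<^sup>2" using y unfolding powr_add by simp
      finally have "y powr - (r + 3) = y powr - (r + 5) * y\<^sup>2" .
      moreover have "c * P * (2 * (v\<^sup>2 * y\<^sup>2) + 2 * (w\<^sup>2 * x\<^sup>2)) = (2 * c * (P * y\<^sup>2)) * v\<^sup>2 + P * (2 * c * x\<^sup>2) * w\<^sup>2"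
        for P by (simp add: algebra_simps)
      ultimately show ?thesis by simp
    qed
    also have "\<dots> \<le> A * v\<^sup>2 + y powr - (r + 5) * B * w\<^sup>2"
    proof (intro add_mono mult_right_mono mult_left_mono)
      have "y powr - (r + 3) \<le> x\<^sub>0 powr - (r + 3)" using x x0 r by (intro powr_mono2') auto
      then have "2 * c * y powr - (r + 3) \<le> 2 * (A * x\<^sub>0 powr (r + 3) / 2) * x\<^sub>0 powr - (r + 3)"
        using c AB by (intro mult_mono) (auto simp: c_def)
      also have "\<dots> = A" using x0 unfolding powr_minus by simp
      finally show "2 * c * y powr - (r + 3) \<le> A" .
      have "2 * c * x\<^sup>2 \<le> 2 * (B / (2 * X\<^sup>2)) * X\<^sup>2"
        using c AB x y by (intro mult_mono power_mono) (auto simp: c_def)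
      also have "\<dots> = B" using X by simp
      finally show "2 * c * x\<^sup>2 \<le> B" .
    qed auto
    also have "\<dots> \<le> hess x y v w" using h[OF x, of v w] by (simp add: mult_ac)
    finally show "c * y powr - (r + 5) * (v * y - w * x)\<^sup>2 \<le> hess x y v w" .
  qed
qed

end

section \<open>The optimal period\<close>

context laplace
begin

lemma \<Psi>_compose:
  assumes "(f has_derivative f') (at t)" "(g has_derivative g') (at t)" "f t > 0" "g t > 0"
  shows "((\<lambda>t. \<Psi> (f t) (g t)) has_derivative
    (\<lambda>h. \<Psi>' (f t) (g t) * f' h + \<Psi>' (g t) (f t) * g' h)) (at t)"
  using has_derivative_compose[OF has_derivative_Pair[OF assms(1,2)] \<Psi>_has_derivative[OF assms(3,4)]]
  by simp

lemma \<Psi>'_compose: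
  assumes "(f has_derivative f') (at t)" "(g has_derivative g') (at t)" "f t > 0" "g t > 0"
  shows "((\<lambda>t. \<Psi>' (f t) (g t)) has_derivative
    (\<lambda>h. \<Psi>_diag (f t) (g t) * f' h + \<Psi>_mixed (f t) (g t) * g' h)) (at t)"
  using has_derivative_compose[OF has_derivative_Pair[OF assms(1,2)] \<Psi>'_has_derivative[OF assms(3,4)]]
  by simp

lemma ray_defect_compose:
  assumes fg: "(f has_derivative f') (at t)" "(g has_derivative g') (at t)" "f t > 0" "g t > 0"
  shows "((\<lambda>t. ray_defect (f t) (g t)) has_derivative
    (\<lambda>h. - (f t * (\<Psi>_diag (f t) (g t) * f' h + \<Psi>_mixed (f t) (g t) * g' h))
         - g t * (\<Psi>_diag (g t) (f t) * g' h + \<Psi>_mixed (f t) (g t) * f' h))) (at t)"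
  unfolding ray_defect_def
  by (rule has_derivative_eq_rhs[OF has_derivative_diff[OF has_derivative_diff[OF \<Psi>_compose[OF fg]
      has_derivative_mult[OF fg(1) \<Psi>'_compose[OF fg]]]
      has_derivative_mult[OF fg(2) \<Psi>'_compose[OF fg(2,1,4,3)]]]])
    (simp add: fun_eq_iff algebra_simps \<Psi>_mixed_commute[of "g t" "f t"])

lemma \<Psi>_compose_real:
  assumes "(f has_real_derivative f') (at t)" "(g has_real_derivative g') (at t)" "f t > 0" "g t > 0"
  shows "((\<lambda>t. \<Psi> (f t) (g t)) has_real_derivative \<Psi>' (f t) (g t) * f' + \<Psi>' (g t) (f t) * g') (at t)"
  unfolding has_field_derivative_def
  by (rule has_derivative_eq_rhs[OF \<Psi>_compose[OF assms[unfolded has_field_derivative_def]]])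
    (simp add: fun_eq_iff algebra_simps)

lemma \<Psi>'_compose_real:
  assumes "(f has_real_derivative f') (at t)" "(g has_real_derivative g') (at t)" "f t > 0" "g t > 0"
  shows "((\<lambda>t. \<Psi>' (f t) (g t)) has_real_derivative
           \<Psi>_diag (f t) (g t) * f' + \<Psi>_mixed (f t) (g t) * g') (at t)"
  unfolding has_field_derivative_def
  by (rule has_derivative_eq_rhs[OF \<Psi>'_compose[OF assms[unfolded has_field_derivative_def]]])
    (simp add: fun_eq_iff algebra_simps)

lemma ray_defect_compose_real:
  assumes "(f has_real_derivative f') (at t)" "(g has_real_derivative g') (at t)" "f t > 0" "g t > 0"
  shows "((\<lambda>t. ray_defect (f t) (g t)) has_real_derivative
     - (f t * (\<Psi>_diag (f t) (g t) * f' + \<Psi>_mixed (f t) (g t) * g'))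
         - g t * (\<Psi>_diag (g t) (f t) * g' + \<Psi>_mixed (f t) (g t) * f')) (at t)"
  unfolding has_field_derivative_def
  by (rule has_derivative_eq_rhs[OF ray_defect_compose[OF assms[unfolded has_field_derivative_def]]])
    (simp add: fun_eq_iff algebra_simps)

definition energy :: "real \<Rightarrow> real \<Rightarrow> real" where
  "energy h \<alpha> = (\<Psi> (\<alpha> * h) ((1 - \<alpha>) * h) - 1) / h"

end

section \<open>Existence, uniqueness and smoothness of the optimal period\<close>

locale stripe_energy = laplace +
  assumes small: "e powr (r + 1) < K * Gamma (r + 1)"
begin

text \<open>The width at which the lower bound of \<open>\<Psi>_ge\<close> equals 1.\<close>

definition x\<^sub>0 :: real where "x\<^sub>0 = ((K * Gamma (r + 1)) powr (1 / (r + 1)) - e) / 2"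

lemma KG_pos: "K * Gamma (r + 1) > 0"
  using K r by (intro mult_pos_pos Gamma_real_pos) auto

lemma x\<^sub>0_pos: "x\<^sub>0 > 0"
proof -
  have "e = (e powr (r + 1)) powr (1 / (r + 1))"
    using e r by (simp add: powr_powr)
  also have "\<dots> < (K * Gamma (r + 1)) powr (1 / (r + 1))"
    using small r by (intro powr_less_mono2) auto
  finally show ?thesis by (simp add: x\<^sub>0_def)
qed

lemma \<Psi>_gt_1:
  assumes "0 < x" "x < x\<^sub>0" "y > 0"
  shows "\<Psi> x y > 1"
proof -
  have "2 * x + e < (K * Gamma (r + 1)) powr (1 / (r + 1))"
    using assms by (simp add: x\<^sub>0_def)
  then have "(2 * x + e) powr (r + 1) < ((K * Gamma (r + 1)) powr (1 / (r + 1))) powr (r + 1)"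
    using assms e r by (intro powr_less_mono2) auto
  also have "\<dots> = K * Gamma (r + 1)" using KG_pos r by (simp add: powr_powr)
  finally have "1 < K * Gamma (r + 1) / (2 * x + e) powr (r + 1)"
    using assms e by simp
  also have "\<dots> \<le> \<Psi> x y" using assms by (intro \<Psi>_ge)
  finally show ?thesis .
qed

text \<open>A width below \<open>x\<^sub>0\<close> would give \<Psi> above 1, while \<Psi> never
  exceeds \<open>ray_defect\<close>. The bound does not depend on the density.\<close>

lemma x\<^sub>0_le:
  assumes "0 < x" "0 < y" "ray_defect x y = 1"
  shows "x\<^sub>0 \<le> x" "x\<^sub>0 \<le> y"
  using \<Psi>_gt_1[of x y] \<Psi>_gt_1[of y x] \<Psi>_le_ray_defect[of x y] \<Psi>_commute[of x y] assms by force+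

text \<open>The 20 is twice the 10 of \<open>ray_defect_le\<close>, both powers there being bounded
  by the one of the smaller width. The maximum ensures \<open>x\<^sub>0 \<le> X\<close>.\<close>

definition X :: real where
  "X = max x\<^sub>0 ((20 * K * Gamma (r + 1)) powr (1 / (r + 1)))"

lemma ray_defect_less_1:
  assumes "X < x" "x \<le> y"
  shows "ray_defect x y < 1"
proof -
  have x: "x > 0" "y > 0" using assms x\<^sub>0_pos by (auto simp: X_def)
  have "20 * K * Gamma (r + 1) = ((20 * K * Gamma (r + 1)) powr (1 / (r + 1))) powr (r + 1)"
    using KG_pos r by (simp add: powr_powr)
  also have "\<dots> < x powr (r + 1)"
    using assms r by (intro powr_less_mono2) (auto simp: X_def)
  finally have *: "20 * K * Gamma (r + 1) < x powr (r + 1)" .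
  have "ray_defect x y \<le> 10 * K * Gamma (r + 1) * (x powr - (r + 1) + y powr - (r + 1))"
    using x by (rule ray_defect_le)
  also have "\<dots> \<le> 10 * K * Gamma (r + 1) * (x powr - (r + 1) + x powr - (r + 1))"
    using KG_pos assms x r by (intro mult_left_mono add_mono powr_mono2') auto
  also have "\<dots> = 20 * K * Gamma (r + 1) / x powr (r + 1)"
    unfolding powr_minus by (simp add: divide_inverse)
  also have "\<dots> < 1" using * x by simp
  finally show ?thesis .
qed

lemma le_X:
  assumes "0 < x" "x \<le> y" "ray_defect x y = 1"
  shows "x \<le> X"
  using ray_defect_less_1[of x y] assms by force

text \<open>The derivative of \<open>ray_defect\<close> along a ray: the first-order terms cancel
  and the Hessian of \<Psi> in the radial direction remains. Its sign gives uniqueness of the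
  stationary point, and its nonvanishing makes the inverse function theorem applicable.\<close>

definition slope :: "real \<Rightarrow> real \<Rightarrow> real" where
  "slope h \<alpha> = - hess (\<alpha> * h) ((1 - \<alpha>) * h) (\<alpha> * h) ((1 - \<alpha>) * h) / h"

context
  fixes \<alpha> :: real
  assumes \<alpha>: "0 < \<alpha>" "\<alpha> < 1"
begin

lemma ray_defect_deriv:
  assumes "h > 0"
  shows "((\<lambda>h. ray_defect (\<alpha> * h) ((1 - \<alpha>) * h)) has_real_derivative slope h \<alpha>) (at h)"
proof -
  have "((\<lambda>h. ray_defect (\<alpha> * h) ((1 - \<alpha>) * h)) has_real_derivative
      - (\<alpha> * h * (\<Psi>_diag (\<alpha> * h) ((1 - \<alpha>) * h) * \<alpha> + \<Psi>_mixed (\<alpha> * h) ((1 - \<alpha>) * h) * (1 - \<alpha>)))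
      - (1 - \<alpha>) * h * (\<Psi>_diag ((1 - \<alpha>) * h) (\<alpha> * h) * (1 - \<alpha>) + \<Psi>_mixed (\<alpha> * h) ((1 - \<alpha>) * h) * \<alpha>)) (at h)"
    using \<alpha> assms by (intro ray_defect_compose_real) (auto intro!: derivative_eq_intros)
  moreover have "- (\<alpha> * h * (P * \<alpha> + Q * (1 - \<alpha>))) - (1 - \<alpha>) * h * (R * (1 - \<alpha>) + Q * \<alpha>)
     = - (P * (\<alpha> * h)\<^sup>2 + 2 * Q * (\<alpha> * h) * ((1 - \<alpha>) * h) + R * ((1 - \<alpha>) * h)\<^sup>2) / h" for P Q R
    using assms by (simp add: power2_eq_square divide_simps) (simp add: algebra_simps)
  ultimately show ?thesis by (simp only: slope_def hess_def)
qed

lemma slope_neg: "h > 0 \<Longrightarrow> slope h \<alpha> < 0"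
  unfolding slope_def using \<alpha> hess_pos[of "\<alpha> * h" "(1 - \<alpha>) * h" "\<alpha> * h" "(1 - \<alpha>) * h"]
  by (auto intro!: divide_neg_pos)

lemma ray_defect_strict_antimono:
  assumes "0 < h" "h < h'"
  shows "ray_defect (\<alpha> * h') ((1 - \<alpha>) * h') < ray_defect (\<alpha> * h) ((1 - \<alpha>) * h)"
  using assms ray_defect_deriv slope_neg
  by (intro DERIV_neg_imp_decreasing[OF assms(2)]) (metis less_le_trans)

lemma ex_optimal: "\<exists>h>0. ray_defect (\<alpha> * h) ((1 - \<alpha>) * h) = 1"
proof -
  define a where "a = x\<^sub>0 / 2 / \<alpha>"
  \<comment> \<open>The quotient makes both widths exceed \<open>X\<close>; the summand
    \<open>a\<close> guarantees \<open>a \<le> b\<close> for the intermediate value theorem.\<close>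
  define b where "b = (X + 1) / min \<alpha> (1 - \<alpha>) + a"
  have X: "X > 0" using x\<^sub>0_pos by (auto simp: X_def)
  have a: "a > 0" "\<alpha> * a < x\<^sub>0" using \<alpha> x\<^sub>0_pos by (auto simp: a_def)
  have ab: "a \<le> b" "b > 0" using \<alpha> a X by (auto simp: b_def add_pos_pos)
  have "1 < \<Psi> (\<alpha> * a) ((1 - \<alpha>) * a)" using a \<alpha> by (intro \<Psi>_gt_1) auto
  also have "\<dots> \<le> ray_defect (\<alpha> * a) ((1 - \<alpha>) * a)" using a \<alpha> by (intro \<Psi>_le_ray_defect) auto
  finally have 1: "1 \<le> ray_defect (\<alpha> * a) ((1 - \<alpha>) * a)" by simp
  have "X < m * b" if "min \<alpha> (1 - \<alpha>) \<le> m" for m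
  proof -
    have "X + 1 = min \<alpha> (1 - \<alpha>) * ((X + 1) / min \<alpha> (1 - \<alpha>))" using \<alpha> by (auto simp: min_def)
    also have "\<dots> \<le> m * b"
      using that \<alpha> a X by (intro mult_mono) (auto simp: b_def)
    finally show ?thesis by simp
  qed
  then have "ray_defect (\<alpha> * b) ((1 - \<alpha>) * b) < 1"
    using ray_defect_less_1[of "\<alpha> * b" "(1 - \<alpha>) * b"] ray_defect_less_1[of "(1 - \<alpha>) * b" "\<alpha> * b"]
      ray_defect_commute[of "\<alpha> * b"]
    by (metis linear min.cobounded1 min.cobounded2)
  then have 2: "ray_defect (\<alpha> * b) ((1 - \<alpha>) * b) \<le> 1" by simp
  have "\<exists>h\<ge>a. h \<le> b \<and> ray_defect (\<alpha> * h) ((1 - \<alpha>) * h) = 1"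
    using 2 1 ab(1)
  proof (rule IVT2)
    show "\<forall>h. a \<le> h \<and> h \<le> b \<longrightarrow> isCont (\<lambda>h. ray_defect (\<alpha> * h) ((1 - \<alpha>) * h)) h"
      using a ray_defect_deriv DERIV_isCont by (meson less_le_trans)
  qed
  then show ?thesis using a by (meson less_le_trans)
qed

end

definition hopt :: "real \<Rightarrow> real" where
  "hopt \<alpha> = (THE h. h > 0 \<and> ray_defect (\<alpha> * h) ((1 - \<alpha>) * h) = 1)"

lemma hopt_unique:
  assumes "0 < \<alpha>" "\<alpha> < 1" "h > 0" "ray_defect (\<alpha> * h) ((1 - \<alpha>) * h) = 1"
  shows "hopt \<alpha> = h"
  unfolding hopt_def
proof (rule the_equality)
  fix h' assume h': "h' > 0 \<and> ray_defect (\<alpha> * h') ((1 - \<alpha>) * h') = 1"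
  then show "h' = h"
    using ray_defect_strict_antimono[OF assms(1,2), of h h'] ray_defect_strict_antimono[OF assms(1,2), of h' h] assms
    by (cases h h' rule: linorder_cases) auto
qed (use assms in auto)

definition optimal_energy :: "real \<Rightarrow> real" where "optimal_energy \<alpha> = energy (hopt \<alpha>) \<alpha>"

context
  fixes \<alpha> :: real
  assumes \<alpha>: "0 < \<alpha>" "\<alpha> < 1"
begin

lemma hopt_pos: "hopt \<alpha> > 0" and ray_defect_hopt: "ray_defect (\<alpha> * hopt \<alpha>) ((1 - \<alpha>) * hopt \<alpha>) = 1"
  using ex_optimal[OF \<alpha>] hopt_unique[OF \<alpha>] by auto

lemma energy_deriv:
  assumes "h > 0"
  shows "((\<lambda>h. energy h \<alpha>) has_real_derivative (1 - ray_defect (\<alpha> * h) ((1 - \<alpha>) * h)) / h\<^sup>2) (at h)"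
proof -
  have "((\<lambda>h. \<Psi> (\<alpha> * h) ((1 - \<alpha>) * h)) has_real_derivative
      \<Psi>' (\<alpha> * h) ((1 - \<alpha>) * h) * \<alpha> + \<Psi>' ((1 - \<alpha>) * h) (\<alpha> * h) * (1 - \<alpha>)) (at h)"
    using \<alpha> assms by (intro \<Psi>_compose_real) (auto intro!: derivative_eq_intros)
  then have "((\<lambda>h. energy h \<alpha>) has_real_derivative
     ((\<Psi>' (\<alpha> * h) ((1 - \<alpha>) * h) * \<alpha> + \<Psi>' ((1 - \<alpha>) * h) (\<alpha> * h) * (1 - \<alpha>)) * h
       - (\<Psi> (\<alpha> * h) ((1 - \<alpha>) * h) - 1)) / h\<^sup>2) (at h)"
    unfolding energy_def using assms by (auto intro!: derivative_eq_intros simp: power2_eq_square)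
  then show ?thesis by (simp add: ray_defect_def algebra_simps)
qed

text \<open>The derivative of the energy in \<open>h\<close> has the sign of
  \<open>1 - ray_defect\<close>, which is negative before \<open>hopt \<alpha>\<close> and positive
  after it. Strictness is what yields uniqueness of the minimiser.\<close>

lemma energy_minimal:
  assumes "h > 0" "h \<noteq> hopt \<alpha>"
  shows "optimal_energy \<alpha> < energy h \<alpha>"
  unfolding optimal_energy_def
proof (cases "h < hopt \<alpha>")
  case True
  show "energy (hopt \<alpha>) \<alpha> < energy h \<alpha>"
  proof (rule DERIV_neg_imp_decreasing_open[OF True])
    fix t assume t: "h < t" "t < hopt \<alpha>"
    then have "1 - ray_defect (\<alpha> * t) ((1 - \<alpha>) * t) < 0"
      using ray_defect_strict_antimono[OF \<alpha>, of t "hopt \<alpha>"] ray_defect_hopt assms by auto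
    then show "\<exists>y. ((\<lambda>h. energy h \<alpha>) has_real_derivative y) (at t) \<and> y < 0"
      using energy_deriv[of t] t assms by (intro exI conjI) (auto intro!: divide_neg_pos)
    next
    show "continuous_on {h..hopt \<alpha>} (\<lambda>h. energy h \<alpha>)"
      using assms by (intro continuous_at_imp_continuous_on ballI DERIV_isCont[OF energy_deriv]) auto
  qed
next
  case False
  then have *: "hopt \<alpha> < h" using assms by simp
  show "energy (hopt \<alpha>) \<alpha> < energy h \<alpha>"
  proof (rule DERIV_pos_imp_increasing_open[OF *])
    fix t assume t: "hopt \<alpha> < t" "t < h"
    then have "1 - ray_defect (\<alpha> * t) ((1 - \<alpha>) * t) > 0"
      using ray_defect_strict_antimono[OF \<alpha>, of "hopt \<alpha>" t] ray_defect_hopt hopt_pos by auto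
    then show "\<exists>y. ((\<lambda>h. energy h \<alpha>) has_real_derivative y) (at t) \<and> y > 0"
      using energy_deriv[of t] t hopt_pos
      by (intro exI[of _ "(1 - ray_defect (\<alpha> * t) ((1 - \<alpha>) * t)) / t\<^sup>2"] conjI) auto
    next
    show "continuous_on {hopt \<alpha>..h} (\<lambda>h. energy h \<alpha>)"
      using hopt_pos by (intro continuous_at_imp_continuous_on ballI DERIV_isCont[OF energy_deriv]) auto
  qed
qed

lemma x\<^sub>0_le_hopt: "x\<^sub>0 \<le> \<alpha> * hopt \<alpha>" "x\<^sub>0 \<le> (1 - \<alpha>) * hopt \<alpha>"
  using x\<^sub>0_le[OF _ _ ray_defect_hopt] \<alpha> hopt_pos by auto

end

lemma hopt_commute:
  assumes "0 < \<alpha>" "\<alpha> < 1"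
  shows "hopt (1 - \<alpha>) = hopt \<alpha>"
  using hopt_unique[of "1 - \<alpha>" "hopt \<alpha>"] hopt_pos[OF assms] ray_defect_hopt[OF assms] ray_defect_commute assms
  by simp

text \<open>The thinner stripes keep a width of at least \<open>x\<^sub>0\<close>, so the period
  must grow at least like \<open>1 / \<alpha>\<close>.\<close>

lemma hopt_at_right_0: "filterlim hopt at_top (at_right 0)"
proof (rule filterlim_at_top_mono)
  show "filterlim (\<lambda>\<alpha>. x\<^sub>0 * inverse \<alpha>) at_top (at_right 0)"
    using x\<^sub>0_pos by (rule filterlim_tendsto_pos_mult_at_top[OF tendsto_const _ filterlim_inverse_at_top_right])
  have "\<forall>\<^sub>F \<alpha> in at_right 0. \<alpha> \<in> {0<..<1::real}"
    by (intro eventually_at_right_real) simp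
  then show "\<forall>\<^sub>F \<alpha> in at_right 0. x\<^sub>0 * inverse \<alpha> \<le> hopt \<alpha>"
  proof eventually_elim
    case (elim \<alpha>)
    then show ?case using x\<^sub>0_le_hopt(1)[of \<alpha>] by (simp add: field_simps)
  qed
qed

lemma hopt_at_left_1: "filterlim hopt at_top (at_left 1)"
proof -
  have "filterlim (\<lambda>\<alpha>::real. 1 - \<alpha>) (at_right 0) (at_left 1)"
    unfolding filterlim_at
    by (auto intro!: tendsto_eq_intros exI[of _ 0] simp: eventually_at_filter)
  with hopt_at_right_0 have "filterlim (\<lambda>\<alpha>. hopt (1 - \<alpha>)) at_top (at_left 1)"
    by (rule filterlim_compose)
  moreover have "\<forall>\<^sub>F \<alpha> in at_left 1. hopt (1 - \<alpha>) = hopt \<alpha>"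
    using eventually_at_left_real[OF zero_less_one] by eventually_elim (auto intro: hopt_commute)
  ultimately show ?thesis by (simp cong: filterlim_cong)
qed

text \<open>The map \<open>f\<close> sends \<open>(h, \<alpha>)\<close> to the pair of
  \<open>ray_defect\<close> and \<alpha>, so \<open>hopt t\<close> is the first component of its
  inverse at \<open>(1, t)\<close>. Monotonicity along rays makes \<open>f\<close> injective on all
  of \<open>S\<close>. The strong inverse function theorem then needs only continuity on
  \<open>S\<close> and an invertible derivative at one point, which avoids any discussion of
  continuity of the second derivatives of \<Psi>.\<close>

lemma hopt_differentiable:
  assumes \<alpha>: "0 < \<alpha>" "\<alpha> < 1"
  shows "\<exists>h'. (hopt has_real_derivative h') (at \<alpha>)"
proof -
  define S where "S = {0::real<..} \<times> {0<..<1::real}"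
  define f where "f z = (ray_defect (snd z * fst z) ((1 - snd z) * fst z), snd z)" for z :: "real \<times> real"
  define g where "g w = (THE z. z \<in> S \<and> f z = w)" for w
  define h where "h = hopt \<alpha>"
  have h: "h > 0" using hopt_pos[OF \<alpha>] by (simp add: h_def)
  have inj: "z = z'" if z: "z \<in> S" "z' \<in> S" "f z = f z'" for z z' :: "real \<times> real"
  proof -
    have 2: "snd z = snd z'" using z by (simp add: f_def)
    have "fst z = fst z'"
      using z 2 ray_defect_strict_antimono[of "snd z" "fst z" "fst z'"] ray_defect_strict_antimono[of "snd z" "fst z'" "fst z"]
      by (cases "fst z" "fst z'" rule: linorder_cases) (auto simp: S_def f_def)
    with 2 show ?thesis by (simp add: prod_eq_iff)
  qed
  have gf: "g (f z) = z" if "z \<in> S" for z :: "real \<times> real"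
    unfolding g_def using that inj by (intro the_equality) auto
  have der: "\<exists>D. (f has_derivative D) (at (a, b)) \<and> (\<forall>u. fst (D (u, 0)) = slope a b * u) \<and> (\<forall>u v. snd (D (u, v)) = v)"
    if "(a, b) \<in> S" for a b
  proof -
    have ab: "a > 0" "0 < b" "b < 1" using that by (auto simp: S_def)
    have F: "((\<lambda>z. snd z * fst z) has_derivative (\<lambda>w. b * fst w + snd w * a)) (at (a, b))"
      "((\<lambda>z. (1 - snd z) * fst z) has_derivative (\<lambda>w. (1 - b) * fst w - snd w * a)) (at (a, b))"
      by (auto intro!: derivative_eq_intros)
    obtain D where D: "((\<lambda>z. ray_defect (snd z * fst z) ((1 - snd z) * fst z)) has_derivative D) (at (a, b))"
      using ray_defect_compose[OF F] ab by auto
    have lin: "bounded_linear D" using D has_derivative_bounded_linear by blast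
    have "((\<lambda>t. (t, b)) has_derivative (\<lambda>u. (u, 0))) (at a)"
      by (auto intro!: derivative_eq_intros)
    from has_derivative_compose[OF this D]
    have "((\<lambda>t. ray_defect (b * t) ((1 - b) * t)) has_derivative (\<lambda>u. D (u, 0))) (at a)" by simp
    moreover have "((\<lambda>t. ray_defect (b * t) ((1 - b) * t)) has_derivative (\<lambda>u. slope a b * u)) (at a)"
      using ray_defect_deriv[OF ab(2,3,1)] unfolding has_field_derivative_def by simp
    ultimately have "(\<lambda>u. D (u, 0)) = (\<lambda>u. slope a b * u)" by (rule has_derivative_unique)
    then have "D (u, 0) = slope a b * u" for u by metis
    moreover have "(f has_derivative (\<lambda>w. (D w, snd w))) (at (a, b))"
      unfolding f_def[abs_def] by (intro has_derivative_Pair D has_derivative_snd has_derivative_ident)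
    ultimately show ?thesis by (intro exI[of _ "\<lambda>w. (D w, snd w)"]) auto
  qed
  have hS: "(h, \<alpha>) \<in> S" using h \<alpha> by (auto simp: S_def)
  obtain D where D: "(f has_derivative D) (at (h, \<alpha>))"
    and D1: "\<And>u. fst (D (u, 0)) = slope h \<alpha> * u" and D2: "\<And>u v. snd (D (u, v)) = v"
    using der[OF hS] by blast
  have lin: "linear D" using D has_derivative_linear by blast
  \<comment> \<open>The derivative is triangular, with diagonal entries
    \<open>slope h \<alpha>\<close> and 1; this is its explicit inverse.\<close>
  define D' where "D' w = ((fst w - fst (D (0, snd w))) / slope h \<alpha>, snd w)" for w
  have "D \<circ> D' = id"
  proof
    fix w :: "real \<times> real"
    obtain u v where w: "w = (u, v)" by force
    have n: "slope h \<alpha> \<noteq> 0" using slope_neg[OF \<alpha> h] by simp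
    define t where "t = (u - fst (D (0, v))) / slope h \<alpha>"
    have "D (t, v) = D (t, 0) + D (0, v)" using linear_add[OF lin, of "(t, 0)" "(0, v)"] by simp
    then have "fst (D (t, v)) = u" using D1[of t] n by (simp add: t_def)
    then show "(D \<circ> D') w = id w" using D2[of t v] by (simp add: D'_def w t_def prod_eq_iff)
  qed
  have "(g has_derivative D') (at (f (h, \<alpha>)))"
  proof (rule has_derivative_inverse_strong[OF _ hS _ gf D \<open>D \<circ> D' = id\<close>])
    show "open S" by (auto simp: S_def intro: open_Times)
    show "continuous_on S f"
    proof (rule continuous_at_imp_continuous_on, rule ballI)
      fix z assume "z \<in> S"
      then show "isCont f z" using der[of "fst z" "snd z"] has_derivative_continuous by auto
    qed
  qed
  moreover have "f (h, \<alpha>) = (1, \<alpha>)" using ray_defect_hopt[OF \<alpha>] by (simp add: f_def h_def)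
  ultimately have "(g has_derivative D') (at (1, \<alpha>))" by simp
  moreover have "((\<lambda>t. (1::real, t)) has_derivative (\<lambda>u. (0, u))) (at \<alpha>)"
    by (auto intro!: derivative_eq_intros)
  ultimately have d: "((\<lambda>t. fst (g (1, t))) has_derivative (\<lambda>u. fst (D' (0, u)))) (at \<alpha>)"
    using has_derivative_compose[of "\<lambda>t. (1, t)" _ \<alpha> UNIV g D'] has_derivative_fst by blast
  have "fst (g (1, t)) = hopt t" if "t \<in> {0<..<1}" for t
  proof -
    have t: "0 < t" "t < 1" using that by auto
    have "f (hopt t, t) = (1, t)" using ray_defect_hopt[OF t] by (simp add: f_def)
    then show ?thesis using gf[of "(hopt t, t)"] hopt_pos[OF t] t by (auto simp: S_def)
  qed
  then have "(hopt has_derivative (\<lambda>u. fst (D' (0, u)))) (at \<alpha>)"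
    by (intro has_derivative_transform_within_open[OF d, where s = "{0<..<1}"]) (use \<alpha> in auto)
  then show ?thesis
    using differentiable_def real_differentiable_def by blast
qed

section \<open>Derivatives of the minimal energy in the density\<close>

definition marginal :: "real \<Rightarrow> real" where
  "marginal \<alpha> = \<Psi>' (\<alpha> * hopt \<alpha>) ((1 - \<alpha>) * hopt \<alpha>) - \<Psi>' ((1 - \<alpha>) * hopt \<alpha>) (\<alpha> * hopt \<alpha>)"

lemma hopt_parts_deriv:
  assumes "(hopt has_real_derivative h') (at \<alpha>)"
  shows "((\<lambda>t. t * hopt t) has_real_derivative hopt \<alpha> + \<alpha> * h') (at \<alpha>)"
    "((\<lambda>t. (1 - t) * hopt t) has_real_derivative - hopt \<alpha> + (1 - \<alpha>) * h') (at \<alpha>)"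
  using assms by (auto intro!: derivative_eq_intros)

context
  fixes \<alpha> :: real
  assumes \<alpha>: "0 < \<alpha>" "\<alpha> < 1"
begin

text \<open>An envelope argument: stationarity gives \<open>\<Psi> x y - 1 = x * P + y * Q\<close>,
  and with it all terms containing the derivative of \<open>hopt\<close> cancel.\<close>

lemma optimal_energy_deriv: "(optimal_energy has_real_derivative marginal \<alpha>) (at \<alpha>)"
proof -
  obtain h' where h': "(hopt has_real_derivative h') (at \<alpha>)" using hopt_differentiable[OF \<alpha>] by blast
  define h x y P Q where "h = hopt \<alpha>" and "x = \<alpha> * h" and "y = (1 - \<alpha>) * h"
    and "P = \<Psi>' x y" and "Q = \<Psi>' y x"
  have h: "h > 0" using hopt_pos[OF \<alpha>] by (simp add: h_def)
  have "((\<lambda>t. \<Psi> (t * hopt t) ((1 - t) * hopt t)) has_real_derivative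
      P * (h + \<alpha> * h') + Q * (- h + (1 - \<alpha>) * h')) (at \<alpha>)"
    unfolding P_def Q_def x_def y_def h_def
    using hopt_parts_deriv[OF h'] \<alpha> hopt_pos[OF \<alpha>] by (intro \<Psi>_compose_real) auto
  then have "((\<lambda>t. (\<Psi> (t * hopt t) ((1 - t) * hopt t) - 1) / hopt t) has_real_derivative
      ((P * (h + \<alpha> * h') + Q * (- h + (1 - \<alpha>) * h')) * h - (\<Psi> x y - 1) * h') / (h * h)) (at \<alpha>)"
    using h h' by (auto intro!: derivative_eq_intros simp: h_def x_def y_def)
  moreover have E: "\<Psi> x y - 1 = x * P + y * Q"
    using ray_defect_hopt[OF \<alpha>] by (simp add: ray_defect_def P_def Q_def x_def y_def h_def)
  have "(P * (h + \<alpha> * h') + Q * (- h + (1 - \<alpha>) * h')) * h - (\<Psi> x y - 1) * h' = (P - Q) * (h * h)"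
    unfolding E by (simp add: x_def y_def algebra_simps)
  then have "((P * (h + \<alpha> * h') + Q * (- h + (1 - \<alpha>) * h')) * h - (\<Psi> x y - 1) * h') / (h * h) = marginal \<alpha>"
    using h by (simp add: marginal_def P_def Q_def x_def y_def h_def)
  ultimately show ?thesis by (simp add: optimal_energy_def[abs_def] energy_def)
qed

text \<open>Both first derivatives of \<Psi> are nonpositive, and by stationarity their absolute
  values weighted with \<open>x\<close> and \<open>y\<close> sum to \<open>1 - \<Psi> x y\<close>,
  which is less than 1. Since both weights are at least \<open>x\<^sub>0\<close>, the bound is
  uniform in \<alpha>.\<close>

lemma abs_marginal_le: "\<bar>marginal \<alpha>\<bar> \<le> 1 / x\<^sub>0"
proof -
  define x y where "x = \<alpha> * hopt \<alpha>" and "y = (1 - \<alpha>) * hopt \<alpha>"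
  have xy: "x\<^sub>0 \<le> x" "x\<^sub>0 \<le> y" using x\<^sub>0_le_hopt[OF \<alpha>] by (auto simp: x_def y_def)
  have pos: "x > 0" "y > 0" using xy x\<^sub>0_pos by auto
  have neg: "\<Psi>' x y \<le> 0" "\<Psi>' y x \<le> 0" using \<Psi>'_nonpos pos by auto
  have "0 < K * Gamma (r + 1) / (2 * x + e) powr (r + 1)" using KG_pos pos e by (intro divide_pos_pos) auto
  then have "0 < \<Psi> x y" using \<Psi>_ge[OF pos] by linarith
  moreover have "\<Psi> x y - x * \<Psi>' x y - y * \<Psi>' y x = 1"
    using ray_defect_hopt[OF \<alpha>] by (simp add: ray_defect_def x_def y_def)
  moreover have "x * \<Psi>' x y \<le> x\<^sub>0 * \<Psi>' x y" "y * \<Psi>' y x \<le> x\<^sub>0 * \<Psi>' y x"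
    using neg xy by (auto intro!: mult_right_mono_neg)
  moreover have "x\<^sub>0 * \<Psi>' x y \<le> 0" "x\<^sub>0 * \<Psi>' y x \<le> 0"
    using neg x\<^sub>0_pos by (auto intro!: mult_nonneg_nonpos)
  ultimately have "\<bar>x\<^sub>0 * \<Psi>' x y - x\<^sub>0 * \<Psi>' y x\<bar> \<le> 1" by linarith
  then have "x\<^sub>0 * \<bar>marginal \<alpha>\<bar> \<le> 1"
    using x\<^sub>0_pos by (simp add: marginal_def x_def y_def abs_mult right_diff_distrib[symmetric])
  then show ?thesis using x\<^sub>0_pos by (simp add: field_simps)
qed

text \<open>Differentiating \<open>ray_defect (x \<alpha>) (y \<alpha>) = 1\<close> shows that \<open>w = (x' \<alpha>, y' \<alpha>)\<close> is
  orthogonal to \<open>(x, y)\<close> for the Hessian, so adding a multiple of \<open>(x, y)\<close> to the direction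
  \<open>(1, -1)\<close> turns the derivative of \<open>marginal\<close> into the Hessian in direction \<open>w\<close>.\<close>

lemma marginal_deriv:
  obtains v w where
    "(marginal has_real_derivative hess (\<alpha> * hopt \<alpha>) ((1 - \<alpha>) * hopt \<alpha>) v w / hopt \<alpha>) (at \<alpha>)"
    "v * ((1 - \<alpha>) * hopt \<alpha>) - w * (\<alpha> * hopt \<alpha>) = (hopt \<alpha>)\<^sup>2"
proof -
  obtain h' where h': "(hopt has_real_derivative h') (at \<alpha>)" using hopt_differentiable[OF \<alpha>] by blast
  define h x y v w A B C where "h = hopt \<alpha>" and "x = \<alpha> * h" and "y = (1 - \<alpha>) * h"
    and "v = h + \<alpha> * h'" and "w = - h + (1 - \<alpha>) * h'"
    and "A = \<Psi>_diag x y" and "B = \<Psi>_mixed x y" and "C = \<Psi>_diag y x"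
  note defs = h_def x_def y_def v_def w_def A_def B_def C_def
  have h: "h > 0" "x > 0" "y > 0" using hopt_pos[OF \<alpha>] \<alpha> by (auto simp: defs)
  have vw: "((\<lambda>t. t * hopt t) has_real_derivative v) (at \<alpha>)"
    "((\<lambda>t. (1 - t) * hopt t) has_real_derivative w) (at \<alpha>)"
    using hopt_parts_deriv[OF h'] by (simp_all add: defs)
  have "((\<lambda>t. ray_defect (t * hopt t) ((1 - t) * hopt t)) has_real_derivative
     - (x * (A * v + B * w)) - y * (C * w + B * v)) (at \<alpha>)"
    using ray_defect_compose_real[OF vw] h by (simp add: A_def B_def C_def x_def y_def h_def)
  moreover have "((\<lambda>t. ray_defect (t * hopt t) ((1 - t) * hopt t)) has_real_derivative 0) (at \<alpha>)"
    by (rule has_field_derivative_transform_within_open[OF DERIV_const[of 1], where S = "{0<..<1}"])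
      (use \<alpha> ray_defect_hopt in auto)
  ultimately have *: "- (x * (A * v + B * w)) - y * (C * w + B * v) = 0" by (rule DERIV_unique)
  have "((\<lambda>t. \<Psi>' (t * hopt t) ((1 - t) * hopt t) - \<Psi>' ((1 - t) * hopt t) (t * hopt t)) has_real_derivative
     (A * v + B * w) - (C * w + B * v)) (at \<alpha>)"
    using DERIV_diff[OF \<Psi>'_compose_real[OF vw] \<Psi>'_compose_real[OF vw(2,1)]] h
    by (simp add: A_def B_def C_def x_def y_def h_def \<Psi>_mixed_commute[of "(1 - \<alpha>) * hopt \<alpha>"])
  moreover have "(A * v + B * w) - (C * w + B * v) = hess x y v w / h"
  proof -
    have "h * ((A * v + B * w) - (C * w + B * v))
        = (v - \<alpha> * h') * (A * v + B * w) + (w - (1 - \<alpha>) * h') * (C * w + B * v)"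
      by (simp add: v_def w_def algebra_simps)
    also have "\<dots> = hess x y v w - h' * (\<alpha> * (A * v + B * w) + (1 - \<alpha>) * (C * w + B * v))"
      by (simp add: hess_def A_def B_def C_def power2_eq_square algebra_simps)
    also have "\<alpha> * (A * v + B * w) + (1 - \<alpha>) * (C * w + B * v) = 0"
    proof -
      have "h * (\<alpha> * (A * v + B * w) + (1 - \<alpha>) * (C * w + B * v)) = 0"
        using * by (simp add: x_def y_def algebra_simps)
      then show ?thesis using h by simp
    qed
    finally show ?thesis using h by (simp add: field_simps)
  qed
  ultimately have "(marginal has_real_derivative hess x y v w / h) (at \<alpha>)"
    by (simp add: marginal_def[abs_def])
  moreover have "v * y - w * x = h\<^sup>2"
    by (simp add: v_def w_def x_def y_def power2_eq_square algebra_simps)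
  ultimately show ?thesis using that[of v w] by (simp add: x_def y_def h_def)
qed

end

text \<open>For \<alpha> at most 1/2, \<open>hess_ge_cross\<close> with cross product
  \<open>h\<^sup>2\<close> gives \<open>c\<^sub>0 * y powr - (r + 5) * h ^ 3\<close>. From
  \<open>y \<le> h\<close> this is at least \<open>c\<^sub>0 * h powr - (r + 2)\<close>, and
  \<open>\<alpha> * h \<le> X\<close> turns it into a multiple of
  \<open>\<alpha> powr (r + 2)\<close>. The other half follows by exchanging the phases.\<close>

lemma marginal_deriv_ge:
  obtains c where "c > 0" "\<And>\<alpha>. 0 < \<alpha> \<Longrightarrow> \<alpha> < 1 \<Longrightarrow>
    \<exists>m. (marginal has_real_derivative m) (at \<alpha>) \<and> c * min (\<alpha> powr (r + 2)) ((1 - \<alpha>) powr (r + 2)) \<le> m"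
proof -
  have X: "0 < x\<^sub>0" "x\<^sub>0 \<le> X" "X > 0" using x\<^sub>0_pos by (auto simp: X_def)
  obtain c\<^sub>0 where c0: "c\<^sub>0 > 0" and hess: "\<And>x y v w. x\<^sub>0 \<le> x \<Longrightarrow> x \<le> X \<Longrightarrow> x \<le> y \<Longrightarrow>
      c\<^sub>0 * y powr - (r + 5) * (v * y - w * x)\<^sup>2 \<le> hess x y v w"
    using hess_ge_cross[OF X(1,2)] by metis
  define c where "c = c\<^sub>0 * X powr - (r + 2)"
  have c: "c > 0" using c0 X by (simp add: c_def)
  have main: "c * \<beta> powr (r + 2) \<le> hess (\<beta> * h) ((1 - \<beta>) * h) v w / h"
    if \<beta>: "0 < \<beta>" "\<beta> \<le> 1 - \<beta>" and h: "h = hopt \<beta>"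
      and vw: "(v * ((1 - \<beta>) * h) - w * (\<beta> * h))\<^sup>2 = (h\<^sup>2)\<^sup>2" for \<beta> v w h
  proof -
    have \<beta>1: "\<beta> < 1" using \<beta> by simp
    define x y where "x = \<beta> * h" and "y = (1 - \<beta>) * h"
    have h0: "h > 0" using hopt_pos[OF \<beta>(1) \<beta>1] h by simp
    have xy: "x\<^sub>0 \<le> x" "x \<le> y" "0 < x" "0 < y" "y \<le> h"
      using x\<^sub>0_le_hopt[OF \<beta>(1) \<beta>1] h \<beta> \<beta>1 h0 by (auto simp: x_def y_def)
    have "ray_defect x y = 1" using ray_defect_hopt[OF \<beta>(1) \<beta>1] h by (simp add: x_def y_def)
    then have xX: "x \<le> X" using xy le_X by blast
    have "c * \<beta> powr (r + 2) = c\<^sub>0 * (X / \<beta>) powr - (r + 2)"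
      unfolding c_def powr_minus using \<beta> X by (simp add: powr_divide field_simps)
    also have "\<dots> \<le> c\<^sub>0 * h powr - (r + 2)"
      using c0 h0 r xX \<beta> by (intro mult_left_mono powr_mono2') (auto simp: x_def field_simps)
    also have "h powr - (r + 2) = h powr - (r + 5) * h ^ 3"
    proof -
      have "- (r + 2) = - (r + 5) + real 3" by simp
      then have "h powr - (r + 2) = h powr (- (r + 5) + real 3)" by (rule arg_cong)
      then show ?thesis using h0 unfolding powr_add by (simp add: powr_realpow)
    qed
    also have "c\<^sub>0 * (h powr - (r + 5) * h ^ 3) \<le> c\<^sub>0 * (y powr - (r + 5) * h ^ 3)"
      using c0 h0 r xy by (intro mult_left_mono mult_right_mono powr_mono2') auto
    also have "\<dots> = c\<^sub>0 * y powr - (r + 5) * (v * y - w * x)\<^sup>2 / h"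
      using vw h0 by (simp add: x_def y_def power2_eq_square power3_eq_cube)
    also have "\<dots> \<le> hess x y v w / h"
      using hess[OF xy(1) xX xy(2)] h0 by (intro divide_right_mono) auto
    finally show ?thesis by (simp add: x_def y_def)
  qed
  show ?thesis
  proof (rule that[OF c])
    fix \<alpha> :: real assume \<alpha>: "0 < \<alpha>" "\<alpha> < 1"
    obtain v w where
      d: "(marginal has_real_derivative hess (\<alpha> * hopt \<alpha>) ((1 - \<alpha>) * hopt \<alpha>) v w / hopt \<alpha>) (at \<alpha>)"
      and vw: "v * ((1 - \<alpha>) * hopt \<alpha>) - w * (\<alpha> * hopt \<alpha>) = (hopt \<alpha>)\<^sup>2"
      using marginal_deriv[OF \<alpha>] by blast
    have "c * min (\<alpha> powr (r + 2)) ((1 - \<alpha>) powr (r + 2)) \<le> hess (\<alpha> * hopt \<alpha>) ((1 - \<alpha>) * hopt \<alpha>) v w / hopt \<alpha>"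
    proof (cases "\<alpha> \<le> 1 - \<alpha>")
      case True
      have "c * min (\<alpha> powr (r + 2)) ((1 - \<alpha>) powr (r + 2)) \<le> c * \<alpha> powr (r + 2)" using c by simp
      also have "\<dots> \<le> hess (\<alpha> * hopt \<alpha>) ((1 - \<alpha>) * hopt \<alpha>) v w / hopt \<alpha>"
        by (rule main) (use \<alpha> True vw in auto)
      finally show ?thesis .
    next
      case False
      have sq: "(w * (\<alpha> * hopt \<alpha>) - v * ((1 - \<alpha>) * hopt \<alpha>))\<^sup>2 = ((hopt \<alpha>)\<^sup>2)\<^sup>2"
        by (subst power2_commute) (simp only: vw)
      have "c * min (\<alpha> powr (r + 2)) ((1 - \<alpha>) powr (r + 2)) \<le> c * (1 - \<alpha>) powr (r + 2)" using c by simp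
      also have "\<dots> \<le> hess ((1 - \<alpha>) * hopt \<alpha>) ((1 - (1 - \<alpha>)) * hopt \<alpha>) w v / hopt \<alpha>"
        by (rule main) (use \<alpha> False sq hopt_commute[OF \<alpha>] in auto)
      finally show ?thesis by (simp add: hess_commute[of "(1 - \<alpha>) * hopt \<alpha>"])
    qed
    with d show "\<exists>m. (marginal has_real_derivative m) (at \<alpha>) \<and> c * min (\<alpha> powr (r + 2)) ((1 - \<alpha>) powr (r + 2)) \<le> m"
      by blast
  qed
qed

end

section \<open>Interfaces in one dimension\<close>

text \<open>A shift by a multiple of \<open>L\<close> brings the left end into
  \<open>{0..<L}\<close>; the part sticking out beyond \<open>L\<close> is then moved back by one
  period.\<close>

lemma nn_integral_periodic:
  fixes F :: "real \<Rightarrow> ennreal"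
  assumes [measurable]: "F \<in> borel_measurable borel" and L: "L > 0" and per: "\<And>t. F (t + L) = F t"
  shows "(\<integral>\<^sup>+t. F t * indicator {a..<a + L} t \<partial>lborel) = (\<integral>\<^sup>+t. F t * indicator {0..<L} t \<partial>lborel)"
proof -
  have trans: "(\<integral>\<^sup>+t. G t \<partial>lborel) = (\<integral>\<^sup>+t. G (t + c) \<partial>lborel)"
    if [measurable]: "G \<in> borel_measurable borel" for G :: "real \<Rightarrow> ennreal" and c
    using nn_integral_real_affine[OF that, of 1 c] by (simp add: add.commute)
  have per_nat: "F (t + real n * L) = F t" for n t
    by (induction n) (auto simp: distrib_right add.assoc[symmetric] per add.commute[of L])
  have per_int: "F (t + of_int k * L) = F t" for k t
  proof (cases "k \<ge> 0")
    case True
    then show ?thesis using per_nat[of t "nat k"] by simp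
  next
    case False
    then show ?thesis using per_nat[of "t + of_int k * L" "nat (- k)"] by simp
  qed
  define k where "k = \<lfloor>a / L\<rfloor>"
  define b where "b = a - of_int k * L"
  have b: "0 \<le> b" "b < L"
    using floor_divide_lower[OF L, of a] floor_divide_upper[OF L, of a]
    by (simp_all add: b_def k_def algebra_simps)
  have "(\<integral>\<^sup>+t. F t * indicator {a..<a + L} t \<partial>lborel)
      = (\<integral>\<^sup>+t. F (t + of_int k * L) * indicator {a..<a + L} (t + of_int k * L) \<partial>lborel)"
    by (rule trans) measurable
  also have "\<dots> = (\<integral>\<^sup>+t. F t * indicator {b..<b + L} t \<partial>lborel)"
    unfolding per_int by (intro nn_integral_cong) (auto simp: b_def indicator_def)
  also have "\<dots> = (\<integral>\<^sup>+t. F t * indicator {b..<L} t + F t * indicator {L..<b + L} t \<partial>lborel)"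
    using b by (intro nn_integral_cong) (auto simp: indicator_def)
  also have "\<dots> = (\<integral>\<^sup>+t. F t * indicator {b..<L} t \<partial>lborel) + (\<integral>\<^sup>+t. F t * indicator {L..<b + L} t \<partial>lborel)"
    by (rule nn_integral_add) auto
  also have "(\<integral>\<^sup>+t. F t * indicator {L..<b + L} t \<partial>lborel)
      = (\<integral>\<^sup>+t. F (t + L) * indicator {L..<b + L} (t + L) \<partial>lborel)"
    by (rule trans) measurable
  also have "\<dots> = (\<integral>\<^sup>+t. F t * indicator {0..<b} t \<partial>lborel)"
    unfolding per by (intro nn_integral_cong) (auto simp: indicator_def)
  also have "(\<integral>\<^sup>+t. F t * indicator {b..<L} t \<partial>lborel) + (\<integral>\<^sup>+t. F t * indicator {0..<b} t \<partial>lborel)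
      = (\<integral>\<^sup>+t. F t * indicator {b..<L} t + F t * indicator {0..<b} t \<partial>lborel)"
    by (rule nn_integral_add[symmetric]) auto
  also have "\<dots> = (\<integral>\<^sup>+t. F t * indicator {0..<L} t \<partial>lborel)"
    using b by (intro nn_integral_cong) (auto simp: indicator_def)
  finally show ?thesis .
qed

lemma has_bochner_integral_exp_greaterThan:
  fixes s u :: real
  assumes "s > 0"
  shows "has_bochner_integral lborel (\<lambda>w. indicator {u<..} w * exp (- (s * (w - u)))) (1 / s)"
proof (rule has_bochner_integral_nn_integral)
  have "(\<integral>\<^sup>+w. ennreal (indicator {u<..} w * exp (- (s * (w - u)))) \<partial>lborel)
      = (\<integral>\<^sup>+w. ennreal (indicator {0<..} w * (w powr 0 * exp (- (s * w)))) \<partial>lborel)"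
    by (subst nn_integral_real_affine[of _ 1 u]) (auto intro!: nn_integral_cong simp: indicator_def)
  also have "\<dots> = ennreal (1 / s)"
    using nn_integral_powr_exp[of s 0] assms by simp
  finally show "(\<integral>\<^sup>+w. ennreal (indicator {u<..} w * exp (- (s * (w - u)))) \<partial>lborel) = ennreal (1 / s)" .
qed (use assms in auto)

lemma nn_integral_exp_cell:
  fixes s u v :: real
  assumes "s > 0" "u \<le> v"
  shows "(\<integral>\<^sup>+w. ennreal (exp (- (s * (v - w)))) * indicator {u<..<v} w \<partial>lborel) = ennreal ((1 - exp (- (s * (v - u)))) / s)"
proof -
  have "(\<integral>\<^sup>+w. ennreal (exp (- (s * (v - w)))) * indicator {u<..<v} w \<partial>lborel)
      = (\<integral>\<^sup>+w. ennreal (exp (- (s * (v - w)))) * indicator {u..v} w \<partial>lborel)"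
    by (rule nn_integral_cong_AE)
      (use AE_lborel_singleton[of u] AE_lborel_singleton[of v] in eventually_elim, auto simp: indicator_def)
  also have "\<dots> = ennreal (exp (- (s * (v - v))) / s - exp (- (s * (v - u))) / s)"
    using assms by (intro nn_integral_FTC_Icc) (auto intro!: derivative_eq_intros)
  finally show ?thesis by (simp add: diff_divide_distrib)
qed

lemma nn_integral_exp_linear:
  fixes s :: real
  assumes "s > 0"
  shows "(\<integral>\<^sup>+t. ennreal (indicator {0<..} t * exp (- (s * t)) * t) \<partial>lborel) = ennreal (1 / s\<^sup>2)"
proof -
  have "Gamma (2::real) = 1" using Gamma_fact[of 1, where 'a = real] by simp
  moreover have "(\<integral>\<^sup>+t. ennreal (indicator {0<..} t * exp (- (s * t)) * t) \<partial>lborel)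
      = (\<integral>\<^sup>+t. ennreal (indicator {0<..} t * (t powr 1 * exp (- (s * t)))) \<partial>lborel)"
    by (intro nn_integral_cong) (auto simp: indicator_def mult.commute)
  ultimately show ?thesis using nn_integral_powr_exp[of s 1] assms by simp
qed

text \<open>The quadratic form \<open>\<Sum>j. T j * (z j + z (j + 1) - c)\<^sup>2\<close> is nonnegative; since \<open>\<Sum>j. (z (j + 1) - z j)\<close> and
  \<open>\<Sum>j. ((z (j + 1))\<^sup>2 - (z j)\<^sup>2)\<close> telescope to zero, expanding it leaves exactly the claim.\<close>

lemma sum_jump_le:
  fixes z T f :: "nat \<Rightarrow> real"
  assumes T: "\<And>j. j < N \<Longrightarrow> 0 \<le> T j"
    and step: "\<And>j. j < N \<Longrightarrow> z (Suc j) - z j = T j * (z j + z (Suc j) - 2 * f j)"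
    and per: "z N = z 0"
  shows "2 * (\<Sum>j<N. f j * (z j - z (Suc j))) \<le> (\<Sum>j<N. T j * (2 * f j - c)\<^sup>2)"
proof -
  have eq: "T j * (z j + z (Suc j) - c)\<^sup>2 = ((z (Suc j))\<^sup>2 - (z j)\<^sup>2) - 2 * c * (z (Suc j) - z j)
      - 2 * (f j * (z j - z (Suc j))) + T j * (2 * f j - c)\<^sup>2" if "j < N" for j
  proof -
    define \<sigma> where "\<sigma> = z j + z (Suc j)"
    have s: "T j * (\<sigma> - 2 * f j) = z (Suc j) - z j" using step[OF that] by (simp add: \<sigma>_def)
    have "T j * (\<sigma> - c)\<^sup>2 = T j * (\<sigma> - 2 * f j) * (\<sigma> - 2 * f j + 2 * (2 * f j - c)) + T j * (2 * f j - c)\<^sup>2"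
      by (simp add: power2_eq_square algebra_simps)
    also have "\<dots> = (z (Suc j) - z j) * (\<sigma> + 2 * f j - 2 * c) + T j * (2 * f j - c)\<^sup>2"
      unfolding s by (simp add: algebra_simps)
    finally show ?thesis by (simp add: \<sigma>_def power2_eq_square algebra_simps)
  qed
  have "0 \<le> (\<Sum>j<N. T j * (z j + z (Suc j) - c)\<^sup>2)"
    using T by (intro sum_nonneg) auto
  also have "\<dots> = (\<Sum>j<N. ((z (Suc j))\<^sup>2 - (z j)\<^sup>2) - 2 * c * (z (Suc j) - z j)
      - 2 * (f j * (z j - z (Suc j))) + T j * (2 * f j - c)\<^sup>2)"
    using eq by (intro sum.cong) auto
  also have "\<dots> = (\<Sum>j<N. (z (Suc j))\<^sup>2 - (z j)\<^sup>2) - 2 * c * (\<Sum>j<N. z (Suc j) - z j)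
      - 2 * (\<Sum>j<N. f j * (z j - z (Suc j))) + (\<Sum>j<N. T j * (2 * f j - c)\<^sup>2)"
    by (simp only: sum.distrib sum_subtractf sum_distrib_left[symmetric])
  also have "(\<Sum>j<N. (z (Suc j))\<^sup>2 - (z j)\<^sup>2) = 0"
    using sum_lessThan_telescope[of "\<lambda>j. (z j)\<^sup>2" N] per by simp
  also have "(\<Sum>j<N. z (Suc j) - z j) = 0"
    using sum_lessThan_telescope[of z N] per by simp
  finally show ?thesis by simp
qed

text \<open>One period cut at its \<open>N\<close> interfaces, with \<open>f j\<close> the value on
  the cell between \<open>x j\<close> and \<open>x (Suc j)\<close>. Index \<open>N\<close> repeats
  index 0 one period later, so sums over a period telescope. Only open cells are prescribed:
  \<open>B\<close> is a Borel representative whose values at the interfaces are left open.\<close>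

locale interfaces =
  fixes B :: "real set" and L :: real and N :: nat and x :: "nat \<Rightarrow> real" and f :: "nat \<Rightarrow> real"
  assumes B [measurable]: "B \<in> sets borel" and L: "L > 0" and N: "N > 0"
    and periodic: "\<And>t. t + L \<in> B \<longleftrightarrow> t \<in> B"
    and x_less: "\<And>j. j < N \<Longrightarrow> x j < x (Suc j)"
    and x_N: "x N = x 0 + L"
    and f01: "\<And>j. j < N \<Longrightarrow> f j = 0 \<or> f j = 1"
    and f_Suc: "\<And>j. j < N \<Longrightarrow> f (Suc j) = 1 - f j"
    and f_N: "f N = f 0"
    and cell: "\<And>j t. j < N \<Longrightarrow> x j < t \<Longrightarrow> t < x (Suc j) \<Longrightarrow> indicator B t = f j"
begin

abbreviation b :: "real \<Rightarrow> real" where "b \<equiv> indicator B"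

definition gap :: "real \<Rightarrow> ennreal" where
  "gap t = (\<integral>\<^sup>+u. ennreal \<bar>b u - b (u + t)\<bar> * indicator {0..<L} u \<partial>lborel)"

definition Z :: "real \<Rightarrow> real \<Rightarrow> real" where
  "Z s u = s * (\<integral>w. indicator {u<..} w * exp (- (s * (w - u))) * b w \<partial>lborel)"

definition jumps :: "real \<Rightarrow> real" where
  "jumps s = (\<Sum>j<N. f j * (Z s (x j) - Z s (x (Suc j))))"

text \<open>The values alternate around a cycle, so exactly half of the cells are full.\<close>

lemma sum_f: "(\<Sum>j<N. f j) = real N / 2"
proof -
  have "(\<Sum>j<N. f (Suc j)) - (\<Sum>j<N. f j) = 0"
    using sum_lessThan_telescope[of f N] f_N by (simp add: sum_subtractf)
  moreover have "(\<Sum>j<N. f (Suc j)) = real N - (\<Sum>j<N. f j)"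
    using f_Suc by (simp add: sum_subtractf)
  ultimately show ?thesis by simp
qed

lemma x_mono: "i \<le> j \<Longrightarrow> j \<le> N \<Longrightarrow> x i \<le> x j"
proof (induction j rule: dec_induct)
  case (step j)
  then show ?case using x_less[of j] by simp
qed simp

lemma AE_cells: "AE u in lborel. indicator {x 0..<x N} u = (\<Sum>j<N. indicator {x j<..<x (Suc j)} u :: ennreal)"
proof -
  have "n \<le> N \<Longrightarrow> AE u in lborel. indicator {x 0..<x n} u = (\<Sum>j<n. indicator {x j<..<x (Suc j)} u :: ennreal)" for n
  proof (induction n)
    case (Suc n)
    then have "AE u in lborel. indicator {x 0..<x n} u = (\<Sum>j<n. indicator {x j<..<x (Suc j)} u :: ennreal)" by simp
    then show ?case
      using AE_lborel_singleton[of "x n"]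
    proof eventually_elim
      case (elim u)
      have "indicator {x 0..<x (Suc n)} u = (indicator {x 0..<x n} u + indicator {x n<..<x (Suc n)} u :: ennreal)"
        using elim x_less[of n] x_mono[of 0 n] Suc.prems by (auto simp: indicator_def)
      then show ?case using elim by simp
    qed
  qed simp
  then show ?thesis by simp
qed

lemma nn_integral_cells:
  assumes [measurable]: "F \<in> borel_measurable borel"
  shows "(\<integral>\<^sup>+u. F u * indicator {x 0..<x N} u \<partial>lborel) = (\<Sum>j<N. \<integral>\<^sup>+u. F u * indicator {x j<..<x (Suc j)} u \<partial>lborel)"
proof -
  have "(\<integral>\<^sup>+u. F u * indicator {x 0..<x N} u \<partial>lborel) = (\<integral>\<^sup>+u. (\<Sum>j<N. F u * indicator {x j<..<x (Suc j)} u) \<partial>lborel)"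
    by (rule nn_integral_cong_AE) (use AE_cells in eventually_elim, simp add: sum_distrib_left)
  also have "\<dots> = (\<Sum>j<N. \<integral>\<^sup>+u. F u * indicator {x j<..<x (Suc j)} u \<partial>lborel)"
    by (rule nn_integral_sum) measurable
  finally show ?thesis .
qed

lemma b01: "0 \<le> b w" "b w \<le> 1" by (auto simp: indicator_def)

lemma b_periodic: "b (t + L) = b t" using periodic by (simp add: indicator_def)

lemma gap_cells: "gap t = (\<Sum>j<N. \<integral>\<^sup>+u. ennreal \<bar>b u - b (u + t)\<bar> * indicator {x j<..<x (Suc j)} u \<partial>lborel)"
proof -
  have "b (u + L + t) = b (u + t)" for u using b_periodic[of "u + t"] by (simp add: algebra_simps)
  then have "gap t = (\<integral>\<^sup>+u. ennreal \<bar>b u - b (u + t)\<bar> * indicator {x 0..<x 0 + L} u \<partial>lborel)"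
    unfolding gap_def by (intro nn_integral_periodic[symmetric] L) (auto simp: b_periodic)
  then show ?thesis unfolding x_N[symmetric] by (simp add: nn_integral_cells)
qed

lemma gap_minus: "gap (- t) = gap t"
proof -
  have "gap (- t) = (\<integral>\<^sup>+u. ennreal \<bar>b (u + t) - b u\<bar> * indicator {-t..<-t + L} u \<partial>lborel)"
    unfolding gap_def
    by (subst nn_integral_real_affine[of _ 1 t]) (auto intro!: nn_integral_cong simp: indicator_def algebra_simps)
  also have "\<dots> = (\<integral>\<^sup>+u. ennreal \<bar>b (u + t) - b u\<bar> * indicator {0..<L} u \<partial>lborel)"
  proof (rule nn_integral_periodic)
    have "b (u + L + t) = b (u + t)" for u using b_periodic[of "u + t"] by (simp add: algebra_simps)
    then show "ennreal \<bar>b (u + L + t) - b (u + L)\<bar> = ennreal \<bar>b (u + t) - b u\<bar>" for u by (simp add: b_periodic)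
  qed (use L in auto)
  also have "\<dots> = gap t" unfolding gap_def by (simp add: abs_minus_commute)
  finally show ?thesis .
qed

text \<open>For \<open>t \<ge> 0\<close> and \<open>u\<close> in a cell, \<open>b u\<close> and
  \<open>b (u + t)\<close> can differ only if the right end of the cell lies within distance
  \<open>t\<close> of \<open>u\<close>; each interface thus contributes at most
  \<open>t\<close>.\<close>

lemma gap_le: "gap t \<le> ennreal (real N * \<bar>t\<bar>)"
proof -
  have *: "gap t \<le> ennreal (real N * t)" if "t \<ge> 0" for t
  proof -
    have "gap t \<le> (\<Sum>j<N. ennreal t)"
      unfolding gap_cells
    proof (rule sum_mono)
      fix j assume "j \<in> {..<N}"
      then have j: "j < N" by simp
      have "(\<integral>\<^sup>+u. ennreal \<bar>b u - b (u + t)\<bar> * indicator {x j<..<x (Suc j)} u \<partial>lborel)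
          \<le> (\<integral>\<^sup>+u. indicator {x (Suc j) - t..x (Suc j)} u \<partial>lborel)"
      proof (rule nn_integral_mono)
        fix u
        show "ennreal \<bar>b u - b (u + t)\<bar> * indicator {x j<..<x (Suc j)} u \<le> indicator {x (Suc j) - t..x (Suc j)} u"
        proof (cases "x j < u \<and> u + t < x (Suc j)")
          case True
          then have "b u = f j" "b (u + t) = f j" using that j by (auto intro!: cell)
          then show ?thesis by simp
        next
          case False
          then show ?thesis using b01[of u] b01[of "u + t"] by (auto simp: indicator_def)
        qed
      qed
      also have "\<dots> = ennreal t" using that by simp
      finally show "(\<integral>\<^sup>+u. ennreal \<bar>b u - b (u + t)\<bar> * indicator {x j<..<x (Suc j)} u \<partial>lborel) \<le> ennreal t" .
    qed
    also have "\<dots> = ennreal (real N * t)" using that by (simp add: ennreal_of_nat_eq_real_of_nat ennreal_mult)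
    finally show ?thesis .
  qed
  show ?thesis using *[of t] *[of "-t"] gap_minus[of t] by (cases "t \<ge> 0") auto
qed

context
  fixes s :: real
  assumes s: "s > 0"
begin

lemma integrable_tail:
  assumes [measurable]: "h \<in> borel_measurable borel" and h: "\<And>w. \<bar>h w\<bar> \<le> 1"
  shows "integrable lborel (\<lambda>w. indicator {u<..} w * exp (- (s * (w - u))) * h w)"
proof (rule Bochner_Integration.integrable_bound)
  show "integrable lborel (\<lambda>w. indicator {u<..} w * exp (- (s * (w - u))))"
    using has_bochner_integral_exp_greaterThan[OF s] by (auto simp: has_bochner_integral_iff)
  show "AE w in lborel. norm (indicator {u<..} w * exp (- (s * (w - u))) * h w) \<le> norm (indicator {u<..} w * exp (- (s * (w - u))))"
    using h by (intro AE_I2) (auto simp: abs_mult indicator_def mult_left_le)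
qed measurable

lemma tail_complement:
  "(\<integral>w. indicator {u<..} w * exp (- (s * (w - u))) * (1 - b w) \<partial>lborel) = (1 - Z s u) / s"
proof -
  have "(\<integral>w. indicator {u<..} w * exp (- (s * (w - u))) * (1 - b w) \<partial>lborel)
      = (\<integral>w. indicator {u<..} w * exp (- (s * (w - u))) * 1 - indicator {u<..} w * exp (- (s * (w - u))) * b w \<partial>lborel)"
    by (simp add: algebra_simps)
  also have "\<dots> = (\<integral>w. indicator {u<..} w * exp (- (s * (w - u))) * 1 \<partial>lborel)
     - (\<integral>w. indicator {u<..} w * exp (- (s * (w - u))) * b w \<partial>lborel)"
    using b01 by (intro Bochner_Integration.integral_diff integrable_tail) auto
  also have "\<dots> = 1 / s - Z s u / s"
    using has_bochner_integral_exp_greaterThan[OF s, of u] s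
    by (simp add: has_bochner_integral_iff Z_def)
  finally show ?thesis by (simp add: diff_divide_distrib)
qed

lemma Z_bounds: "0 \<le> Z s u" "Z s u \<le> 1"
proof -
  show "0 \<le> Z s u" unfolding Z_def using s b01 by (intro mult_nonneg_nonneg Bochner_Integration.integral_nonneg) auto
  have "0 \<le> (1 - Z s u) / s"
    unfolding tail_complement[symmetric] using b01 by (intro Bochner_Integration.integral_nonneg) auto
  then show "Z s u \<le> 1" using s by (simp add: zero_le_divide_iff)
qed

lemma Z_periodic: "Z s (u + L) = Z s u"
proof -
  have "(\<integral>w. indicator {u + L<..} w * exp (- (s * (w - (u + L)))) * b w \<partial>lborel)
      = (\<integral>w. indicator {u + L<..} (L + 1 * w) * exp (- (s * ((L + 1 * w) - (u + L)))) * b (L + 1 * w) \<partial>lborel)"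
    using lborel_integral_real_affine[of 1 "\<lambda>w. indicator {u + L<..} w * exp (- (s * (w - (u + L)))) * b w" L] by simp
  also have "\<dots> = (\<integral>w. indicator {u<..} w * exp (- (s * (w - u))) * b w \<partial>lborel)"
  proof (rule Bochner_Integration.integral_cong[OF refl])
    fix w :: real
    have "indicator {u + L<..} (L + 1 * w) = (indicator {u<..} w :: real)" "L + 1 * w - (u + L) = w - u"
      by (auto simp: indicator_def)
    moreover have "b (L + 1 * w) = b w" using b_periodic[of w] by (simp add: add.commute)
    ultimately show "indicator {u + L<..} (L + 1 * w) * exp (- (s * ((L + 1 * w) - (u + L)))) * b (L + 1 * w)
        = indicator {u<..} w * exp (- (s * (w - u))) * b w" by (simp only:)
  qed
  finally show ?thesis by (simp add: Z_def)
qed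

text \<open>The difference \<open>d = f j - b\<close> vanishes between \<open>u\<close> and the end
  of the cell, so its exponentially weighted tail from \<open>u\<close> is the tail from that end
  times a decay factor.\<close>

lemma Z_cell:
  assumes j: "j < N" and u: "x j \<le> u" "u \<le> x (Suc j)"
  shows "f j - Z s u = (f j - Z s (x (Suc j))) * exp (- (s * (x (Suc j) - u)))"
proof -
  define v where "v = x (Suc j)"
  have uv: "u \<le> v" using u by (simp add: v_def)
  define d where "d w = f j - b w" for w
  have [measurable]: "d \<in> borel_measurable borel" unfolding d_def by measurable
  have d: "\<bar>d w\<bar> \<le> 1" for w using f01[OF j] by (auto simp: d_def indicator_def)
  have repr: "(\<integral>w. indicator {u<..} w * exp (- (s * (w - u))) * d w \<partial>lborel) = (f j - Z s u) / s" for u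
  proof -
    have "(\<integral>w. indicator {u<..} w * exp (- (s * (w - u))) * d w \<partial>lborel)
      = (\<integral>w. f j * (indicator {u<..} w * exp (- (s * (w - u)))) - indicator {u<..} w * exp (- (s * (w - u))) * b w \<partial>lborel)"
      by (simp add: d_def algebra_simps)
    also have "\<dots> = (\<integral>w. f j * (indicator {u<..} w * exp (- (s * (w - u)))) \<partial>lborel)
        - (\<integral>w. indicator {u<..} w * exp (- (s * (w - u))) * b w \<partial>lborel)"
      using b01 integrable_tail[of "\<lambda>_. 1" u] by (intro Bochner_Integration.integral_diff integrable_tail integrable_mult_right) auto
    also have "\<dots> = f j * (1 / s) - Z s u / s"
      using has_bochner_integral_exp_greaterThan[OF s, of u] s
      by (simp add: has_bochner_integral_iff Z_def)
    finally show ?thesis by (simp add: diff_divide_distrib)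
  qed
  have "(\<integral>w. indicator {u<..} w * exp (- (s * (w - u))) * d w \<partial>lborel)
      = (\<integral>w. exp (- (s * (v - u))) * (indicator {v<..} w * exp (- (s * (w - v))) * d w) \<partial>lborel)"
  proof (rule integral_cong_AE)
    show "AE w in lborel. indicator {u<..} w * exp (- (s * (w - u))) * d w
        = exp (- (s * (v - u))) * (indicator {v<..} w * exp (- (s * (w - v))) * d w)"
      using AE_lborel_singleton[of v]
    proof eventually_elim
      case (elim w)
      have "d w = 0" if "u < w" "w < v" using cell[OF j, of w] that u by (simp add: d_def v_def)
      moreover have "exp (- (s * (w - u))) = exp (- (s * (v - u))) * exp (- (s * (w - v)))"
        by (simp add: exp_add[symmetric] algebra_simps)
      ultimately show ?case using elim uv by (auto simp: indicator_def)
    qed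
  qed auto
  also have "\<dots> = exp (- (s * (v - u))) * ((f j - Z s v) / s)" by (simp add: repr)
  finally show ?thesis using s unfolding repr by (simp add: v_def field_simps)
qed

text \<open>With \<open>E\<close> the decay factor of the cell, the distances of \<open>Z\<close>
  from \<open>f j\<close> at its two ends are \<open>p * E\<close> and \<open>p\<close>; the ratio
  \<open>(1 - E) / (1 + E)\<close> is the hyperbolic tangent.\<close>

lemma Z_step:
  assumes "j < N"
  shows "Z s (x (Suc j)) - Z s (x j)
    = tanh (s * (x (Suc j) - x j) / 2) * (Z s (x j) + Z s (x (Suc j)) - 2 * f j)"
proof -
  define E where "E = exp (- (s * (x (Suc j) - x j)))"
  have E: "E > 0" by (simp add: E_def)
  define p where "p = f j - Z s (x (Suc j))"
  have 1: "f j - Z s (x j) = p * E"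
    using Z_cell[OF assms order_refl] x_less[OF assms] by (simp add: p_def E_def)
  have "tanh (s * (x (Suc j) - x j) / 2) = (1 - E) / (1 + E)"
    unfolding tanh_real_altdef E_def by simp
  moreover have "Z s (x (Suc j)) = f j - p" "Z s (x j) = f j - p * E" using 1 by (simp_all add: p_def)
  moreover have "(f j - p) - (f j - p * E) = (1 - E) / (1 + E) * ((f j - p * E) + (f j - p) - 2 * f j)"
    using E by (simp add: divide_simps) (simp add: algebra_simps)
  ultimately show ?thesis by presburger
qed

lemma Z_N: "Z s (x N) = Z s (x 0)"
  using Z_periodic by (simp add: x_N)

text \<open>The factor \<open>2 * f j - 1\<close> is the sign that resolves the absolute value of
  \<open>f j - b w\<close>. What remains is a tail integral from \<open>u\<close>, transported to
  the end of the cell by \<open>Z_cell\<close>.\<close>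

lemma nn_integral_cell_point:
  assumes j: "j < N" and u: "x j < u" "u < x (Suc j)"
  shows "(\<integral>\<^sup>+t. ennreal (indicator {0<..} t * exp (- (s * t))) * ennreal \<bar>b u - b (u + t)\<bar> \<partial>lborel)
      = ennreal ((2 * f j - 1) * (f j - Z s (x (Suc j))) * exp (- (s * (x (Suc j) - u))) / s)"
proof -
  have "(\<integral>\<^sup>+t. ennreal (indicator {0<..} t * exp (- (s * t))) * ennreal \<bar>b u - b (u + t)\<bar> \<partial>lborel)
      = (\<integral>\<^sup>+w. ennreal (indicator {u<..} w * exp (- (s * (w - u))) * \<bar>f j - b w\<bar>) \<partial>lborel)"
    using cell[OF j u]
    by (subst (2) nn_integral_real_affine[of _ 1 u])
      (auto intro!: nn_integral_cong simp: indicator_def ennreal_mult' cong: if_cong)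
  also have "\<dots> = ennreal (\<integral>w. indicator {u<..} w * exp (- (s * (w - u))) * \<bar>f j - b w\<bar> \<partial>lborel)"
    using f01[OF j] by (intro nn_integral_eq_integral integrable_tail) (auto simp: indicator_def)
  also have "(\<integral>w. indicator {u<..} w * exp (- (s * (w - u))) * \<bar>f j - b w\<bar> \<partial>lborel) = (2 * f j - 1) * (f j - Z s u) / s"
  proof (cases "f j = 1")
    case True
    then have "\<bar>f j - b w\<bar> = 1 - b w" for w using b01[of w] by simp
    then show ?thesis using True tail_complement[of u] by simp
  next
    case False
    then have f: "f j = 0" using f01[OF j] by auto
    then have "\<bar>f j - b w\<bar> = b w" for w using b01[of w] by simp
    then show ?thesis using f s by (simp add: Z_def)
  qed
  also have "f j - Z s u = (f j - Z s (x (Suc j))) * exp (- (s * (x (Suc j) - u)))"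
    using u by (intro Z_cell j) auto
  finally show ?thesis by (simp add: mult.assoc)
qed

lemma sign_cell:
  assumes "j < N"
  shows "0 \<le> (2 * f j - 1) * (f j - Z s u)" "0 \<le> (2 * f j - 1) * (Z s (x j) - Z s (x (Suc j)))"
proof -
  show *: "0 \<le> (2 * f j - 1) * (f j - Z s u)" for u
    using f01[OF assms] Z_bounds[of u] by auto
  define E where "E = exp (- (s * (x (Suc j) - x j)))"
  have "E \<le> 1" using s x_less[OF assms] by (simp add: E_def)
  moreover have "Z s (x j) - Z s (x (Suc j)) = (f j - Z s (x (Suc j))) * (1 - E)"
    using Z_cell[OF assms order_refl] x_less[OF assms] by (simp add: E_def algebra_simps)
  ultimately show "0 \<le> (2 * f j - 1) * (Z s (x j) - Z s (x (Suc j)))"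
    using *[of "x (Suc j)"] by (simp add: mult.assoc[symmetric])
qed

lemma gap_measurable [measurable]: "gap \<in> borel_measurable borel"
  unfolding gap_def[abs_def] by measurable

text \<open>By Tonelli the integral over \<open>t\<close> is taken first, at a fixed point of a
  cell, and the resulting exponential is integrated over the cell. In the sum the coefficient
  \<open>2 * f j - 1\<close> may be replaced by \<open>2 * f j\<close>, because the jumps of
  \<open>Z\<close> telescope to zero over a period.\<close>

lemma laplace_gap:
  "(\<integral>\<^sup>+t. ennreal (indicator {0<..} t * exp (- (s * t))) * gap t \<partial>lborel) = ennreal (2 * jumps s / s\<^sup>2)"
proof -
  let ?g = "\<lambda>j t u. ennreal (indicator {0<..} t * exp (- (s * t))) * ennreal \<bar>b u - b (u + t)\<bar>
      * indicator {x j<..<x (Suc j)} u"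
  have "(\<integral>\<^sup>+t. ennreal (indicator {0<..} t * exp (- (s * t))) * gap t \<partial>lborel)
     = (\<Sum>j<N. \<integral>\<^sup>+t. \<integral>\<^sup>+u. ?g j t u \<partial>lborel \<partial>lborel)"
    unfolding gap_cells sum_distrib_left
    by (subst nn_integral_sum) (auto simp: nn_integral_cmult[symmetric] mult.assoc)
  also have "\<dots> = (\<Sum>j<N. ennreal ((2 * f j - 1) * (Z s (x j) - Z s (x (Suc j))) / s\<^sup>2))"
  proof (rule sum.cong[OF refl])
    fix j assume "j \<in> {..<N}"
    then have j: "j < N" by simp
    let ?v = "x (Suc j)"
    define c where "c = (2 * f j - 1) * (f j - Z s ?v) / s"
    define E where "E = exp (- (s * (?v - x j)))"
    have c: "c \<ge> 0" unfolding c_def using sign_cell(1)[OF j] s by (intro divide_nonneg_pos) auto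
    have "(\<integral>\<^sup>+t. \<integral>\<^sup>+u. ?g j t u \<partial>lborel \<partial>lborel) = (\<integral>\<^sup>+u. \<integral>\<^sup>+t. ?g j t u \<partial>lborel \<partial>lborel)"
      by (rule lborel_pair.Fubini') measurable
    also have "\<dots> = (\<integral>\<^sup>+u. ennreal c * (ennreal (exp (- (s * (?v - u)))) * indicator {x j<..<?v} u) \<partial>lborel)"
    proof (rule nn_integral_cong)
      fix u
      show "(\<integral>\<^sup>+t. ?g j t u \<partial>lborel) = ennreal c * (ennreal (exp (- (s * (?v - u)))) * indicator {x j<..<?v} u)"
      proof (cases "x j < u \<and> u < ?v")
        case True
        then show ?thesis
          using nn_integral_cell_point[OF j, of u] c by (simp add: c_def ennreal_mult'[symmetric])
      next
        case False
        then have "indicator {x j<..<?v} u = (0::ennreal)" by (auto simp: indicator_def)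
        then show ?thesis by simp
      qed
    qed
    also have "\<dots> = ennreal c * ennreal ((1 - E) / s)"
      using nn_integral_exp_cell[OF s, of "x j" ?v] x_less[OF j] by (simp add: nn_integral_cmult E_def)
    also have "\<dots> = ennreal (c * ((1 - E) / s))" by (rule ennreal_mult'[OF c, symmetric])
    also have "c * ((1 - E) / s) = (2 * f j - 1) * ((f j - Z s ?v) - (f j - Z s ?v) * E) / s\<^sup>2"
    proof -
      have "A * D / s * ((1 - E) / s) = A * (D - D * E) / s\<^sup>2" for A D
        using s by (simp add: power2_eq_square field_simps)
      then show ?thesis by (simp only: c_def)
    qed
    also have "(f j - Z s ?v) - (f j - Z s ?v) * E = Z s (x j) - Z s ?v"
      using Z_cell[OF j order_refl] x_less[OF j] by (simp add: E_def)
    finally show "(\<integral>\<^sup>+t. \<integral>\<^sup>+u. ?g j t u \<partial>lborel \<partial>lborel) = ennreal ((2 * f j - 1) * (Z s (x j) - Z s ?v) / s\<^sup>2)" .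
  qed
  also have "\<dots> = ennreal (\<Sum>j<N. (2 * f j - 1) * (Z s (x j) - Z s (x (Suc j))) / s\<^sup>2)"
    using sign_cell(2) by (intro sum_ennreal) auto
  also have "(\<Sum>j<N. (2 * f j - 1) * (Z s (x j) - Z s (x (Suc j))) / s\<^sup>2)
     = (2 * jumps s + (\<Sum>j<N. Z s (x (Suc j)) - Z s (x j))) / s\<^sup>2"
    unfolding jumps_def sum_divide_distrib[symmetric] sum_distrib_left sum.distrib[symmetric]
    by (intro arg_cong2[where f = "(/)"] sum.cong) (auto simp: algebra_simps)
  also have "(\<Sum>j<N. Z s (x (Suc j)) - Z s (x j)) = 0"
    using sum_lessThan_telescope[of "\<lambda>j. Z s (x j)" N] Z_N by simp
  finally show ?thesis by simp
qed

end

end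

lemma nn_integral_exp_abs:
  fixes F :: "real \<Rightarrow> ennreal"
  assumes [measurable]: "F \<in> borel_measurable borel" and even: "\<And>t. F (- t) = F t"
  shows "(\<integral>\<^sup>+t. ennreal (exp (- (s * \<bar>t\<bar>))) * F t \<partial>lborel)
    = 2 * (\<integral>\<^sup>+t. ennreal (indicator {0<..} t * exp (- (s * t))) * F t \<partial>lborel)"
proof -
  let ?I = "\<integral>\<^sup>+t. ennreal (indicator {0<..} t * exp (- (s * t))) * F t \<partial>lborel"
  let ?J = "\<integral>\<^sup>+t. ennreal (indicator {0<..} (- t) * exp (- (s * (- t)))) * F t \<partial>lborel"
  have "(\<integral>\<^sup>+t. ennreal (exp (- (s * \<bar>t\<bar>))) * F t \<partial>lborel)
      = (\<integral>\<^sup>+t. ennreal (indicator {0<..} t * exp (- (s * t))) * F t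
          + ennreal (indicator {0<..} (- t) * exp (- (s * (- t)))) * F t \<partial>lborel)"
    by (rule nn_integral_cong_AE)
      (use AE_lborel_singleton[of "0::real"] in eventually_elim, auto simp: indicator_def)
  also have "\<dots> = ?I + ?J" by (rule nn_integral_add) measurable
  also have "?J = ?I"
    by (subst nn_integral_real_affine[of _ "-1" 0]) (auto simp: even)
  finally show ?thesis by (simp add: mult_2)
qed

section \<open>Comparison with stripes of the same density\<close>

context interfaces
begin

definition volume :: real where "volume = (\<Sum>j<N. f j * (x (Suc j) - x j))"

lemma sum_lengths: "(\<Sum>j<N. x (Suc j) - x j) = L"
  using sum_lessThan_telescope[of x N] x_N by simp

lemma volume_eq: "(\<integral>\<^sup>+u. ennreal (b u) * indicator {0..<L} u \<partial>lborel) = ennreal volume"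
proof -
  have "(\<integral>\<^sup>+u. ennreal (b u) * indicator {0..<L} u \<partial>lborel) = (\<integral>\<^sup>+u. ennreal (b u) * indicator {x 0..<x 0 + L} u \<partial>lborel)"
    by (rule nn_integral_periodic[symmetric]) (auto simp: b_periodic L)
  also have "\<dots> = (\<Sum>j<N. \<integral>\<^sup>+u. ennreal (b u) * indicator {x j<..<x (Suc j)} u \<partial>lborel)"
    unfolding x_N[symmetric] by (rule nn_integral_cells) measurable
  also have "\<dots> = (\<Sum>j<N. ennreal (f j * (x (Suc j) - x j)))"
  proof (rule sum.cong[OF refl])
    fix j assume "j \<in> {..<N}"
    then have j: "j < N" by simp
    have "(\<integral>\<^sup>+u. ennreal (b u) * indicator {x j<..<x (Suc j)} u \<partial>lborel) = (\<integral>\<^sup>+u. ennreal (f j) * indicator {x j<..<x (Suc j)} u \<partial>lborel)"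
      by (intro nn_integral_cong) (auto simp: cell[OF j] split: split_indicator)
    then show "(\<integral>\<^sup>+u. ennreal (b u) * indicator {x j<..<x (Suc j)} u \<partial>lborel) = ennreal (f j * (x (Suc j) - x j))"
      using x_less[OF j] f01[OF j] by (auto simp: nn_integral_cmult_indicator ennreal_mult')
  qed
  also have "\<dots> = ennreal volume"
    unfolding volume_def
  proof (rule sum_ennreal)
    fix j assume "j \<in> {..<N}"
    then show "0 \<le> f j * (x (Suc j) - x j)" using x_less[of j] f01[of j] by auto
  qed
  finally show ?thesis .
qed

text \<open>Full and empty cells enter \<open>sum_jump_le\<close> with separate coefficients, and
  concavity of \<open>tanh\<close> replaces the cell lengths in each class by their mean. The result
  is the kernel of stripes with half-widths \<open>\<alpha> * h\<close> and
  \<open>(1 - \<alpha>) * h\<close>.\<close>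

lemma jumps_le:
  assumes s: "s > 0" and \<alpha>: "0 < \<alpha>" "\<alpha> < 1" and vol: "volume = \<alpha> * L" and h: "h = L / real N"
  shows "real N * stripe_kernel (s * (\<alpha> * h)) (s * ((1 - \<alpha>) * h)) \<le> real N - 2 * jumps s"
proof -
  define T where "T j = tanh (s * (x (Suc j) - x j) / 2)" for j
  define X Y where "X = tanh (s * (\<alpha> * h))" and "Y = tanh (s * ((1 - \<alpha>) * h))"
  have h0: "h > 0" using h L N by simp
  have hN: "h * real N = L" using h N by simp
  have XY: "X > 0" "Y > 0" using s \<alpha> h0 by (auto simp: X_def Y_def)
  have len: "0 \<le> s * (x (Suc j) - x j) / 2" if "j < N" for j using x_less[OF that] s by simp
  \<comment> \<open>The minimiser of \<open>(2 - c)\<^sup>2 * X + c\<^sup>2 * Y\<close>, whose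
    minimum is \<open>4 * X * Y / (X + Y)\<close>.\<close>
  define c where "c = 2 * X / (X + Y)"
  \<comment> \<open>\<open>g\<close> will be the indicator of the full or of the empty cells. There
    are \<open>N / 2\<close> of them, so the last hypothesis says that \<open>m\<close> is the mean
    of the arguments of \<open>tanh\<close>, and the linear terms of the tangent bound
    cancel.\<close>
  have jensen: "(\<Sum>j<N. g j * T j) \<le> tanh m * (real N / 2)"
    if g: "\<And>j. j < N \<Longrightarrow> 0 \<le> g j" and m: "m \<ge> 0" and sum: "(\<Sum>j<N. g j) = real N / 2"
      and len_sum: "(\<Sum>j<N. g j * (x (Suc j) - x j)) * s = m * real N" for g m
  proof -
    let ?D = "1 - (tanh m)\<^sup>2"
    have "(\<Sum>j<N. g j * T j) \<le> (\<Sum>j<N. g j * (tanh m + ?D * (s * (x (Suc j) - x j) / 2 - m)))"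
      unfolding T_def using g m len by (intro sum_mono mult_left_mono tanh_le_tangent) auto
    also have "\<dots> = (\<Sum>j<N. (tanh m - ?D * m) * g j + ?D / 2 * s * (g j * (x (Suc j) - x j)))"
      by (intro sum.cong) (auto simp: field_simps)
    also have "\<dots> = (tanh m - ?D * m) * (real N / 2) + ?D / 2 * s * (\<Sum>j<N. g j * (x (Suc j) - x j))"
      by (simp only: sum.distrib sum_distrib_left[symmetric] sum)
    also have "?D / 2 * s * (\<Sum>j<N. g j * (x (Suc j) - x j)) = ?D / 2 * (m * real N)"
      unfolding len_sum[symmetric] by simp
    also have "(tanh m - ?D * m) * (real N / 2) + ?D / 2 * (m * real N) = tanh m * (real N / 2)"
      by (simp add: field_simps)
    finally show ?thesis .
  qed
  have 1: "(\<Sum>j<N. f j * T j) \<le> X * (real N / 2)"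
    unfolding X_def
  proof (rule jensen[OF _ _ sum_f])
    show "0 \<le> f j" if "j < N" for j using f01[OF that] by auto
    show "(\<Sum>j<N. f j * (x (Suc j) - x j)) * s = s * (\<alpha> * h) * real N"
      unfolding volume_def[symmetric] vol hN[symmetric] by simp
  qed (use s \<alpha> h0 in simp)
  have 2: "(\<Sum>j<N. (1 - f j) * T j) \<le> Y * (real N / 2)"
    unfolding Y_def
  proof (rule jensen)
    show "0 \<le> 1 - f j" if "j < N" for j using f01[OF that] by auto
    show "(\<Sum>j<N. 1 - f j) = real N / 2" using sum_f by (simp add: sum_subtractf)
    have "(\<Sum>j<N. (1 - f j) * (x (Suc j) - x j)) = (\<Sum>j<N. x (Suc j) - x j) - volume"
      by (simp only: left_diff_distrib sum_subtractf mult_1 volume_def)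
    then have "(\<Sum>j<N. (1 - f j) * (x (Suc j) - x j)) = L - volume" by (simp only: sum_lengths)
    moreover have "(h * real N - \<alpha> * (h * real N)) * s = s * ((1 - \<alpha>) * h) * real N"
      by (simp add: algebra_simps)
    ultimately show "(\<Sum>j<N. (1 - f j) * (x (Suc j) - x j)) * s = s * ((1 - \<alpha>) * h) * real N"
      by (simp only: vol hN[symmetric])
  qed (use s \<alpha> h0 in simp)
  have "2 * jumps s \<le> (\<Sum>j<N. T j * (2 * f j - c)\<^sup>2)"
    unfolding jumps_def
  proof (rule sum_jump_le)
    show "0 \<le> T j" if "j < N" for j using len[OF that] by (simp add: T_def)
    show "Z s (x (Suc j)) - Z s (x j) = T j * (Z s (x j) + Z s (x (Suc j)) - 2 * f j)" if "j < N" for j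
      unfolding T_def by (rule Z_step[OF s that])
    show "Z s (x N) = Z s (x 0)" by (rule Z_N[OF s])
  qed
  also have "\<dots> = (\<Sum>j<N. (2 - c)\<^sup>2 * (f j * T j) + c\<^sup>2 * ((1 - f j) * T j))"
  proof (rule sum.cong[OF refl])
    fix j assume "j \<in> {..<N}"
    then show "T j * (2 * f j - c)\<^sup>2 = (2 - c)\<^sup>2 * (f j * T j) + c\<^sup>2 * ((1 - f j) * T j)"
      using f01[of j] by (auto simp: mult.commute)
  qed
  also have "\<dots> = (2 - c)\<^sup>2 * (\<Sum>j<N. f j * T j) + c\<^sup>2 * (\<Sum>j<N. (1 - f j) * T j)"
    by (simp only: sum.distrib sum_distrib_left[symmetric])
  also have "\<dots> \<le> (2 - c)\<^sup>2 * (X * (real N / 2)) + c\<^sup>2 * (Y * (real N / 2))"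
    using 1 2 by (intro add_mono mult_left_mono) auto
  also have "\<dots> = real N * (2 * (X * Y / (X + Y)))"
  proof -
    have n: "X + Y \<noteq> 0" using XY by simp
    have "2 - c = 2 * Y / (X + Y)" using n by (simp add: c_def field_simps)
    then have "(2 - c)\<^sup>2 * X + c\<^sup>2 * Y = 4 * X * Y * (X + Y) / (X + Y)\<^sup>2"
      by (simp add: c_def power_divide power_mult_distrib add_divide_distrib[symmetric])
        (simp add: power2_eq_square algebra_simps)
    also have "\<dots> = 4 * X * Y / (X + Y)" using n by (simp add: power2_eq_square)
    finally have "(2 - c)\<^sup>2 * X + c\<^sup>2 * Y = 4 * X * Y / (X + Y)" .
    then have "((2 - c)\<^sup>2 * X + c\<^sup>2 * Y) * (real N / 2) = 4 * X * Y / (X + Y) * (real N / 2)" by simp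
    then show ?thesis by (simp add: algebra_simps)
  qed
  finally have "2 * jumps s \<le> real N * (2 * (X * Y / (X + Y)))" .
  then show ?thesis
    unfolding stripe_kernel_def X_def[symmetric] Y_def[symmetric] right_diff_distrib[of "real N" 1] by simp
qed

text \<open>This decay provides integrability against the Laplace weight. With \<open>m\<close> the
  shortest cell, \<open>Z\<close> is exponentially close to 1 at the left end of a full cell and to
  0 at its right end, where an empty cell begins.\<close>

lemma jumps_ge:
  obtains m where "m > 0" "\<And>s. s > 0 \<Longrightarrow> real N - 2 * jumps s \<le> 2 * real N * exp (- (s * m))"
proof -
  define m where "m = Min ((\<lambda>j. x (Suc j) - x j) ` {..<N})"
  have ne: "finite ((\<lambda>j. x (Suc j) - x j) ` {..<N})" "(\<lambda>j. x (Suc j) - x j) ` {..<N} \<noteq> {}" using N by auto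
  have m: "m > 0" unfolding m_def using ne x_less by (subst Min_gr_iff) auto
  have mle: "m \<le> x (Suc j) - x j" if "j < N" for j unfolding m_def using ne that by (intro Min_le) auto
  have "real N - 2 * jumps s \<le> 2 * real N * exp (- (s * m))" if s: "s > 0" for s
  proof -
    define E where "E = exp (- (s * m))"
    have Zc: "f j - Z s (x j) = (f j - Z s (x (Suc j))) * exp (- (s * (x (Suc j) - x j)))"
      "exp (- (s * (x (Suc j) - x j))) \<le> E" if "j < N" for j
      using Z_cell[OF s that order_refl] x_less[OF that] mle[OF that] s by (auto simp: E_def)
    have one: "1 - E \<le> Z s (x j)" if "j < N" "f j = 1" for j
    proof -
      have "(1 - Z s (x (Suc j))) * exp (- (s * (x (Suc j) - x j))) \<le> 1 * E"
        using Z_bounds[OF s] Zc[OF that(1)] by (intro mult_mono) auto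
      then show ?thesis using Zc(1)[OF that(1)] that(2) by simp
    qed
    have zero: "Z s (x j) \<le> E" if "j \<le> N" "f j = 0" for j
    proof -
      have *: "Z s (x j) \<le> E" if j: "j < N" "f j = 0" for j
      proof -
        have "Z s (x (Suc j)) * exp (- (s * (x (Suc j) - x j))) \<le> 1 * E"
          using Z_bounds[OF s] Zc[OF j(1)] by (intro mult_mono) auto
        then show ?thesis using Zc(1)[OF j(1)] j(2) by simp
      qed
      show ?thesis using *[of j] *[of 0] that N f_N Z_N[OF s] by (cases "j = N") auto
    qed
    have "(\<Sum>j<N. f j * (1 - 2 * E)) \<le> jumps s"
      unfolding jumps_def
    proof (rule sum_mono)
      fix j assume "j \<in> {..<N}"
      then have j: "j < N" by simp
      show "f j * (1 - 2 * E) \<le> f j * (Z s (x j) - Z s (x (Suc j)))"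
      proof (cases "f j = 1")
        case True
        then have "f (Suc j) = 0" using f_Suc[OF j] by simp
        then show ?thesis using True one[OF j] zero[of "Suc j"] j by simp
      qed (use f01[OF j] in auto)
    qed
    then have "(1 - 2 * E) * (real N / 2) \<le> jumps s"
      by (simp add: sum_distrib_right[symmetric] sum_f mult.commute)
    then show ?thesis by (simp add: E_def algebra_simps)
  qed
  with m show ?thesis using that by blast
qed

text \<open>The two step equations determine \<open>Z\<close>. The sum
  \<open>p + q = 2 * a / (a + b)\<close> is the constant \<open>c\<close> of
  \<open>jumps_le\<close>, so the discarded quadratic form vanishes and stripes attain the
  bound.\<close>

lemma jumps_two:
  assumes "N = 2" "f 0 = 1" "s > 0"
  shows "real N - 2 * jumps s
    = real N * stripe_kernel (s * ((x 1 - x 0) / 2)) (s * ((x 2 - x 1) / 2))"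
proof -
  define a b where "a = tanh (s * ((x 1 - x 0) / 2))" and "b = tanh (s * ((x 2 - x 1) / 2))"
  have "a > 0" "b > 0" using x_less[of 0] x_less[of 1] assms by (auto simp: a_def b_def numeral_2_eq_2)
  then have n: "a + b \<noteq> 0" by simp
  define p q where "p = Z s (x 0)" and "q = Z s (x 1)"
  have f1: "f 1 = 0" using f_Suc[of 0] assms by simp
  have 1: "q - p = a * (p + q - 2)"
    using Z_step[OF assms(3), of 0] assms by (simp add: a_def p_def q_def)
  have 2: "p - q = b * (q + p)"
    using Z_step[OF assms(3), of 1] Z_N[OF assms(3)] assms f1 by (simp add: b_def p_def q_def numeral_2_eq_2)
  have "(p + q) * (a + b) = 2 * a" using 1 2 by (simp add: algebra_simps)
  then have "p + q = 2 * a / (a + b)" using n by (simp add: field_simps)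
  then have "p - q = 2 * (a * b / (a + b))" using 2 by (simp add: add.commute)
  moreover have "jumps s = p - q"
  proof -
    have "{..<N} = {0, 1}" using assms(1) by auto
    then show ?thesis unfolding jumps_def using f1 assms(2) by (simp add: p_def q_def)
  qed
  ultimately show ?thesis using assms(1) by (simp add: stripe_kernel_def a_def b_def)
qed

text \<open>The bracket of the functional per unit cross-section. By \<open>gap_le\<close> it is
  nonnegative, which allows Tonelli's theorem even when its two parts are not separately integrable
  against the kernel.\<close>

definition excess :: "real \<Rightarrow> real" where "excess t = real N * \<bar>t\<bar> - enn2real (gap t)"

lemma gap_finite: "ennreal (enn2real (gap t)) = gap t"
  using le_less_trans[OF gap_le ennreal_less_top, of t] by simp

lemma excess_measurable [measurable]: "excess \<in> borel_measurable borel"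
proof -
  have [measurable]: "gap \<in> borel_measurable borel" by (rule gap_measurable[of 1]) simp
  show ?thesis unfolding excess_def[abs_def] by measurable
qed

lemma excess_nonneg: "0 \<le> excess t"
  using enn2real_mono[OF gap_le ennreal_less_top, of t] by (simp add: excess_def)

lemma excess_minus: "excess (- t) = excess t"
  by (simp add: excess_def gap_minus)

text \<open>The transform of \<open>gap\<close> is added to that of \<open>excess\<close>, giving
  the transform of \<open>real N * t\<close>; since all terms are finite it can then be subtracted
  again in \<open>ennreal\<close>.\<close>

lemma laplace_excess_pos:
  assumes s: "s > 0"
  shows "(\<integral>\<^sup>+t. ennreal (indicator {0<..} t * exp (- (s * t))) * ennreal (excess t) \<partial>lborel)
    = ennreal ((real N - 2 * jumps s) / s\<^sup>2)" (is "?I = _")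
proof -
  have [measurable]: "gap \<in> borel_measurable borel" by (rule gap_measurable[OF s])
  have "?I + (\<integral>\<^sup>+t. ennreal (indicator {0<..} t * exp (- (s * t))) * gap t \<partial>lborel)
      = (\<integral>\<^sup>+t. ennreal (indicator {0<..} t * exp (- (s * t))) * ennreal (excess t)
          + ennreal (indicator {0<..} t * exp (- (s * t))) * gap t \<partial>lborel)"
    by (rule nn_integral_add[symmetric]) measurable
  also have "\<dots> = (\<integral>\<^sup>+t. ennreal (real N) * ennreal (indicator {0<..} t * exp (- (s * t)) * t) \<partial>lborel)"
  proof (rule nn_integral_cong)
    fix t :: real
    have "ennreal (excess t) + ennreal (enn2real (gap t)) = ennreal (real N * \<bar>t\<bar>)"
      using excess_nonneg[of t] by (subst ennreal_plus[symmetric]) (auto simp: excess_def)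
    then have "ennreal (excess t) + gap t = ennreal (real N * \<bar>t\<bar>)"
      by (simp only: gap_finite)
    then have "ennreal (indicator {0<..} t * exp (- (s * t))) * ennreal (excess t)
          + ennreal (indicator {0<..} t * exp (- (s * t))) * gap t
        = ennreal (indicator {0<..} t * exp (- (s * t))) * ennreal (real N * \<bar>t\<bar>)"
      by (simp add: distrib_left[symmetric])
    also have "\<dots> = ennreal (real N) * ennreal (indicator {0<..} t * exp (- (s * t)) * t)"
      by (auto simp: indicator_def ennreal_mult'[symmetric] mult_ac)
    finally show "ennreal (indicator {0<..} t * exp (- (s * t))) * ennreal (excess t)
          + ennreal (indicator {0<..} t * exp (- (s * t))) * gap t
        = ennreal (real N) * ennreal (indicator {0<..} t * exp (- (s * t)) * t)" .
  qed
  also have "\<dots> = ennreal (real N / s\<^sup>2)"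
    using nn_integral_exp_linear[OF s] by (subst nn_integral_cmult) (auto simp: ennreal_mult'[symmetric])
  finally have sum: "?I + ennreal (2 * jumps s / s\<^sup>2) = ennreal (real N / s\<^sup>2)"
    unfolding laplace_gap[OF s] .
  have "0 \<le> jumps s"
    unfolding jumps_def
  proof (rule sum_nonneg)
    fix j assume "j \<in> {..<N}"
    then show "0 \<le> f j * (Z s (x j) - Z s (x (Suc j)))"
      using sign_cell(2)[OF s, of j] f01[of j] by auto
  qed
  then have "?I = ennreal (real N / s\<^sup>2) - ennreal (2 * jumps s / s\<^sup>2)"
    unfolding sum[symmetric] by simp
  also have "\<dots> = ennreal ((real N - 2 * jumps s) / s\<^sup>2)"
    using \<open>0 \<le> jumps s\<close> by (subst ennreal_minus) (auto simp: diff_divide_distrib)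
  finally show ?thesis .
qed

lemma laplace_excess:
  assumes s: "s > 0"
  shows "(\<integral>\<^sup>+t. ennreal (exp (- (s * \<bar>t\<bar>))) * ennreal (excess t) \<partial>lborel)
    = ennreal (2 * ((real N - 2 * jumps s) / s\<^sup>2))"
proof -
  have "(\<integral>\<^sup>+t. ennreal (exp (- (s * \<bar>t\<bar>))) * ennreal (excess t) \<partial>lborel)
      = 2 * ennreal ((real N - 2 * jumps s) / s\<^sup>2)"
    unfolding laplace_excess_pos[OF s, symmetric]
    by (rule nn_integral_exp_abs) (auto simp: excess_minus)
  also have "\<dots> = ennreal 2 * ennreal ((real N - 2 * jumps s) / s\<^sup>2)" by simp
  also have "\<dots> = ennreal (2 * ((real N - 2 * jumps s) / s\<^sup>2))"
    by (rule ennreal_mult'[symmetric]) simp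
  finally show ?thesis .
qed

end

section \<open>Reduction of the functional to one dimension\<close>

lemma nn_integral_vec_prod:
  fixes F :: "'n::finite \<Rightarrow> real \<Rightarrow> ennreal"
  assumes [measurable]: "\<And>i. F i \<in> borel_measurable borel"
  shows "(\<integral>\<^sup>+z. (\<Prod>i\<in>UNIV. F i ((z :: real^'n) $ i)) \<partial>lborel) = (\<Prod>i\<in>UNIV. \<integral>\<^sup>+t. F i t \<partial>lborel)"
proof -
  define G where "G b = F (inv (\<lambda>i. axis i (1::real)) b)" for b :: "real^'n"
  have inj: "inj (\<lambda>i::'n. axis i (1::real))" by (auto simp: inj_def axis_eq_axis)
  have Basis: "(Basis :: (real^'n) set) = range (\<lambda>i. axis i 1)" by (auto simp: Basis_vec_def)
  have G: "G (axis i 1) = F i" for i by (simp add: G_def inv_f_f[OF inj])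
  have prod: "(\<Prod>b\<in>Basis. H b) = (\<Prod>i\<in>UNIV. H (axis i 1))" for H :: "real^'n \<Rightarrow> ennreal"
    unfolding Basis by (subst prod.reindex[OF inj]) simp
  have "(\<integral>\<^sup>+z. (\<Prod>b\<in>Basis. G b (z \<bullet> b)) \<partial>lborel) = (\<Prod>b\<in>Basis. \<integral>\<^sup>+t. G b t \<partial>lborel)"
    by (rule nn_integral_lborel_prod) (auto simp: G_def)
  then show ?thesis by (simp add: prod G inner_axis)
qed

lemma prod_UNIV_single:
  fixes a c :: "'b::comm_monoid_mult" and k :: "'n::finite"
  shows "(\<Prod>i\<in>UNIV. if i = k then a else c) = a * c ^ (CARD('n) - 1)"
  by (subst prod.remove[of _ k]) (auto simp: card_Diff_singleton)

lemma AE_vec_nth: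
  fixes k :: "'n::finite"
  assumes "negligible {t. \<not> P t}"
  shows "AE z in lebesgue. P ((z :: real^'n) $ k)"
proof -
  have "AE t in lborel. P t"
    using assms AE_I'[of "{t. \<not> P t}" lebesgue P]
    by (simp add: negligible_iff_null_sets AE_completion_iff)
  then obtain S where S: "S \<in> null_sets lborel" "{t. \<not> P t} \<subseteq> S"
    unfolding eventually_ae_filter by auto
  have [measurable]: "S \<in> sets borel" using S by auto
  have "emeasure lborel {z :: real^'n. z $ k \<in> S} = (\<integral>\<^sup>+z. indicator S ((z :: real^'n) $ k) \<partial>lborel)"
  proof -
    have "(\<lambda>z :: real^'n. indicator S (z $ k)) = (indicator {z. z $ k \<in> S} :: _ \<Rightarrow> ennreal)"
      by (auto simp: fun_eq_iff indicator_def)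
    then show ?thesis by simp
  qed
  also have "\<dots> = (\<integral>\<^sup>+z. (\<Prod>i\<in>UNIV. (if i = k then indicator S else (\<lambda>_. 1)) ((z :: real^'n) $ i)) \<partial>lborel)"
  proof (rule nn_integral_cong)
    fix z :: "real^'n"
    have "(\<Prod>i\<in>UNIV. (if i = k then indicator S else (\<lambda>_. 1)) (z $ i)) = (\<Prod>i\<in>UNIV. if i = k then indicator S (z $ k) else (1::ennreal))"
      by (intro prod.cong) auto
    then show "indicator S (z $ k) = (\<Prod>i\<in>UNIV. (if i = k then indicator S else (\<lambda>_. 1::ennreal)) (z $ i))"
      by (simp add: prod_UNIV_single)
  qed
  also have "\<dots> = (\<Prod>i\<in>UNIV. \<integral>\<^sup>+t. (if i = k then indicator S else (\<lambda>_. 1)) t \<partial>lborel)"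
    by (rule nn_integral_vec_prod) auto
  \<comment> \<open>The factor of coordinate \<open>k\<close> is zero; the other factors are
    infinite, but zero times infinity is zero in \<open>ennreal\<close>.\<close>
  also have "\<dots> = 0" using S(1) by (intro prod_zero bexI[of _ k]) auto
  finally have "{z :: real^'n. z $ k \<in> S} \<in> null_sets lborel" by auto
  then have "AE z in lborel. P ((z :: real^'n) $ k)"
    by (rule AE_I') (use S(2) in auto)
  then show ?thesis by (rule AE_completion)
qed

context interfaces
begin

text \<open>Apart from the cube, the integrand depends on coordinate \<open>k\<close> alone, so
  every other coordinate contributes a factor \<open>L\<close>. Outside a null set \<open>A\<close>
  may be replaced by \<open>B\<close> both at the point and at its translate.\<close>

lemma inner_integral:
  fixes k :: "'n::finite" and A :: "real set"
  assumes neg: "negligible {t. \<not> (t \<in> A \<longleftrightarrow> t \<in> B)}"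
  shows "(LINT z:QL L|lebesgue. \<bar>indicator (cyl k A) z - indicator (cyl k A) (z + \<zeta>)\<bar>)
     = L ^ (CARD('n) - 1) * enn2real (gap (\<zeta> $ k))"
proof -
  define F :: "real^'n \<Rightarrow> real" where
    "F z = (\<Prod>i\<in>UNIV. indicator {0..<L} (z $ i)) * \<bar>b (z $ k) - b (z $ k + \<zeta> $ k)\<bar>" for z
  define c where "c = \<zeta> $ k"
  have [measurable]: "F \<in> borel_measurable borel" unfolding F_def by measurable
  have QL: "indicator (QL L) z = (\<Prod>i\<in>UNIV. indicator {0..<L} (z $ i) :: real)" for z :: "real^'n"
    by (auto simp: QL_def indicator_def prod_zero_iff)
  have "{t. \<not> (t + c \<in> A \<longleftrightarrow> t + c \<in> B)} = (+) (- c) ` {t. \<not> (t \<in> A \<longleftrightarrow> t \<in> B)}"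
    by (force simp: image_iff)
  then have neg': "negligible {t. \<not> (t + c \<in> A \<longleftrightarrow> t + c \<in> B)}"
    using negligible_translation[OF neg, of "- c"] by simp
  have ae: "AE z in lebesgue. F z = indicator (QL L) z *\<^sub>R \<bar>indicator (cyl k A) z - indicator (cyl k A) (z + \<zeta>)\<bar>"
    using AE_vec_nth[OF neg, of k] AE_vec_nth[OF neg', of k]
  proof eventually_elim
    case (elim z)
    have "(indicator (cyl k A) z :: real) = b (z $ k)"
      "(indicator (cyl k A) (z + \<zeta>) :: real) = b (z $ k + \<zeta> $ k)"
      using elim by (auto simp: cyl_def indicator_def c_def)
    then show ?case by (simp add: F_def QL)
  qed
  have "F \<in> borel_measurable lebesgue" by (simp add: measurable_completion)
  then have "(LINT z:QL L|lebesgue. \<bar>indicator (cyl k A) z - indicator (cyl k A) (z + \<zeta>)\<bar>) = (\<integral>z. F z \<partial>lebesgue)"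
    unfolding set_lebesgue_integral_def using ae
    by (intro integral_cong_AE borel_measurable_AE[OF _ ae]) auto
  also have "\<dots> = (\<integral>z. F z \<partial>lborel)" by (rule integral_completion) simp
  also have "\<dots> = enn2real (\<integral>\<^sup>+z. ennreal (F z) \<partial>lborel)"
    by (rule integral_eq_nn_integral) (auto simp: F_def intro!: mult_nonneg_nonneg prod_nonneg)
  also have "(\<integral>\<^sup>+z. ennreal (F z) \<partial>lborel)
     = (\<integral>\<^sup>+z. (\<Prod>i\<in>UNIV. (if i = k then (\<lambda>u. ennreal \<bar>b u - b (u + c)\<bar> * indicator {0..<L} u) else indicator {0..<L}) ((z::real^'n) $ i)) \<partial>lborel)"
  proof (rule nn_integral_cong)
    fix z :: "real^'n"
    have "(\<Prod>i\<in>UNIV. (if i = k then (\<lambda>u. ennreal \<bar>b u - b (u + c)\<bar> * indicator {0..<L} u) else indicator {0..<L}) (z $ i))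
      = (\<Prod>i\<in>UNIV. indicator {0..<L} (z $ i) * (if i = k then ennreal \<bar>b (z $ k) - b (z $ k + c)\<bar> else 1))"
      by (intro prod.cong) (auto simp: mult.commute)
    also have "\<dots> = (\<Prod>i\<in>UNIV. ennreal (indicator {0..<L} (z $ i))) * ennreal \<bar>b (z $ k) - b (z $ k + c)\<bar>"
      by (simp add: prod.distrib prod_UNIV_single ennreal_indicator)
    also have "\<dots> = ennreal (F z)"
      unfolding F_def c_def by (subst prod_ennreal) (auto simp: ennreal_mult' prod_nonneg)
    finally show "ennreal (F z) = (\<Prod>i\<in>UNIV. (if i = k then (\<lambda>u. ennreal \<bar>b u - b (u + c)\<bar> * indicator {0..<L} u) else indicator {0..<L}) (z $ i))"
      by simp
  qed
  also have "\<dots> = (\<Prod>i\<in>(UNIV :: 'n set). \<integral>\<^sup>+u. (if i = k then (\<lambda>u. ennreal \<bar>b u - b (u + c)\<bar> * indicator {0..<L} u) else indicator {0..<L}) u \<partial>lborel)"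
    by (rule nn_integral_vec_prod) auto
  also have "\<dots> = (\<Prod>i\<in>(UNIV :: 'n set). if i = k then gap c else ennreal L)"
    using L by (intro prod.cong) (auto simp: gap_def)
  also have "\<dots> = gap c * ennreal (L ^ (CARD('n) - 1))"
    using L by (simp add: prod_UNIV_single ennreal_power)
  finally show ?thesis using L by (simp add: enn2real_mult c_def mult.commute)
qed

lemma jumps_le_half: "s > 0 \<Longrightarrow> 2 * jumps s \<le> real N"
proof -
  assume s: "s > 0"
  have "jumps s \<le> (\<Sum>j<N. f j * 1)"
    unfolding jumps_def
  proof (intro sum_mono mult_left_mono)
    fix j assume "j \<in> {..<N}"
    then show "0 \<le> f j" using f01[of j] by auto
    show "Z s (x j) - Z s (x (Suc j)) \<le> 1"
      using Z_bounds[OF s, of "x j"] Z_bounds[OF s, of "x (Suc j)"] by linarith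
  qed
  then show ?thesis by (simp add: sum_f)
qed

lemma jumps_measurable [measurable]: "jumps \<in> borel_measurable borel"
  unfolding jumps_def[abs_def] Z_def by measurable

end

lemma (in laplace) integrable_jumps:
  assumes "interfaces B L N x f"
  shows "integrable M (\<lambda>s. real N - 2 * interfaces.jumps B N x f s)"
proof -
  interpret interfaces B L N x f by fact
  obtain m where m: "m > 0" "\<And>s. s > 0 \<Longrightarrow> real N - 2 * jumps s \<le> 2 * real N * exp (- (s * m))"
    using jumps_ge by blast
  show ?thesis
  proof (rule Bochner_Integration.integrable_bound)
    show "integrable M (\<lambda>s. 2 * real N * exp (- (m * s)))"
      using integral_exp_laplace_weight(2)[OF m(1)] by (rule integrable_mult_right)
    show "AE s in M. norm (real N - 2 * jumps s) \<le> norm (2 * real N * exp (- (m * s)))"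
      using AE_laplace_weight
    proof eventually_elim
      case (elim s)
      then show ?case using m(2)[of s] jumps_le_half[of s] by (simp add: mult.commute[of m])
    qed
  qed measurable
qed

lemma borel_measurable_vec_nth_compose [measurable (raw)]:
  fixes g :: "'a \<Rightarrow> real^'n"
  assumes "g \<in> borel_measurable M"
  shows "(\<lambda>z. g z $ k) \<in> borel_measurable M"
  using measurable_compose[OF assms borel_measurable_nth] .

lemma borel_measurable_ell1 [measurable]: "ell1 \<in> borel_measurable borel"
  unfolding ell1_def[abs_def] by measurable

context interfaces
begin

text \<open>The exponential of the 1-norm is a product over the coordinates: each coordinate other
  than \<open>k\<close> contributes \<open>2 / s\<close>, and coordinate \<open>k\<close> carries
  the one-dimensional transform of \<open>excess\<close>.\<close>

lemma laplace_vec: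
  fixes k :: "'n::finite"
  assumes s: "s > 0"
  shows "(\<integral>\<^sup>+\<zeta>. ennreal (exp (- (s * ell1 \<zeta>))) * ennreal (excess ((\<zeta> :: real^'n) $ k)) \<partial>lborel)
    = ennreal ((2 / s) ^ (CARD('n) - 1) * (2 * ((real N - 2 * jumps s) / s\<^sup>2)))"
proof -
  define E where "E t = ennreal (exp (- (s * \<bar>t\<bar>)))" for t :: real
  define F where "F i t = E t * (if i = k then ennreal (excess t) else 1)" for i t
  have [measurable]: "E \<in> borel_measurable borel" unfolding E_def by measurable
  have [measurable]: "F i \<in> borel_measurable borel" for i unfolding F_def by measurable
  have "(\<integral>\<^sup>+\<zeta>. ennreal (exp (- (s * ell1 \<zeta>))) * ennreal (excess ((\<zeta> :: real^'n) $ k)) \<partial>lborel)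
    = (\<integral>\<^sup>+\<zeta>. (\<Prod>i\<in>UNIV. F i ((\<zeta> :: real^'n) $ i)) \<partial>lborel)"
  proof (rule nn_integral_cong)
    fix \<zeta> :: "real^'n"
    have "(\<Prod>i\<in>UNIV. F i (\<zeta> $ i)) = (\<Prod>i\<in>UNIV. E (\<zeta> $ i)) * (\<Prod>i\<in>UNIV. if i = k then ennreal (excess (\<zeta> $ k)) else 1)"
      unfolding F_def prod.distrib by (intro arg_cong2[where f = "(*)"] prod.cong) auto
    also have "(\<Prod>i\<in>UNIV. E (\<zeta> $ i)) = ennreal (exp (- (s * ell1 \<zeta>)))"
      unfolding E_def ell1_def sum_distrib_left sum_negf[symmetric]
      by (subst prod_ennreal) (auto simp: exp_sum)
    finally show "ennreal (exp (- (s * ell1 \<zeta>))) * ennreal (excess (\<zeta> $ k)) = (\<Prod>i\<in>UNIV. F i (\<zeta> $ i))"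
      by (simp add: prod_UNIV_single)
  qed
  also have "\<dots> = (\<Prod>i\<in>UNIV. \<integral>\<^sup>+t. F i t \<partial>lborel)"
    by (rule nn_integral_vec_prod) measurable
  also have "\<dots> = (\<Prod>i\<in>UNIV. if i = k then ennreal (2 * ((real N - 2 * jumps s) / s\<^sup>2)) else ennreal (2 / s))"
  proof (intro prod.cong refl)
    fix i :: 'n
    have "(\<integral>\<^sup>+t. E t \<partial>lborel) = 2 * ennreal (1 / s)"
    proof -
      have "(\<integral>\<^sup>+t. ennreal (indicator {0<..} t * exp (- (s * t))) \<partial>lborel)
          = (\<integral>\<^sup>+t. ennreal (indicator {0<..} t * (t powr 0 * exp (- (s * t)))) \<partial>lborel)"
        by (intro nn_integral_cong) (auto simp: indicator_def)
      also have "\<dots> = ennreal (1 / s)" using nn_integral_powr_exp[of s 0] s by simp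
      finally show ?thesis using nn_integral_exp_abs[of "\<lambda>_. 1" s] by (simp add: E_def)
    qed
    also have "\<dots> = ennreal (2 / s)" using s by (simp add: ennreal_mult'[symmetric] flip: ennreal_numeral)
    finally have "(\<integral>\<^sup>+t. E t \<partial>lborel) = ennreal (2 / s)" .
    then show "(\<integral>\<^sup>+t. F i t \<partial>lborel) = (if i = k then ennreal (2 * ((real N - 2 * jumps s) / s\<^sup>2)) else ennreal (2 / s))"
      using laplace_excess[OF s] by (simp add: F_def E_def)
  qed
  also have "\<dots> = ennreal (2 * ((real N - 2 * jumps s) / s\<^sup>2)) * ennreal ((2 / s) ^ (CARD('n) - 1))"
    using s by (simp add: prod_UNIV_single ennreal_power)
  also have "\<dots> = ennreal ((2 / s) ^ (CARD('n) - 1) * (2 * ((real N - 2 * jumps s) / s\<^sup>2)))"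
    using s by (subst mult.commute) (intro ennreal_mult'[symmetric], simp)
  finally show ?thesis .
qed

text \<open>The weight collects \<open>s powr (p - 1) / Gamma p\<close> from the Laplace
  representation of the kernel, \<open>(2 / s) ^ (d - 1)\<close> from the transversal coordinates
  and \<open>2 / s\<^sup>2\<close> from coordinate \<open>k\<close>: the product is
  \<open>2 ^ d / Gamma p * s powr (p - d - 2)\<close>.\<close>

lemma Fcyl_eq:
  fixes k :: "'n::finite" and A :: "real set" and p \<tau> :: real
  defines "d \<equiv> CARD('n)"
  defines "w \<equiv> laplace_weight (2 ^ d / Gamma p) (p - real d - 2) (\<tau> powr (1 / (p - real d - 1)))"
  assumes p: "p \<ge> real d + 2" and \<tau>: "\<tau> \<ge> 0"
    and neg: "negligible {t. \<not> (t \<in> A \<longleftrightarrow> t \<in> B)}" and bdry: "card (bdry1 A \<inter> {0..<L}) = N"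
  shows "Fcyl p \<tau> L k A = (- real N + (\<integral>s. real N - 2 * jumps s \<partial>w)) / L"
proof -
  define e where "e = \<tau> powr (1 / (p - real d - 1))"
  define K where "K = 2 ^ d / Gamma p"
  define r where "r = p - real d - 2"
  let ?E = "\<lambda>s (\<zeta> :: real^'n). ennreal (exp (- (s * ell1 \<zeta>))) * ennreal (excess (\<zeta> $ k))"
  have e: "e \<ge> 0" by (simp add: e_def)
  have p0: "p > 0" using p by simp
  have G: "Gamma p > 0" using p0 by (rule Gamma_real_pos)
  have d: "d > 0" by (simp add: d_def)
  interpret laplace K r e using G p e by unfold_locales (auto simp: K_def r_def)
  let ?J = "\<integral>s. real N - 2 * jumps s \<partial>M"
  have w: "w = M" by (simp add: w_def K_def r_def e_def)
  have ae: "AE s in M. 0 \<le> real N - 2 * jumps s"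
    using AE_laplace_weight by eventually_elim (use jumps_le_half in auto)
  define C where "C = L ^ (d - 1)"
  have C: "C > 0" using L by (simp add: C_def)
  have Kt: "Kt p \<tau> \<zeta> = (ell1 \<zeta> + e) powr - p" for \<zeta> :: "real^'n"
    by (simp add: Kt_def e_def d_def)
  have [measurable]: "(\<lambda>\<zeta>::real^'n. Kt p \<tau> \<zeta>) \<in> borel_measurable borel" unfolding Kt by measurable
  define W where "W s = ennreal (indicator {0<..} s * (s powr (p - 1) * exp (- (e * s))) / Gamma p)" for s
  have [measurable]: "W \<in> borel_measurable borel" unfolding W_def by measurable
  have "(\<integral>\<^sup>+\<zeta>. ennreal (Kt p \<tau> \<zeta> * excess ((\<zeta> :: real^'n) $ k)) \<partial>lborel)
      = (\<integral>\<^sup>+\<zeta>. (\<integral>\<^sup>+s. W s * ?E s \<zeta> \<partial>lborel) \<partial>lborel)"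
  proof (rule nn_integral_cong_AE)
    show "AE \<zeta> in lborel. ennreal (Kt p \<tau> \<zeta> * excess ((\<zeta> :: real^'n) $ k))
      = (\<integral>\<^sup>+s. W s * ?E s \<zeta> \<partial>lborel)"
      \<comment> \<open>The origin is excluded because for \<tau> = 0 the base
        \<open>ell1 \<zeta> + e\<close> vanishes there.\<close>
      using AE_lborel_singleton[of "0 :: real^'n"]
    proof eventually_elim
      case (elim \<zeta>)
      obtain i where "\<zeta> $ i \<noteq> 0" using elim by (auto simp: vec_eq_iff)
      then have "ell1 \<zeta> > 0" unfolding ell1_def by (intro sum_pos2[of _ i]) auto
      then have c: "ell1 \<zeta> + e > 0" using e by simp
      have "(\<integral>\<^sup>+s. W s * ?E s \<zeta> \<partial>lborel)
          = (\<integral>\<^sup>+s. ennreal (excess (\<zeta> $ k) / Gamma p) * ennreal (indicator {0<..} s * (s powr (p - 1) * exp (- ((ell1 \<zeta> + e) * s)))) \<partial>lborel)"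
      proof (rule nn_integral_cong)
        fix s
        have "exp (- ((ell1 \<zeta> + e) * s)) = exp (- (e * s)) * exp (- (s * ell1 \<zeta>))"
          by (simp add: exp_add[symmetric] algebra_simps)
        then show "W s * ?E s \<zeta>
           = ennreal (excess (\<zeta> $ k) / Gamma p) * ennreal (indicator {0<..} s * (s powr (p - 1) * exp (- ((ell1 \<zeta> + e) * s))))"
          using G excess_nonneg[of "\<zeta> $ k"] unfolding W_def
          by (simp add: ennreal_mult'[symmetric] mult_ac)
      qed
      also have "\<dots> = ennreal (excess (\<zeta> $ k) / Gamma p) * ennreal (Gamma p / (ell1 \<zeta> + e) powr p)"
        using nn_integral_powr_exp[OF c, of "p - 1"] p0 by (subst nn_integral_cmult) auto
      also have "\<dots> = ennreal (excess (\<zeta> $ k) / Gamma p * (Gamma p / (ell1 \<zeta> + e) powr p))"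
        using G excess_nonneg[of "\<zeta> $ k"] by (simp add: ennreal_mult'[symmetric])
      also have "excess (\<zeta> $ k) / Gamma p * (Gamma p / (ell1 \<zeta> + e) powr p) = Kt p \<tau> \<zeta> * excess (\<zeta> $ k)"
        using G unfolding Kt powr_minus by (simp add: divide_inverse)
      finally show ?case by simp
    qed
  qed
  also have "\<dots> = (\<integral>\<^sup>+s. (\<integral>\<^sup>+\<zeta>. W s * ?E s \<zeta> \<partial>lborel) \<partial>lborel)"
    by (rule lborel_pair.Fubini') measurable
  also have "\<dots> = (\<integral>\<^sup>+s. ennreal (indicator {0<..} s * (K * s powr r * exp (- (e * s)))) * ennreal (real N - 2 * jumps s) \<partial>lborel)"
  proof (rule nn_integral_cong)
    fix s :: real
    show "(\<integral>\<^sup>+\<zeta>. W s * ?E s \<zeta> \<partial>lborel)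
      = ennreal (indicator {0<..} s * (K * s powr r * exp (- (e * s)))) * ennreal (real N - 2 * jumps s)"
    proof (cases "s > 0")
      case True
      have "(\<integral>\<^sup>+\<zeta>. W s * ?E s \<zeta> \<partial>lborel)
          = W s * ennreal ((2 / s) ^ (d - 1) * (2 * ((real N - 2 * jumps s) / s\<^sup>2)))"
        by (subst nn_integral_cmult) (auto simp: laplace_vec[OF True] d_def)
      also have "\<dots> = ennreal (s powr (p - 1) * exp (- (e * s)) / Gamma p * ((2 / s) ^ (d - 1) * (2 * ((real N - 2 * jumps s) / s\<^sup>2))))"
        using True G by (simp add: W_def ennreal_mult'[symmetric])
      also have "s powr (p - 1) * exp (- (e * s)) / Gamma p * ((2 / s) ^ (d - 1) * (2 * ((real N - 2 * jumps s) / s\<^sup>2)))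
          = K * s powr r * exp (- (e * s)) * (real N - 2 * jumps s)"
      proof -
        have "p - 1 = r + real (d + 1)" by (simp add: r_def)
        then have "s powr (p - 1) = s powr (r + real (d + 1))" by (rule arg_cong)
        also have "\<dots> = s powr r * s ^ (d + 1)" using True unfolding powr_add by (simp only: powr_realpow)
        also have "s ^ (d + 1) = s ^ (d - 1) * s\<^sup>2" using d by (simp add: power_add[symmetric])
        finally have 1: "s powr (p - 1) = s powr r * (s ^ (d - 1) * s\<^sup>2)" .
        have 2: "2 * 2 ^ (d - 1) = (2::real) ^ d" using d by (simp add: power_eq_if)
        show ?thesis unfolding 1 K_def 2[symmetric] using True G by (simp add: power_divide field_simps)
      qed
      also have "ennreal (K * s powr r * exp (- (e * s)) * (real N - 2 * jumps s))
          = ennreal (indicator {0<..} s * (K * s powr r * exp (- (e * s)))) * ennreal (real N - 2 * jumps s)"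
        using True K by (simp add: ennreal_mult')
      finally show ?thesis .
    qed (simp add: W_def)
  qed
  also have "\<dots> = (\<integral>\<^sup>+s. ennreal (real N - 2 * jumps s) \<partial>M)"
    unfolding laplace_weight_def by (rule nn_integral_density[symmetric]) measurable
  also have "\<dots> = ennreal ?J"
  proof (rule nn_integral_eq_integral)
    show "integrable M (\<lambda>s. real N - 2 * jumps s)"
      by (rule integrable_jumps) (rule interfaces_axioms)
    show "AE s in M. 0 \<le> real N - 2 * jumps s" by (rule ae)
  qed
  finally have main: "(\<integral>\<^sup>+\<zeta>. ennreal (Kt p \<tau> \<zeta> * excess ((\<zeta> :: real^'n) $ k)) \<partial>lborel) = ennreal ?J" .
  have nn: "0 \<le> ?J"
    using ae by (rule integral_nonneg_AE)
  have "(LINT \<zeta>|lebesgue. Kt p \<tau> (\<zeta> :: real^'n) * (L ^ (d - 1) * real N * \<bar>\<zeta> $ k\<bar>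
              - (LINT z:QL L|lebesgue. \<bar>indicator (cyl k A) z - indicator (cyl k A) (z + \<zeta>)\<bar>)))
      = (LINT \<zeta>|lebesgue. C * (Kt p \<tau> (\<zeta> :: real^'n) * excess (\<zeta> $ k)))"
    unfolding inner_integral[OF neg, of k] excess_def C_def d_def
    by (intro Bochner_Integration.integral_cong) (auto simp: algebra_simps)
  also have "\<dots> = (LINT \<zeta>|lborel. C * (Kt p \<tau> (\<zeta> :: real^'n) * excess (\<zeta> $ k)))"
    by (rule integral_completion) measurable
  also have "\<dots> = C * (LINT \<zeta>|lborel. Kt p \<tau> (\<zeta> :: real^'n) * excess (\<zeta> $ k))" by simp
  also have "(LINT \<zeta>|lborel. Kt p \<tau> (\<zeta> :: real^'n) * excess (\<zeta> $ k)) = ?J"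
    using nn main excess_nonneg
    by (subst integral_eq_nn_integral) (auto simp: Kt intro!: mult_nonneg_nonneg)
  finally have "Fcyl p \<tau> L k A = 1 / L ^ d * (- (C * real N) + C * ?J)"
    unfolding Fcyl_def Let_def bdry C_def d_def by simp
  also have "L ^ d = L * C" using d by (simp add: C_def power_eq_if)
  also have "1 / (L * C) * (- (C * real N) + C * ?J)
      = (- real N + ?J) / L"
    using C L by (simp add: field_simps)
  finally show ?thesis by (simp add: w)
qed

end

section \<open>Sets of locally finite perimeter on the line\<close>

lemma measure_Int_interval_eq_full:
  fixes A :: "real set"
  assumes A: "A \<in> sets lebesgue" and ab: "a \<le> b"
  shows "measure lebesgue (A \<inter> {a<..<b}) = b - a \<longleftrightarrow> negligible ({a<..<b} - A)"
    and "measure lebesgue (A \<inter> {a<..<b}) = 0 \<longleftrightarrow> negligible ({a<..<b} \<inter> A)"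
proof -
  have I: "{a<..<b} \<in> lmeasurable" by simp
  have AI: "A \<inter> {a<..<b} \<in> lmeasurable"
    using A I by (metis Int_commute fmeasurable_Int_fmeasurable)
  have "measure lebesgue ({a<..<b} - A \<inter> {a<..<b}) = measure lebesgue {a<..<b} - measure lebesgue (A \<inter> {a<..<b})"
    using I AI by (intro measurable_measure_Diff) auto
  moreover have "{a<..<b} - A \<inter> {a<..<b} = {a<..<b} - A" by auto
  ultimately have "measure lebesgue ({a<..<b} - A) = (b - a) - measure lebesgue (A \<inter> {a<..<b})"
    using ab by simp
  moreover have "{a<..<b} - A \<in> lmeasurable" using A I by (intro fmeasurable_Diff) auto
  ultimately show "measure lebesgue (A \<inter> {a<..<b}) = b - a \<longleftrightarrow> negligible ({a<..<b} - A)"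
    by (auto simp: negligible_iff_measure)
  show "measure lebesgue (A \<inter> {a<..<b}) = 0 \<longleftrightarrow> negligible ({a<..<b} \<inter> A)"
    using AI by (auto simp: negligible_iff_measure Int_commute)
qed

text \<open>Almost everywhere inclusion of an open interval. Emptiness is expressed as fullness of
  the complement, so each structural lemma covers both cases.\<close>

definition full :: "real set \<Rightarrow> real \<Rightarrow> real \<Rightarrow> bool" where
  "full A a b \<longleftrightarrow> negligible ({a<..<b} - A)"

abbreviation void :: "real set \<Rightarrow> real \<Rightarrow> real \<Rightarrow> bool" where "void A \<equiv> full (- A)"

lemma void_iff: "void A a b \<longleftrightarrow> negligible ({a<..<b} \<inter> A)"
  by (simp add: full_def Diff_eq)

lemma full_subinterval: "full A a b \<Longrightarrow> a \<le> c \<Longrightarrow> d \<le> b \<Longrightarrow> full A c d"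
  unfolding full_def by (erule negligible_subset) auto

lemma full_glue:
  assumes "full A u t" "full A t v"
  shows "full A u v"
proof -
  have "negligible (({u<..<t} - A) \<union> ({t<..<v} - A) \<union> {t})"
    using assms by (intro negligible_Un) (auto simp: full_def)
  then show ?thesis unfolding full_def by (rule negligible_subset) auto
qed

lemma locally_full_imp_full:
  assumes "\<And>t. u < t \<Longrightarrow> t < v \<Longrightarrow> \<exists>e>0. full A (t - e) (t + e)"
  shows "full A u v"
  unfolding full_def locally_negligible_alt[of "{u<..<v} - A"]
proof
  fix t assume t: "t \<in> {u<..<v} - A"
  then obtain e where e: "e > 0" "full A (t - e) (t + e)" using assms by auto
  show "\<exists>U. openin (top_of_set ({u<..<v} - A)) U \<and> t \<in> U \<and> negligible U"
  proof (intro exI conjI)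
    show "openin (top_of_set ({u<..<v} - A)) (({u<..<v} - A) \<inter> {t - e<..<t + e})"
      by (rule openin_open_Int) simp
    show "negligible (({u<..<v} - A) \<inter> {t - e<..<t + e})"
      by (rule negligible_subset[OF e(2)[unfolded full_def]]) auto
  qed (use t e in auto)
qed

lemma open_locally_full: "open {t. \<exists>e>0. full A (t - e) (t + e)}"
  unfolding open_dist
proof safe
  fix t e :: real assume e: "0 < e" "full A (t - e) (t + e)"
  show "\<exists>d>0. \<forall>y. dist y t < d \<longrightarrow> y \<in> {t. \<exists>e>0. full A (t - e) (t + e)}"
  proof (intro exI[of _ "e/2"] conjI allI impI)
    fix y assume "dist y t < e / 2"
    then have "t - e \<le> y - e / 2" "y + e / 2 \<le> t + e" unfolding dist_real_def by linarith+
    then show "y \<in> {t. \<exists>e>0. full A (t - e) (t + e)}"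
      using full_subinterval[OF e(2)] e(1) by (intro CollectI exI[of _ "e / 2"]) auto
  qed (use e in simp)
qed

lemma not_full_and_void:
  assumes "a < b" "full A a b" "void A a b"
  shows False
proof -
  have "negligible (({a<..<b} - A) \<union> ({a<..<b} \<inter> A))"
    using assms unfolding full_def[of A] void_iff by (rule_tac negligible_Un)
  moreover have "({a<..<b} - A) \<union> ({a<..<b} \<inter> A) = {a<..<b}" by auto
  ultimately have "negligible {a<..<b}" by simp
  then show False using open_not_negligible[of "{a<..<b}"] assms(1) by auto
qed

lemma bdry1_iff:
  assumes "A \<in> sets lebesgue"
  shows "t \<in> bdry1 A \<longleftrightarrow>
    (\<exists>e>0. full A (t - e) t \<and> void A t (t + e) \<or> void A (t - e) t \<and> full A t (t + e))"
proof -
  have "(measure lebesgue (A \<inter> {t-e<..<t}) = e \<longleftrightarrow> full A (t - e) t) \<and>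
      (measure lebesgue (A \<inter> {t<..<t+e}) = e \<longleftrightarrow> full A t (t + e)) \<and>
      (measure lebesgue (A \<inter> {t-e<..<t}) = 0 \<longleftrightarrow> void A (t - e) t) \<and>
      (measure lebesgue (A \<inter> {t<..<t+e}) = 0 \<longleftrightarrow> void A t (t + e))" if "e > 0" for e
    using measure_Int_interval_eq_full[OF assms, of "t - e" t] measure_Int_interval_eq_full[OF assms, of t "t + e"] that
    by (simp add: full_def[of A] void_iff)
  then show ?thesis unfolding bdry1_def by blast
qed

lemma lfp1_iff:
  "lfp1 A \<longleftrightarrow> A \<in> sets lebesgue \<and> (\<forall>t. \<exists>e>0. (full A (t - e) t \<or> void A (t - e) t) \<and> (full A t (t + e) \<or> void A t (t + e)))"
proof (cases "A \<in> sets lebesgue")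
  case True
  have "(measure lebesgue (A \<inter> {t-e<..<t}) \<in> {0, e} \<longleftrightarrow> full A (t - e) t \<or> void A (t - e) t) \<and>
      (measure lebesgue (A \<inter> {t<..<t+e}) \<in> {0, e} \<longleftrightarrow> full A t (t + e) \<or> void A t (t + e))" if "e > 0" for e t
    using measure_Int_interval_eq_full[OF True, of "t - e" t] measure_Int_interval_eq_full[OF True, of t "t + e"] that
    by (auto simp: full_def[of A] void_iff)
  then show ?thesis unfolding lfp1_def using True by blast
qed (simp add: lfp1_def)

lemma interior_not_bdry1:
  assumes A: "A \<in> sets lebesgue" and st: "full A u v \<or> void A u v" and t: "u < t" "t < v"
  shows "t \<notin> bdry1 A"
proof
  assume "t \<in> bdry1 A"
  then obtain e where e: "e > 0" "full A (t - e) t \<and> void A t (t + e) \<or> void A (t - e) t \<and> full A t (t + e)"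
    unfolding bdry1_iff[OF A] by blast
  define m where "m = min e (min (t - u) (v - t))"
  have m: "m > 0" "m \<le> e" "m \<le> t - u" "m \<le> v - t" using e(1) t by (auto simp: m_def)
  have "full A (t - m) t \<and> void A t (t + m) \<or> void A (t - m) t \<and> full A t (t + m)"
    using e(2) m by (auto intro: full_subinterval)
  moreover have "full A (t - m) t \<and> full A t (t + m) \<or> void A (t - m) t \<and> void A t (t + m)"
    using st m by (auto intro: full_subinterval)
  ultimately show False
    using not_full_and_void[of "t - m" t A] not_full_and_void[of t "t + m" A] m(1) by auto
qed

lemma bdry1_alternates:
  assumes A: "A \<in> sets lebesgue" and t: "t \<in> bdry1 A" "u < t" "t < v"
    and st: "full A u t \<or> void A u t" "full A t v \<or> void A t v"
  shows "full A t v \<longleftrightarrow> \<not> full A u t"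
proof -
  obtain e where e: "e > 0" "full A (t - e) t \<and> void A t (t + e) \<or> void A (t - e) t \<and> full A t (t + e)"
    using t(1) unfolding bdry1_iff[OF A] by blast
  define m where "m = min e (min (t - u) (v - t))"
  have m: "m > 0" "m \<le> e" "m \<le> t - u" "m \<le> v - t" using e(1) t by (auto simp: m_def)
  have 1: "full A (t - m) t \<and> void A t (t + m) \<or> void A (t - m) t \<and> full A t (t + m)"
    using e(2) m by (auto intro: full_subinterval)
  have 2: "full A u t \<Longrightarrow> full A (t - m) t" "void A u t \<Longrightarrow> void A (t - m) t"
    "full A t v \<Longrightarrow> full A t (t + m)" "void A t v \<Longrightarrow> void A t (t + m)"
    using m by (auto intro: full_subinterval)
  show ?thesis
    using 1 2 st not_full_and_void[of "t - m" t A] not_full_and_void[of t "t + m" A] m(1) by auto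
qed

text \<open>Away from the boundary every point has a neighbourhood that is almost full or almost
  empty. The points of these two kinds form disjoint open sets covering the interval, and
  connectedness leaves only one of them.\<close>

lemma constant_between_bdry1:
  assumes lfp: "lfp1 A" and no: "{u<..<v} \<inter> bdry1 A = {}"
  shows "full A u v \<or> void A u v"
proof -
  have A: "A \<in> sets lebesgue" using lfp by (simp add: lfp1_def)
  define S where "S C = {t. \<exists>e>0. full C (t - e) (t + e)}" for C
  have opens: "open (S C)" for C unfolding S_def by (rule open_locally_full)
  have cover: "{u<..<v} \<subseteq> S A \<union> S (- A)"
  proof
    fix t assume t: "t \<in> {u<..<v}"
    then have nb: "t \<notin> bdry1 A" using no by blast
    obtain e where e: "e > 0" "full A (t - e) t \<or> void A (t - e) t" "full A t (t + e) \<or> void A t (t + e)"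
      using lfp unfolding lfp1_iff by blast
    have "full A (t - e) t \<and> full A t (t + e) \<or> void A (t - e) t \<and> void A t (t + e)"
      using e nb unfolding bdry1_iff[OF A] by blast
    then show "t \<in> S A \<union> S (- A)" using e(1) full_glue unfolding S_def by blast
  qed
  have disj: "S A \<inter> S (- A) = {}"
  proof safe
    fix t assume "t \<in> S A" "t \<in> S (- A)"
    then obtain e1 e2 where e: "e1 > 0" "e2 > 0" "full A (t - e1) (t + e1)" "void A (t - e2) (t + e2)"
      by (auto simp: S_def)
    define m where "m = min e1 e2"
    have "full A (t - m) (t + m)" "void A (t - m) (t + m)" "m > 0"
      using e full_subinterval[OF e(3), of "t - m" "t + m"] full_subinterval[OF e(4), of "t - m" "t + m"]
      by (auto simp: m_def)
    then show "t \<in> {}" using not_full_and_void[of "t - m" "t + m" A] by simp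
  qed
  have "S A \<inter> {u<..<v} = {} \<or> S (- A) \<inter> {u<..<v} = {}"
    using connectedD[OF connected_Ioo opens opens] cover disj by blast
  then have "{u<..<v} \<subseteq> S A \<or> {u<..<v} \<subseteq> S (- A)" using cover by blast
  moreover have "full C u v" if "{u<..<v} \<subseteq> S C" for C
    using that by (intro locally_full_imp_full) (auto simp: S_def)
  ultimately show ?thesis by blast
qed

text \<open>Each point has one-sided neighbourhoods that are almost full or almost empty and hence
  free of boundary points, so the boundary has no accumulation point.\<close>

lemma finite_bdry1:
  assumes lfp: "lfp1 A"
  shows "finite ({a..b} \<inter> bdry1 A)"
proof (rule finite_not_islimpt_in_compact)
  have A: "A \<in> sets lebesgue" using lfp by (simp add: lfp1_def)
  fix t
  obtain e where e: "e > 0" "full A (t - e) t \<or> void A (t - e) t" "full A t (t + e) \<or> void A t (t + e)"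
    using lfp unfolding lfp1_iff by blast
  show "\<not> t islimpt bdry1 A"
  proof
    assume "t islimpt bdry1 A"
    then obtain y where y: "y \<in> bdry1 A" "y \<in> {t - e<..<t + e}" "y \<noteq> t"
      using e(1) by (auto elim!: islimptE[where T = "{t - e<..<t + e}"])
    show False
    proof (cases "y < t")
      case True then show False using interior_not_bdry1[OF A e(2), of y] y by auto
    next
      case False then show False using interior_not_bdry1[OF A e(3), of y] y by auto
    qed
  qed
qed simp

section \<open>Periodic sets and their interfaces\<close>

lemma periodic_int:
  fixes A :: "real set"
  assumes "\<And>t. t \<in> A \<longleftrightarrow> t + L \<in> A"
  shows "t + of_int k * L \<in> A \<longleftrightarrow> t \<in> A"
proof -
  have nat: "t + real n * L \<in> A \<longleftrightarrow> t \<in> A" for n t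
  proof (induction n)
    case (Suc n)
    have "t + real (Suc n) * L = (t + real n * L) + L" by (simp add: algebra_simps)
    then show ?case using Suc assms by metis
  qed simp
  show ?thesis
  proof (cases "k \<ge> 0")
    case True then show ?thesis using nat[of t "nat k"] by simp
  next
    case False
    then show ?thesis using nat[of "t + of_int k * L" "nat (- k)"] by simp
  qed
qed

lemma translate_periodic:
  fixes A :: "real set"
  assumes "\<And>t. t \<in> A \<longleftrightarrow> t + L \<in> A"
  shows "full A (a + L) (b + L) \<longleftrightarrow> full A a b" "void A (a + L) (b + L) \<longleftrightarrow> void A a b"
proof -
  have *: "full A (a + L) (b + L) \<longleftrightarrow> full A a b" if per: "\<And>t. t \<in> A \<longleftrightarrow> t + L \<in> A" for A :: "real set"
  proof -
    have "{a + L<..<b + L} - A = (+) L ` ({a<..<b} - A)"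
    proof (rule set_eqI)
      fix t show "t \<in> {a + L<..<b + L} - A \<longleftrightarrow> t \<in> (+) L ` ({a<..<b} - A)"
        using per[of "t - L"] by (auto simp: image_iff algebra_simps intro!: bexI[of _ "t - L"])
    qed
    then show ?thesis unfolding full_def using negligible_translation negligible_translation_rev by metis
  qed
  show "full A (a + L) (b + L) \<longleftrightarrow> full A a b" "void A (a + L) (b + L) \<longleftrightarrow> void A a b"
    using *[of A] *[of "- A"] assms by auto
qed

lemma bdry1_periodic:
  assumes "A \<in> sets lebesgue" "\<And>t. t \<in> A \<longleftrightarrow> t + L \<in> A"
  shows "t \<in> bdry1 A \<longleftrightarrow> t + L \<in> bdry1 A"
proof -
  have "t + L - e = (t - e) + L" "t + L + e = (t + e) + L" for e by simp_all
  then show ?thesis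
    unfolding bdry1_iff[OF assms(1)] by (simp only: translate_periodic[OF assms(2)])
qed

lemma admissible_interfaces:
  assumes adm: "admissible L \<alpha> A" and L: "L > 0" and \<alpha>: "0 < \<alpha>" "\<alpha> < 1"
  obtains B x f where "interfaces B L (card (bdry1 A \<inter> {0..<L})) x f"
    "negligible {t. \<not> (t \<in> A \<longleftrightarrow> t \<in> B)}"
proof -
  have lfp: "lfp1 A" and per: "\<And>t. t \<in> A \<longleftrightarrow> t + L \<in> A"
    and meas: "measure lebesgue (A \<inter> {0..<L}) = \<alpha> * L"
    using adm L by (auto simp: admissible_def field_simps)
  have A: "A \<in> sets lebesgue" using lfp by (simp add: lfp1_def)
  define D where "D = bdry1 A \<inter> {0..<L}"
  define N where "N = card D"
  have finD: "finite D" unfolding D_def by (rule finite_subset[OF _ finite_bdry1[OF lfp, of 0 L]]) auto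
  have bper: "t + of_int k * L \<in> bdry1 A \<longleftrightarrow> t \<in> bdry1 A" for t k
    by (rule periodic_int) (rule bdry1_periodic[OF A per])
  \<comment> \<open>Here the restriction on the density enters: without interfaces the period would
    be almost full or almost empty.\<close>
  have D_ne: "D \<noteq> {}"
  proof
    assume "D = {}"
    then have "full A 0 L \<or> void A 0 L"
      by (intro constant_between_bdry1[OF lfp]) (auto simp: D_def)
    then have "measure lebesgue (A \<inter> {0<..<L}) = L \<or> measure lebesgue (A \<inter> {0<..<L}) = 0"
      using measure_Int_interval_eq_full[OF A, of 0 L] L by (auto simp: full_def[of A] void_iff)
    moreover have "measure lebesgue (A \<inter> {0..<L}) = measure lebesgue (A \<inter> {0<..<L})"
    proof (rule measure_negligible_symdiff)
      show "A \<inter> {0<..<L} \<in> lmeasurable"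
        using A by (metis Int_commute fmeasurable_Int_fmeasurable lmeasurable_interval(2) box_real(1))
      show "negligible ((A \<inter> {0<..<L} - A \<inter> {0..<L}) \<union> (A \<inter> {0..<L} - A \<inter> {0<..<L}))"
        by (rule negligible_subset[of "{0}"]) auto
    qed
    ultimately show False using meas \<alpha> L by auto
  qed
  then have N: "N > 0" using finD by (simp add: N_def card_gt_0_iff)
  define xs where "xs = sorted_list_of_set D"
  have xs: "sorted_wrt (<) xs" "set xs = D" "length xs = N"
    using finD by (auto simp: xs_def N_def)
  \<comment> \<open>Index \<open>N\<close> is the first interface moved by one period.\<close>
  define x where "x j = (if j < N then xs ! j else xs ! 0 + L)" for j
  have x0: "0 \<le> x 0" "x 0 < L" using xs N nth_mem[of 0 xs] by (auto simp: x_def D_def)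
  have xD: "x j \<in> D" if "j < N" for j using that xs nth_mem[of j xs] by (auto simp: x_def)
  have x_N: "x N = x 0 + L" using N by (simp add: x_def)
  have x_less: "x j < x (Suc j)" if "j < N" for j
  proof (cases "Suc j < N")
    case True then show ?thesis using sorted_wrt_nth_less[OF xs(1), of j "Suc j"] xs(3) by (simp add: x_def)
  next
    case False
    then have "Suc j = N" using that by simp
    then show ?thesis using xD[OF that] x0 x_N by (auto simp: D_def)
  qed
  have mono: "x i \<le> x j" if "i \<le> j" "j \<le> N" for i j
    using that
  proof (induction j rule: dec_induct)
    case (step n)
    then show ?case using x_less[of n] by simp
  qed simp
  have bx: "x j \<in> bdry1 A" if "j \<le> N" for j
    using xD[of j] xD[of 0] N that bper[of "x 0" 1] x_N by (cases "j = N") (auto simp: D_def)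
  have no: "{x j<..<x (Suc j)} \<inter> bdry1 A = {}" if j: "j < N" for j
  proof safe
    fix y assume y: "y \<in> {x j<..<x (Suc j)}" "y \<in> bdry1 A"
    have *: False if z: "z \<in> D" "z \<in> {x j<..<x (Suc j)}" for z
    proof -
      obtain i where i: "i < N" "z = x i" using z(1) xs by (auto simp: in_set_conv_nth x_def)
      have "j < i" using i z(2) mono[of i j] j by (cases "i \<le> j") auto
      then have "x (Suc j) \<le> x i" using i mono by simp
      then show False using i z(2) by simp
    qed
    show "y \<in> {}"
    proof (cases "y < L")
      case True
      then have "y \<in> D" using y mono[of 0 j] x0 j by (auto simp: D_def)
      then show ?thesis using * y by blast
    next
      case False
      have "y < x 0 + L" using y mono[of "Suc j" N] j x_N by auto
      then have "y - L \<in> D" using False y x0 bper[of y "-1"] by (auto simp: D_def)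
      then obtain i where "i < N" "y - L = x i" using xs by (auto simp: in_set_conv_nth x_def)
      then show ?thesis using mono[of 0 i] \<open>y < x 0 + L\<close> by simp
    qed
  qed
  have st: "full A (x j) (x (Suc j)) \<or> void A (x j) (x (Suc j))" if "j < N" for j
    using constant_between_bdry1[OF lfp no[OF that]] .
  define f :: "nat \<Rightarrow> real" where
    "f j = (let i = (if j < N then j else 0) in if full A (x i) (x (Suc i)) then 1 else 0)" for j
  have f_Suc: "f (Suc j) = 1 - f j" if j: "j < N" for j
  proof (cases "Suc j < N")
    case True
    then show ?thesis
      using bdry1_alternates[OF A bx x_less[OF j] x_less[OF True] st[OF j] st[OF True]] j
      by (auto simp: f_def)
  next
    case False
    then have Nj: "Suc j = N" using j by simp
    \<comment> \<open>The cell after \<open>x N\<close> is the first cell moved by one period; this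
      carries the alternation around the end of the cycle.\<close>
    have "full A (x N) (x 1 + L) \<longleftrightarrow> full A (x 0) (x 1)" "void A (x N) (x 1 + L) \<longleftrightarrow> void A (x 0) (x 1)"
      unfolding x_N by (rule translate_periodic[OF per])+
    then show ?thesis
      using bdry1_alternates[OF A bx[OF order_refl], of "x j" "x 1 + L"] x_less[OF j] x_less[OF N] st[OF j] st[OF N] x_N Nj N j
      by (auto simp: f_def)
  qed
  \<comment> \<open>All translates of the full open cells: a Borel set that is periodic by
    construction.\<close>
  define B where "B = (\<Union>k::int. \<Union>j\<in>{j. j < N \<and> f j = 1}. {t. x j < t + of_int k * L \<and> t + of_int k * L < x (Suc j)})"
  have B_iff: "t \<in> B \<longleftrightarrow> (\<exists>k::int. \<exists>j<N. f j = 1 \<and> x j < t + of_int k * L \<and> t + of_int k * L < x (Suc j))" for t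
    by (auto simp: B_def)
  have cell: "t \<in> B \<longleftrightarrow> f j = 1" if j: "j < N" and t: "x j < t" "t < x (Suc j)" for j t
  proof
    assume "f j = 1"
    then show "t \<in> B" unfolding B_iff using j t by (intro exI[of _ 0] exI[of _ j]) auto
  next
    assume "t \<in> B"
    then obtain k :: int and i where i: "i < N" "f i = 1" "x i < t + of_int k * L" "t + of_int k * L < x (Suc i)"
      unfolding B_iff by blast
    have "x 0 < t + of_int k * L" "t + of_int k * L < x 0 + L" "x 0 < t" "t < x 0 + L"
      using i t j mono[of 0 i] mono[of "Suc i" N] mono[of 0 j] mono[of "Suc j" N] x_N by auto
    \<comment> \<open>Both \<open>t\<close> and its translate lie in the same open window of length
      \<open>L\<close>, so the shift must be zero.\<close>
    then have "\<bar>of_int k * L\<bar> < 1 * L" by auto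
    then have "\<bar>of_int k :: real\<bar> < 1" using L by (simp add: abs_mult)
    then have k: "k = 0" by linarith
    have "i = j"
    proof (rule ccontr)
      assume "i \<noteq> j"
      then consider "Suc i \<le> j" | "Suc j \<le> i" by linarith
      then show False
        by cases (use i t k mono[of "Suc i" j] mono[of "Suc j" i] j in auto)
    qed
    then show "f j = 1" using i by simp
  qed
  have Bper: "t + of_int k * L \<in> B \<longleftrightarrow> t \<in> B" for t k
  proof -
    have *: "t \<in> B" if tk: "t + of_int k * L \<in> B" for t k
    proof -
      obtain k' :: int and j where "j < N" "f j = 1" "x j < t + of_int k * L + of_int k' * L" "t + of_int k * L + of_int k' * L < x (Suc j)"
        using tk unfolding B_iff by blast
      then show ?thesis unfolding B_iff by (intro exI[of _ "k + k'"] exI[of _ j]) (auto simp: algebra_simps)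
    qed
    show ?thesis using *[of t k] *[of "t + of_int k * L" "- k"] by auto
  qed
  have "interfaces B L N x f"
  proof
    show "B \<in> sets borel" unfolding B_def
      by (intro sets.countable_UN borel_open sets.finite_UN) (auto intro!: open_Collect_conj open_Collect_less continuous_intros)
    show "t + L \<in> B \<longleftrightarrow> t \<in> B" for t using Bper[of t 1] by simp
    show "f j = 0 \<or> f j = 1" if "j < N" for j by (auto simp: f_def Let_def)
    show "f N = f 0" using N by (simp add: f_def)
    show "indicator B t = f j" if "j < N" "x j < t" "t < x (Suc j)" for j t
      using cell[OF that] by (auto simp: indicator_def f_def Let_def split: if_splits)
  qed (use L N x_less x_N f_Suc in auto)
  moreover have "negligible {t. \<not> (t \<in> A \<longleftrightarrow> t \<in> B)}"
  proof (rule negligible_subset)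
    \<comment> \<open>The points of one cell, left end included, where \<open>A\<close> and
      \<open>B\<close> may disagree. Translates of the finite union \<open>W\<close> cover the whole
      exceptional set.\<close>
    define Bad where "Bad j = insert (x j) (if f j = 1 then {x j<..<x (Suc j)} - A else {x j<..<x (Suc j)} \<inter> A)" for j
    define W where "W = (\<Union>j<N. Bad j)"
    have "negligible (Bad j)" if "j < N" for j
      using st[OF that] that unfolding Bad_def by (auto simp: f_def full_def[of A] void_iff negligible_insert)
    then have W: "negligible W" unfolding W_def by (intro negligible_Union) auto
    show "negligible (\<Union>(range (\<lambda>k::int. (+) (- (of_int k * L)) ` W)))"
    proof (rule negligible_countable_Union)
      fix S assume "S \<in> range (\<lambda>k::int. (+) (- (of_int k * L)) ` W)"
      then obtain k :: int where "S = (+) (- (of_int k * L)) ` W" by blast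
      then show "negligible S" using negligible_translation[OF W] by metis
    qed simp
    show "{t. \<not> (t \<in> A \<longleftrightarrow> t \<in> B)} \<subseteq> (\<Union>k::int. (+) (- (of_int k * L)) ` W)"
    proof
      fix t assume t: "t \<in> {t. \<not> (t \<in> A \<longleftrightarrow> t \<in> B)}"
      \<comment> \<open>The shift that moves \<open>t\<close> into the period starting at
        \<open>x 0\<close>.\<close>
      define k where "k = - \<lfloor>(t - x 0) / L\<rfloor>"
      define y where "y = t + of_int k * L"
      have y: "x 0 \<le> y" "y < x N"
        using floor_divide_lower[OF L, of "t - x 0"] floor_divide_upper[OF L, of "t - x 0"]
        by (auto simp: y_def k_def x_N algebra_simps)
      have "\<exists>j<N. x j \<le> y \<and> y < x (Suc j)"
      proof -
        define j where "j = (LEAST j. y < x (Suc j))"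
        have ex: "y < x (Suc (N - 1))" using y N by simp
        then have 1: "y < x (Suc j)" unfolding j_def by (rule LeastI)
        have 2: "j \<le> N - 1" unfolding j_def using ex by (rule Least_le)
        have 3: "x j \<le> y"
        proof (cases j)
          case (Suc i)
          then have "\<not> y < x (Suc i)" using not_less_Least[of i "\<lambda>j. y < x (Suc j)"] by (simp add: j_def)
          then show ?thesis using Suc by simp
        qed (use y in simp)
        show ?thesis using 1 2 3 N by (intro exI[of _ j]) auto
      qed
      then obtain j where j: "j < N" "x j \<le> y" "y < x (Suc j)" by blast
      have yAB: "\<not> (y \<in> A \<longleftrightarrow> y \<in> B)"
        using t periodic_int[OF per, where t = t and k = k] Bper[of t k] by (auto simp: y_def)
      have "y \<in> Bad j"
      proof (cases "y = x j")
        case False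
        then show ?thesis using yAB cell[OF j(1), of y] j by (auto simp: Bad_def)
      qed (simp add: Bad_def)
      then have "y \<in> W" using j by (auto simp: W_def)
      moreover have "t = - (of_int k * L) + y" by (simp add: y_def)
      ultimately show "t \<in> (\<Union>k::int. (+) (- (of_int k * L)) ` W)" by blast
    qed
  qed
  ultimately show ?thesis using that by (simp add: N_def D_def)
qed

section \<open>Periodic stripes and the main theorem\<close>

definition stripe1_ends :: "real \<Rightarrow> real \<Rightarrow> nat \<Rightarrow> real" where
  "stripe1_ends h \<alpha> j = (if j = 0 then 0 else if j = 1 then 2 * \<alpha> * h else 2 * h)"

text \<open>Index 2 takes the value of index 0, as the cyclic condition \<open>f N = f 0\<close>
  with \<open>N = 2\<close> requires.\<close>

definition stripe1_state :: "nat \<Rightarrow> real" where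
  "stripe1_state j = (if j = 1 then 0 else 1)"

context
  fixes h \<alpha> :: real
  assumes h: "h > 0" and \<alpha>: "0 < \<alpha>" "\<alpha> < 1"
begin

lemma stripe1_subset: "{2 * of_int k * h..<(2 * of_int k + 2 * \<alpha>) * h} \<subseteq> stripe1 h \<alpha>"
  unfolding stripe1_def by blast

lemma stripe1_disjoint: "{(2 * of_int k + 2 * \<alpha>) * h..<(2 * of_int k + 2) * h} \<inter> stripe1 h \<alpha> = {}"
proof safe
  fix t assume t: "t \<in> {(2 * of_int k + 2 * \<alpha>) * h..<(2 * of_int k + 2) * h}" "t \<in> stripe1 h \<alpha>"
  then obtain j :: int where j: "2 * of_int j * h \<le> t" "t < (2 * of_int j + 2 * \<alpha>) * h"
    unfolding stripe1_def by auto
  have "(2 * of_int k + 2 * \<alpha>) * h < (2 * of_int j + 2 * \<alpha>) * h" using t(1) j by auto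
  then have "of_int k < (of_int j :: real)" using h by simp
  then have "k < j" by (simp only: of_int_less_iff)
  moreover have "2 * of_int j * h < (2 * of_int k + 2) * h" using t(1) j by auto
  then have "of_int j < (of_int (k + 1) :: real)" using h by simp
  then have "j < k + 1" by (simp only: of_int_less_iff)
  ultimately have False by linarith
  then show "t \<in> {}" ..
qed

lemma stripe1_full: "full (stripe1 h \<alpha>) (2 * of_int k * h) ((2 * of_int k + 2 * \<alpha>) * h)"
proof -
  have "{2 * of_int k * h<..<(2 * of_int k + 2 * \<alpha>) * h} - stripe1 h \<alpha> = {}"
    using stripe1_subset[of k] by auto
  then show ?thesis by (simp add: full_def)
qed

lemma stripe1_void: "void (stripe1 h \<alpha>) ((2 * of_int k + 2 * \<alpha>) * h) ((2 * of_int k + 2) * h)"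
proof -
  have "{(2 * of_int k + 2 * \<alpha>) * h<..<(2 * of_int k + 2) * h} \<inter> stripe1 h \<alpha> = {}"
    using stripe1_disjoint[of k] by (auto simp: disjoint_iff)
  then show ?thesis by (simp add: void_iff)
qed

lemma stripe1_borel: "stripe1 h \<alpha> \<in> sets borel"
  unfolding stripe1_def by (intro sets.countable_UN) auto

lemma stripe1_lebesgue: "stripe1 h \<alpha> \<in> sets lebesgue"
  using stripe1_borel by simp

lemma stripe1_periodic: "t \<in> stripe1 h \<alpha> \<longleftrightarrow> t + 2 * h \<in> stripe1 h \<alpha>"
proof
  assume "t \<in> stripe1 h \<alpha>"
  then obtain j :: int where "2 * of_int j * h \<le> t" "t < (2 * of_int j + 2 * \<alpha>) * h"
    unfolding stripe1_def by auto
  then show "t + 2 * h \<in> stripe1 h \<alpha>"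
    unfolding stripe1_def by (intro UN_I[of "j + 1"]) (auto simp: algebra_simps)
next
  assume "t + 2 * h \<in> stripe1 h \<alpha>"
  then obtain j :: int where "2 * of_int j * h \<le> t + 2 * h" "t + 2 * h < (2 * of_int j + 2 * \<alpha>) * h"
    unfolding stripe1_def by auto
  then show "t \<in> stripe1 h \<alpha>"
    unfolding stripe1_def by (intro UN_I[of "j - 1"]) (auto simp: algebra_simps)
qed

lemma stripe1_lfp1: "lfp1 (stripe1 h \<alpha>)"
  unfolding lfp1_iff
proof (intro conjI allI stripe1_lebesgue)
  fix t :: real
  define k where "k = \<lfloor>t / (2 * h)\<rfloor>"
  define a m c where "a = 2 * of_int k * h" and "m = (2 * of_int k + 2 * \<alpha>) * h" and "c = (2 * of_int k + 2) * h"
  have t: "a \<le> t" "t < c"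
    using floor_divide_lower[of "2 * h" t] floor_divide_upper[of "2 * h" t] h
    by (auto simp: a_def c_def k_def algebra_simps)
  have am: "a < m" "m < c" using h \<alpha> by (auto simp: a_def m_def c_def)
  have F: "full (stripe1 h \<alpha>) a m" unfolding a_def m_def by (rule stripe1_full)
  have V: "void (stripe1 h \<alpha>) m c" unfolding m_def c_def by (rule stripe1_void)
  \<comment> \<open>The empty interval of the preceding period, the left neighbour of
    \<open>a\<close>.\<close>
  have V': "void (stripe1 h \<alpha>) (m - 2 * h) a"
    using stripe1_void[of "k - 1"] by (simp add: a_def m_def algebra_simps)
  consider "t = a" | "a < t \<and> t < m" | "t = m" | "m < t" using t by linarith
  then show "\<exists>e>0. (full (stripe1 h \<alpha>) (t - e) t \<or> void (stripe1 h \<alpha>) (t - e) t) \<and>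
      (full (stripe1 h \<alpha>) t (t + e) \<or> void (stripe1 h \<alpha>) t (t + e))"
  proof cases
    case 1
    define e where "e = min (m - a) (a - (m - 2 * h))"
    have "a - (m - 2 * h) = 2 * ((1 - \<alpha>) * h)" by (simp add: a_def m_def algebra_simps)
    also have "\<dots> > 0" using h \<alpha> by simp
    finally have "e > 0" using am by (simp add: e_def)
    then show ?thesis
      using 1 full_subinterval[OF F, of t "t + e"] full_subinterval[OF V', of "t - e" t]
      by (intro exI[of _ e]) (auto simp: e_def)
  next
    case 2
    define e where "e = min (t - a) (m - t)"
    have "e > 0" using 2 by (simp add: e_def)
    then show ?thesis
      using 2 full_subinterval[OF F, of t "t + e"] full_subinterval[OF F, of "t - e" t]
      by (intro exI[of _ e]) (auto simp: e_def)
  next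
    case 3
    define e where "e = min (m - a) (c - m)"
    have "e > 0" using am by (simp add: e_def)
    then show ?thesis
      using 3 full_subinterval[OF V, of t "t + e"] full_subinterval[OF F, of "t - e" t]
      by (intro exI[of _ e]) (auto simp: e_def)
  next
    case 4
    define e where "e = min (t - m) (c - t)"
    have "e > 0" using 4 t by (simp add: e_def)
    then show ?thesis
      using 4 full_subinterval[OF V, of t "t + e"] full_subinterval[OF V, of "t - e" t]
      by (intro exI[of _ e]) (auto simp: e_def)
  qed
qed

lemma bdry1_stripe1: "bdry1 (stripe1 h \<alpha>) \<inter> {0..<2 * h} = {0, 2 * \<alpha> * h}"
proof -
  have F: "full (stripe1 h \<alpha>) 0 (2 * \<alpha> * h)" using stripe1_full[of 0] by simp
  have V: "void (stripe1 h \<alpha>) (2 * \<alpha> * h) (2 * h)" using stripe1_void[of 0] by simp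
  have V': "void (stripe1 h \<alpha>) (2 * \<alpha> * h - 2 * h) 0" using stripe1_void[of "-1"] by (simp add: algebra_simps)
  have pos: "0 < 2 * \<alpha> * h" "2 * \<alpha> * h < 2 * h" using h \<alpha> by auto
  define e where "e = min (2 * \<alpha> * h) (2 * h - 2 * \<alpha> * h)"
  have e: "e > 0" "e \<le> 2 * \<alpha> * h" "e \<le> 2 * h - 2 * \<alpha> * h" using pos by (auto simp: e_def)
  have "0 \<in> bdry1 (stripe1 h \<alpha>)"
    unfolding bdry1_iff[OF stripe1_lebesgue]
    using e full_subinterval[OF F, of 0 "0 + e"] full_subinterval[OF V', of "0 - e" 0]
    by (intro exI[of _ e]) auto
  moreover have "2 * \<alpha> * h \<in> bdry1 (stripe1 h \<alpha>)"
    unfolding bdry1_iff[OF stripe1_lebesgue]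
    using e full_subinterval[OF F, of "2 * \<alpha> * h - e" "2 * \<alpha> * h"] full_subinterval[OF V, of "2 * \<alpha> * h" "2 * \<alpha> * h + e"]
    by (intro exI[of _ e]) auto
  moreover have "\<forall>t. t \<in> bdry1 (stripe1 h \<alpha>) \<longrightarrow> 0 \<le> t \<longrightarrow> t < 2 * h \<longrightarrow> t = 0 \<or> t = 2 * \<alpha> * h"
  proof (intro allI impI)
    fix t assume "t \<in> bdry1 (stripe1 h \<alpha>)" "0 \<le> t" "t < 2 * h"
    then show "t = 0 \<or> t = 2 * \<alpha> * h"
    using interior_not_bdry1[OF stripe1_lebesgue disjI1[OF F], of t]
      interior_not_bdry1[OF stripe1_lebesgue disjI2[OF V], of t] by linarith
  qed
  ultimately show ?thesis
    using pos h by (intro subset_antisym subsetI) (auto simp del: mult_less_cancel_right2)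
qed

lemma stripe1_admissible: "admissible (2 * h) \<alpha> (stripe1 h \<alpha>)"
  unfolding admissible_def
proof (intro conjI allI stripe1_lfp1 stripe1_periodic)
  have "stripe1 h \<alpha> \<inter> {0..<2 * h} = {0..<2 * \<alpha> * h}"
  proof -
    have "{0..<2 * \<alpha> * h} \<subseteq> stripe1 h \<alpha>" using stripe1_subset[of 0] by simp
    moreover have "{2 * \<alpha> * h..<2 * h} \<inter> stripe1 h \<alpha> = {}" using stripe1_disjoint[of 0] by simp
    moreover have "2 * \<alpha> * h \<le> 2 * h" using h \<alpha> by simp
    ultimately show ?thesis by (fastforce simp: disjoint_iff subset_iff not_less)
  qed
  then show "measure lebesgue (stripe1 h \<alpha> \<inter> {0..<2 * h}) / (2 * h) = \<alpha>"
    using h \<alpha> by simp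
qed

lemma interfaces_stripe1: "interfaces (stripe1 h \<alpha>) (2 * h) 2 (stripe1_ends h \<alpha>) stripe1_state"
proof
  show "stripe1 h \<alpha> \<in> sets borel" by (rule stripe1_borel)
  show "t + 2 * h \<in> stripe1 h \<alpha> \<longleftrightarrow> t \<in> stripe1 h \<alpha>" for t using stripe1_periodic by simp
  show "indicator (stripe1 h \<alpha>) t = stripe1_state j"
    if j: "j < 2" and t: "stripe1_ends h \<alpha> j < t" "t < stripe1_ends h \<alpha> (Suc j)" for j t
  proof (cases "j = 0")
    case True
    then have "t \<in> stripe1 h \<alpha>" using t stripe1_subset[of 0] by (auto simp: stripe1_ends_def)
    then show ?thesis using True by (simp add: stripe1_state_def)
  next
    case False
    then have "t \<notin> stripe1 h \<alpha>" using j t stripe1_disjoint[of 0] by (auto simp: stripe1_ends_def disjoint_iff)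
    then show ?thesis using False j by (simp add: stripe1_state_def)
  qed
qed (use h \<alpha> in \<open>auto simp: stripe1_ends_def stripe1_state_def less_2_cases_iff\<close>)

end

text \<open>The mean value theorem on both sides of the intermediate point turns the two chord
  slopes into values of \<open>g\<close> at ordered points.\<close>

lemma DERIV_strict_mono_imp_strictly_convex:
  fixes F g :: "real \<Rightarrow> real"
  assumes F: "\<And>t. a < t \<Longrightarrow> t < b \<Longrightarrow> (F has_real_derivative g t) (at t)"
    and g: "\<And>s t. a < s \<Longrightarrow> s < t \<Longrightarrow> t < b \<Longrightarrow> g s < g t"
  shows "strictly_convex_on {a<..<b} F"
proof -
  have *: "F (t * u + (1 - t) * v) < t * F u + (1 - t) * F v"
    if uv: "a < u" "u < v" "v < b" and t: "0 < t" "t < 1" for u v t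
  proof -
    define z where "z = t * u + (1 - t) * v"
    have zu: "z - u = (1 - t) * (v - u)" and vz: "v - z = t * (v - u)"
      by (simp_all add: z_def algebra_simps)
    have "0 < z - u" "0 < v - z" unfolding zu vz using uv t by auto
    then have z: "u < z" "z < v" by auto
    have "\<exists>p>u. p < z \<and> F z - F u = (z - u) * g p"
      by (rule MVT2[OF z(1)]) (use F uv z in auto)
    then obtain p where p: "u < p" "p < z" "F z - F u = (z - u) * g p" by blast
    have "\<exists>q>z. q < v \<and> F v - F z = (v - z) * g q"
      by (rule MVT2[OF z(2)]) (use F uv z in auto)
    then obtain q where q: "z < q" "q < v" "F v - F z = (v - z) * g q" by blast
    have "g p < g q" using g[of p q] p q uv by simp
    moreover have "0 < t * ((1 - t) * (v - u))" using t uv by simp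
    ultimately have "0 < t * ((1 - t) * (v - u)) * (g q - g p)" by simp
    also have "\<dots> = (1 - t) * (F v - F z) - t * (F z - F u)"
      unfolding p(3) q(3) zu vz by (simp add: algebra_simps)
    finally have "F z < t * F u + (1 - t) * F v" by (simp add: algebra_simps)
    then show ?thesis by (simp add: z_def)
  qed
  show ?thesis
    unfolding strictly_convex_on_def
  proof (intro ballI allI impI)
    fix u v t :: real assume uv: "u \<in> {a<..<b}" "v \<in> {a<..<b}" and t: "u \<noteq> v \<and> 0 < t \<and> t < 1"
    show "F (t * u + (1 - t) * v) < t * F u + (1 - t) * F v"
    proof (cases "u < v")
      case True then show ?thesis using *[of u v t] uv t by simp
    next
      case False
      then show ?thesis using *[of v u "1 - t"] uv t by (simp add: add.commute)
    qed
  qed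
qed

context stripe_energy
begin

lemma strictly_convex_optimal_energy: "strictly_convex_on {0<..<1} optimal_energy"
proof (rule DERIV_strict_mono_imp_strictly_convex)
  show "(optimal_energy has_real_derivative marginal t) (at t)" if "0 < t" "t < 1" for t
    using optimal_energy_deriv[OF that] .
  obtain c where c: "c > 0" "\<And>\<alpha>. 0 < \<alpha> \<Longrightarrow> \<alpha> < 1 \<Longrightarrow>
    \<exists>m. (marginal has_real_derivative m) (at \<alpha>) \<and> c * min (\<alpha> powr (r + 2)) ((1 - \<alpha>) powr (r + 2)) \<le> m"
    using marginal_deriv_ge by blast
  show "marginal s < marginal t" if "0 < s" "s < t" "t < 1" for s t
  proof (rule DERIV_pos_imp_increasing[OF \<open>s < t\<close>])
    fix u assume "s \<le> u" "u \<le> t"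
    then have u: "0 < u" "u < 1" using that by auto
    then obtain m where m: "(marginal has_real_derivative m) (at u)" "c * min (u powr (r + 2)) ((1 - u) powr (r + 2)) \<le> m"
      using c(2) by blast
    have "0 < c * min (u powr (r + 2)) ((1 - u) powr (r + 2))" using c(1) u by simp
    then show "\<exists>y. (marginal has_real_derivative y) (at u) \<and> 0 < y" using m by (intro exI[of _ m]) auto
  qed
qed

end

theorem theorem3p2:
  fixes p :: real and k :: "'n::finite"
  assumes "p \<ge> real CARD('n) + 2"
  shows "\<exists>\<tau>h>0. \<forall>\<tau>. 0 \<le> \<tau> \<and> \<tau> \<le> \<tau>h \<longrightarrow>
    (\<exists>hs :: real \<Rightarrow> real.
        (\<forall>\<alpha>\<in>{0<..<1}. hs \<alpha> > 0
           \<and> (\<forall>h>0. Fcyl p \<tau> (2 * h) k (stripe1 h \<alpha>) = Lambda TYPE('n) p \<tau> \<alpha> \<longleftrightarrow> h = hs \<alpha>)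
           \<and> Lambda TYPE('n) p \<tau> \<alpha> = Inf {Fcyl p \<tau> (2 * h) k (stripe1 h \<alpha>) | h. h > 0})
        \<and> filterlim hs at_top (at_right 0) \<and> filterlim hs at_top (at_left 1))
    \<and> (\<exists>C2>0. \<forall>\<alpha>\<in>{0<..<1}. Lambda TYPE('n) p \<tau> differentiable (at \<alpha>)
                 \<and> \<bar>deriv (Lambda TYPE('n) p \<tau>) \<alpha>\<bar> \<le> C2)
    \<and> strictly_convex_on {0<..<1} (Lambda TYPE('n) p \<tau>)
    \<and> (\<exists>c>0. \<forall>\<alpha>\<in>{0<..<1}. deriv (Lambda TYPE('n) p \<tau>) differentiable (at \<alpha>)
                 \<and> deriv (deriv (Lambda TYPE('n) p \<tau>)) \<alpha>
                     \<ge> c * min (\<alpha> powr (p - real CARD('n))) ((1 - \<alpha>) powr (p - real CARD('n))))"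
  (is "\<exists>\<tau>h>0. \<forall>\<tau>. 0 \<le> \<tau> \<and> \<tau> \<le> \<tau>h \<longrightarrow> ?P \<tau>")
proof -
  define d where "d = CARD('n)"
  define K where "K = 2 ^ d / Gamma p"
  define r where "r = p - real d - 2"
  have p: "p \<ge> real d + 2" using assms by (simp add: d_def)
  have K: "K > 0" using p by (auto simp: K_def intro!: divide_pos_pos Gamma_real_pos)
  have r: "r \<ge> 0" using p by (simp add: r_def)
  \<comment> \<open>Half of the threshold, so that the strict inequality of
    \<open>stripe_energy\<close> also holds at the right end of the interval.\<close>
  define \<tau>h where "\<tau>h = K * Gamma (r + 1) / 2"
  have KG: "K * Gamma (r + 1) > 0" using K r by (intro mult_pos_pos Gamma_real_pos) auto
  show ?thesis
  proof (intro exI[of _ \<tau>h] conjI[OF _ allI[OF impI]])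
    show "\<tau>h > 0" using KG by (simp add: \<tau>h_def)
    fix \<tau> :: real assume \<tau>: "0 \<le> \<tau> \<and> \<tau> \<le> \<tau>h"
    let ?\<Lambda> = "Lambda TYPE('n) p \<tau>"
    define e where "e = \<tau> powr (1 / (p - real d - 1))"
    \<comment> \<open>Because \<open>r + 1 = p - d - 1\<close>, the exponent \<beta> whose
      reciprocal defines \<open>e\<close>.\<close>
    have "e powr (r + 1) = \<tau>"
      unfolding e_def powr_powr using p \<tau> by (simp add: r_def)
    moreover have "\<tau> < K * Gamma (r + 1)" using \<tau> KG unfolding \<tau>h_def by linarith
    ultimately interpret stripe_energy K r e
      using K r by unfold_locales (auto simp: e_def)
    have w: "laplace_weight (2 ^ CARD('n) / Gamma p) (p - real CARD('n) - 2) (\<tau> powr (1 / (p - real CARD('n) - 1))) = M"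
      by (simp add: K_def r_def e_def d_def)
    \<comment> \<open>For every coordinate \<open>j\<close>, since \<open>Lambda\<close> ranges over
      all coordinates while the theorem fixes \<open>k\<close>.\<close>
    have stripe: "Fcyl p \<tau> (2 * h) j (stripe1 h \<alpha>) = energy h \<alpha>"
      if "h > 0" "0 < \<alpha>" "\<alpha> < 1" for h \<alpha> and j :: 'n
    proof -
      interpret I: interfaces "stripe1 h \<alpha>" "2 * h" 2 "stripe1_ends h \<alpha>" stripe1_state
        using interfaces_stripe1[OF that] .
      have "card (bdry1 (stripe1 h \<alpha>) \<inter> {0..<2 * h}) = 2"
        unfolding bdry1_stripe1[OF that] using that by simp
      then have "Fcyl p \<tau> (2 * h) j (stripe1 h \<alpha>) = (- real 2 + (\<integral>s. real 2 - 2 * I.jumps s \<partial>M)) / (2 * h)"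
        using I.Fcyl_eq[of p \<tau> "stripe1 h \<alpha>", where k = j] assms \<tau> w by simp
      also have "(\<integral>s. real 2 - 2 * I.jumps s \<partial>M) = (\<integral>s. 2 * stripe_kernel (s * (\<alpha> * h)) (s * ((1 - \<alpha>) * h)) \<partial>M)"
      proof (rule integral_cong_AE)
        show "AE s in M. real 2 - 2 * I.jumps s = 2 * stripe_kernel (s * (\<alpha> * h)) (s * ((1 - \<alpha>) * h))"
          using AE_laplace_weight
        proof eventually_elim
          case (elim s)
          have "stripe1_ends h \<alpha> 1 - stripe1_ends h \<alpha> 0 = 2 * (\<alpha> * h)"
            "stripe1_ends h \<alpha> 2 - stripe1_ends h \<alpha> 1 = 2 * ((1 - \<alpha>) * h)"
            by (simp_all add: stripe1_ends_def algebra_simps)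
          then show ?case using I.jumps_two[OF refl _ elim] by (simp add: stripe1_state_def)
        qed
      qed measurable
      also have "\<dots> = 2 * \<Psi> (\<alpha> * h) ((1 - \<alpha>) * h)" by (simp add: \<Psi>_def)
      finally show ?thesis using that by (simp add: energy_def field_simps)
    qed
    have lower: "optimal_energy \<alpha> \<le> Fcyl p \<tau> L j A"
      if adm: "admissible L \<alpha> A" and L: "L > 0" and \<alpha>: "0 < \<alpha>" "\<alpha> < 1" for L \<alpha> A and j :: 'n
    proof -
      define N where "N = card (bdry1 A \<inter> {0..<L})"
      obtain B x f where int: "interfaces B L N x f" and neg: "negligible {t. \<not> (t \<in> A \<longleftrightarrow> t \<in> B)}"
        using admissible_interfaces[OF adm L \<alpha>] unfolding N_def by blast
      interpret I: interfaces B L N x f by (rule int)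
      \<comment> \<open>Stripes of period \<open>2 * h\<close> have two interfaces per period, hence
        the same number of interfaces per unit length as \<open>A\<close>.\<close>
      define h where "h = L / real N"
      have h: "h > 0" using L I.N by (simp add: h_def)
      have hN: "L = h * real N" using I.N by (simp add: h_def)
      have pos: "\<alpha> * h > 0" "(1 - \<alpha>) * h > 0" using h \<alpha> by auto
      have vol: "I.volume = \<alpha> * L"
      proof -
        have "measure lebesgue (A \<inter> {0..<L}) = measure lebesgue (B \<inter> {0..<L})"
        proof (rule measure_negligible_symdiff)
          show "B \<inter> {0..<L} \<in> lmeasurable"
            by (intro bounded_set_imp_lmeasurable) (auto intro: bounded_subset[of "{0..L}"])
          show "negligible ((B \<inter> {0..<L} - A \<inter> {0..<L}) \<union> (A \<inter> {0..<L} - B \<inter> {0..<L}))"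
            by (rule negligible_subset[OF neg]) auto
        qed
        then have "measure lebesgue (B \<inter> {0..<L}) = \<alpha> * L"
          using adm L by (auto simp: admissible_def field_simps)
        moreover have "emeasure lborel (B \<inter> {0..<L}) = ennreal I.volume"
        proof -
          have "emeasure lborel (B \<inter> {0..<L}) = (\<integral>\<^sup>+u. indicator (B \<inter> {0..<L}) u \<partial>lborel)" by simp
          also have "\<dots> = (\<integral>\<^sup>+u. ennreal (I.b u) * indicator {0..<L} u \<partial>lborel)"
            by (intro nn_integral_cong) (auto simp: indicator_def)
          finally show ?thesis by (simp add: I.volume_eq)
        qed
        moreover have "0 \<le> I.volume"
          unfolding I.volume_def
        proof (rule sum_nonneg)
          fix i assume "i \<in> {..<N}"
          then show "0 \<le> f i * (x (Suc i) - x i)" using I.x_less[of i] I.f01[of i] by auto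
        qed
        ultimately show ?thesis by (simp add: measure_def)
      qed
      have "optimal_energy \<alpha> \<le> energy h \<alpha>"
        using energy_minimal[OF \<alpha> h] by (cases "h = hopt \<alpha>") (auto simp: optimal_energy_def)
      also have "\<dots> = (- real N + real N * \<Psi> (\<alpha> * h) ((1 - \<alpha>) * h)) / L"
        using h I.N unfolding hN energy_def by (simp add: field_simps)
      also have "\<dots> \<le> (- real N + (\<integral>s. real N - 2 * I.jumps s \<partial>M)) / L"
      proof -
        have "real N * \<Psi> (\<alpha> * h) ((1 - \<alpha>) * h) = (\<integral>s. real N * stripe_kernel (s * (\<alpha> * h)) (s * ((1 - \<alpha>) * h)) \<partial>M)"
          by (simp add: \<Psi>_def)
        also have "\<dots> \<le> (\<integral>s. real N - 2 * I.jumps s \<partial>M)"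
        proof (rule integral_mono_AE)
          show "integrable M (\<lambda>s. real N * stripe_kernel (s * (\<alpha> * h)) (s * ((1 - \<alpha>) * h)))"
            using integrable_\<Psi>[OF pos] by (rule integrable_mult_right)
          show "integrable M (\<lambda>s. real N - 2 * I.jumps s)" by (rule integrable_jumps[OF int])
          show "AE s in M. real N * stripe_kernel (s * (\<alpha> * h)) (s * ((1 - \<alpha>) * h)) \<le> real N - 2 * I.jumps s"
            using AE_laplace_weight by eventually_elim (rule I.jumps_le[OF _ \<alpha> vol h_def])
        qed
        finally show ?thesis using L by (intro divide_right_mono) auto
      qed
      also have "\<dots> = Fcyl p \<tau> L j A"
        using I.Fcyl_eq[of p \<tau> A, where k = j] assms \<tau> w neg by (simp add: N_def)
      finally show ?thesis .
    qed
    have Lam: "?\<Lambda> \<alpha> = optimal_energy \<alpha>" if \<alpha>: "0 < \<alpha>" "\<alpha> < 1" for \<alpha>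
      unfolding Lambda_def
    proof (rule cInf_eq_minimum)
      have "optimal_energy \<alpha> = Fcyl p \<tau> (2 * hopt \<alpha>) k (stripe1 (hopt \<alpha>) \<alpha>)"
        using stripe[OF hopt_pos[OF \<alpha>] \<alpha>] by (simp add: optimal_energy_def)
      moreover have "2 * hopt \<alpha> > 0" "admissible (2 * hopt \<alpha>) \<alpha> (stripe1 (hopt \<alpha>) \<alpha>)"
        using hopt_pos[OF \<alpha>] stripe1_admissible[OF hopt_pos[OF \<alpha>] \<alpha>] by auto
      ultimately show "optimal_energy \<alpha> \<in> {Fcyl p \<tau> L (k::'n) A |L k A. L > 0 \<and> admissible L \<alpha> A}" by blast
    qed (use lower \<alpha> in blast)
    have inner: "Inf {Fcyl p \<tau> (2 * h) k (stripe1 h \<alpha>) | h. h > 0} = optimal_energy \<alpha>" if \<alpha>: "0 < \<alpha>" "\<alpha> < 1" for \<alpha>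
    proof (rule cInf_eq_minimum)
      show "optimal_energy \<alpha> \<in> {Fcyl p \<tau> (2 * h) k (stripe1 h \<alpha>) | h. h > 0}"
        using stripe[OF hopt_pos[OF \<alpha>] \<alpha>, of k] hopt_pos[OF \<alpha>] unfolding optimal_energy_def by force
      fix y assume "y \<in> {Fcyl p \<tau> (2 * h) k (stripe1 h \<alpha>) | h. h > 0}"
      then obtain h where "h > 0" "y = energy h \<alpha>" using stripe[OF _ \<alpha>] by auto
      then show "optimal_energy \<alpha> \<le> y"
        using energy_minimal[OF \<alpha>, of h] by (cases "h = hopt \<alpha>") (auto simp: optimal_energy_def)
    qed
    have D1: "(?\<Lambda> has_real_derivative marginal \<alpha>) (at \<alpha>)" if \<alpha>: "0 < \<alpha>" "\<alpha> < 1" for \<alpha>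
      by (rule has_field_derivative_transform_within_open[OF optimal_energy_deriv[OF \<alpha>], where S = "{0<..<1}"])
        (use \<alpha> Lam in auto)
    have d1: "deriv (?\<Lambda>) \<alpha> = marginal \<alpha>" if "0 < \<alpha>" "\<alpha> < 1" for \<alpha>
      using D1[OF that] by (rule DERIV_imp_deriv)
    have D2: "(deriv (?\<Lambda>) has_real_derivative m) (at \<alpha>)"
      if \<alpha>: "0 < \<alpha>" "\<alpha> < 1" and m: "(marginal has_real_derivative m) (at \<alpha>)" for \<alpha> m
      by (rule has_field_derivative_transform_within_open[OF m, where S = "{0<..<1}"])
        (use \<alpha> d1 in auto)
    obtain c where c: "c > 0" "\<And>\<alpha>. 0 < \<alpha> \<Longrightarrow> \<alpha> < 1 \<Longrightarrow>
      \<exists>m. (marginal has_real_derivative m) (at \<alpha>) \<and> c * min (\<alpha> powr (r + 2)) ((1 - \<alpha>) powr (r + 2)) \<le> m"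
      using marginal_deriv_ge by blast
    \<comment> \<open>This is \<open>q - 1\<close>, the exponent of the claim.\<close>
    have r2: "p - real CARD('n) = r + 2" by (simp add: r_def d_def)
    have "\<exists>hs :: real \<Rightarrow> real.
        (\<forall>\<alpha>\<in>{0<..<1}. hs \<alpha> > 0
           \<and> (\<forall>h>0. Fcyl p \<tau> (2 * h) k (stripe1 h \<alpha>) = ?\<Lambda> \<alpha> \<longleftrightarrow> h = hs \<alpha>)
           \<and> ?\<Lambda> \<alpha> = Inf {Fcyl p \<tau> (2 * h) k (stripe1 h \<alpha>) | h. h > 0})
        \<and> filterlim hs at_top (at_right 0) \<and> filterlim hs at_top (at_left 1)"
    proof (intro exI[of _ hopt] conjI ballI allI impI hopt_at_right_0 hopt_at_left_1)
      fix \<alpha> :: real assume "\<alpha> \<in> {0<..<1}"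
      then have \<alpha>: "0 < \<alpha>" "\<alpha> < 1" by auto
      show "hopt \<alpha> > 0" using hopt_pos[OF \<alpha>] .
      show "?\<Lambda> \<alpha> = Inf {Fcyl p \<tau> (2 * h) k (stripe1 h \<alpha>) | h. h > 0}"
        using Lam[OF \<alpha>] inner[OF \<alpha>] by simp
      fix h :: real assume h: "h > 0"
      show "Fcyl p \<tau> (2 * h) k (stripe1 h \<alpha>) = ?\<Lambda> \<alpha> \<longleftrightarrow> h = hopt \<alpha>"
        using stripe[OF h \<alpha>, of k] Lam[OF \<alpha>] energy_minimal[OF \<alpha> h]
        by (cases "h = hopt \<alpha>") (auto simp: optimal_energy_def)
    qed
    moreover have "\<exists>C2>0. \<forall>\<alpha>\<in>{0<..<1}. ?\<Lambda> differentiable (at \<alpha>)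
                 \<and> \<bar>deriv (?\<Lambda>) \<alpha>\<bar> \<le> C2"
    proof (intro exI[of _ "1 / x\<^sub>0"] conjI ballI)
      show "1 / x\<^sub>0 > 0" using x\<^sub>0_pos by simp
      fix \<alpha> :: real assume "\<alpha> \<in> {0<..<1}"
      then have \<alpha>: "0 < \<alpha>" "\<alpha> < 1" by auto
      show "?\<Lambda> differentiable (at \<alpha>)"
        using D1[OF \<alpha>] unfolding real_differentiable_def by blast
      show "\<bar>deriv (?\<Lambda>) \<alpha>\<bar> \<le> 1 / x\<^sub>0"
        using abs_marginal_le[OF \<alpha>] by (simp add: d1[OF \<alpha>])
    qed
    moreover have "strictly_convex_on {0<..<1} (?\<Lambda>)"
      using D1 strictly_convex_optimal_energy
      unfolding strictly_convex_on_def
    proof (intro ballI allI impI)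
      fix u v t :: real assume uv: "u \<in> {0<..<1}" "v \<in> {0<..<1}" and t: "u \<noteq> v \<and> 0 < t \<and> t < 1"
      have "t * u + (1 - t) * v \<in> {0<..<1}"
        using convexD[of "{0<..<1::real}" u v t "1 - t"] uv t by simp
      then show "?\<Lambda> (t * u + (1 - t) * v) < t * ?\<Lambda> u + (1 - t) * ?\<Lambda> v"
        using strictly_convex_optimal_energy uv t Lam unfolding strictly_convex_on_def by simp
    qed
    moreover have "\<exists>c>0. \<forall>\<alpha>\<in>{0<..<1}. deriv (?\<Lambda>) differentiable (at \<alpha>)
                 \<and> deriv (deriv (?\<Lambda>)) \<alpha>
                     \<ge> c * min (\<alpha> powr (p - real CARD('n))) ((1 - \<alpha>) powr (p - real CARD('n)))"
    proof (intro exI[of _ c] conjI c(1) ballI)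
      fix \<alpha> :: real assume "\<alpha> \<in> {0<..<1}"
      then have \<alpha>: "0 < \<alpha>" "\<alpha> < 1" by auto
      obtain m where m: "(marginal has_real_derivative m) (at \<alpha>)" "c * min (\<alpha> powr (r + 2)) ((1 - \<alpha>) powr (r + 2)) \<le> m"
        using c(2)[OF \<alpha>] by blast
      show "deriv (?\<Lambda>) differentiable (at \<alpha>)"
        using D2[OF \<alpha> m(1)] by (auto simp: real_differentiable_def)
      show "deriv (deriv (?\<Lambda>)) \<alpha>
          \<ge> c * min (\<alpha> powr (p - real CARD('n))) ((1 - \<alpha>) powr (p - real CARD('n)))"
        using DERIV_imp_deriv[OF D2[OF \<alpha> m(1)]] m(2) by (simp add: r2)
    qed
    ultimately show "?P \<tau>" by (intro conjI)
  qed
qed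

end
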